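(* Let $n\ge 2$, let $I$ be an inner function in $\mathbb{D}^n$, let $\alpha\in\mathbb{T}$, and let $\sigma_\alpha=\sigma_\alpha[I]$ be the corresponding Clark measure. Then the following properties are equivalent: (i) $T_\alpha: I^*(H^2)\to L^2(\sigma_\alpha)$ is a unitary operator; (ii) $(f\sigma_\alpha)_+\not\equiv 0$ (as a function on $\mathbb{D}^n$) for any $f\in L^2(\sigma_\alpha)$, $f\not\equiv 0$ (i.e. $f\neq0$ as an element of $L^2(\sigma_\alpha)$); (iii) the polydisc algebra $A(\mathbb{D}^n)$ is dense in $L^2(\sigma_\alpha)$.
   Context: $\mathbb{D}$ is the open unit disc of $\mathbb{C}$ and $\mathbb{T}=\partial\mathbb{D}$. $m_n$ is the normalized Lebesgue measure on $\mathbb{T}^n$. Cauchy kernel: $C(z,\zeta)=\prod_{j=1}^n\frac{1}{1-z_j\overline{\zeta_j}}$ (used whenever the product makes sense, in particular if one of $z,\zeta$ lies in $\mathbb{D}^n$ and the other in $\mathbb{D}^n\cup\mathbb{T}^n$). For a complex Borel measure $\mu$ on $\mathbb{T}^n$, its Cauchy transform is $\mu_+(z)=\int_{\mathbb{T}^n}C(z,\xi)\,d\mu(\xi)$, $z\in\mathbb{D}^n$. Poisson kernel: $P(z,\zeta)=\frac{C(z,\zeta)C(\zeta,z)}{C(z,z)}=\prod_{j=1}^n\frac{1-|z_j|^2}{|1-z_j\overline{\zeta_j}|^2}$, $z\in\mathbb{D}^n$, $\zeta\in\mathbb{T}^n$; $P[\mu](z)=\int_{\mathbb{T}^n}P(z,\zeta)\,d\mu(\zeta)$.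 A holomorphic function $I:\mathbb{D}^n\to\mathbb{D}$ is inner if $|I(\zeta)|=1$ for $m_n$-a.e. $\zeta\in\mathbb{T}^n$, where $I(\zeta)=\lim_{r\to1-}I(r\zeta)$ (the limit exists $m_n$-a.e.). Clark measure: for $\alpha\in\mathbb{T}$, $\sigma_\alpha[I]$ is the unique positive Borel measure on $\mathbb{T}^n$ such that $P[\sigma_\alpha[I]](z)=\mathrm{Re}\left(\frac{\alpha+I(z)}{\alpha-I(z)}\right)$, $z\in\mathbb{D}^n$. $H^2$ is the Hardy space of the polydisc: holomorphic $f$ on $\mathbb{D}^n$ with $\sup_{0<r<1}\int_{\mathbb{T}^n}|f(r\zeta)|^2\,dm_n(\zeta)<\infty$, identified with the space of boundary values, a closed subspace of $L^2(\mathbb{T}^n,m_n)$. $I^*(H^2)=H^2\ominus IH^2$ is the orthogonal complement of $IH^2$ in $H^2$. Its reproducing kernel is $K(z,w)=(1-I(z)\overline{I(w)})\,C(z,w)$, $z,w\in\mathbb{D}^n$, and $K_w(z)=K(z,w)$. The operator $T_\alpha$: it is the unique linear isometric operator from $I^*(H^2)$ into $L^2(\sigma_\alpha)$ such that $(T_\alpha K_w)(\xi)=(1-\alpha\overline{I(w)})\,C(\xi,w)$, $\xi\in\mathbb{T}^n$, for every $w\in\mathbb{D}^n$ (such an operator exists and is unique). It is unitary if and only if it is onto. The polydisc algebra $A(\mathbb{D}^n)$ consists of those $f\in C(\overline{\mathbb{D}}^n)$ which are holomorphic in $\mathbb{D}^n$; its elements are regarded as elements of $L^2(\sigma_\alpha)$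 by restriction to $\mathbb{T}^n$. *)

theory Defs
  imports "HOL-Analysis.Analysis"
begin

section \<open>Polydisc and torus\<close>

definition polydisc :: "(complex ^ 'n) set" where
  "polydisc = {z. \<forall>j. norm (z $ j) < 1}"

definition closed_polydisc :: "(complex ^ 'n) set" where
  "closed_polydisc = {z. \<forall>j. norm (z $ j) \<le> 1}"

definition torus :: "(complex ^ 'n) set" where
  "torus = {z. \<forall>j. norm (z $ j) = 1}"

abbreviation torus_borel :: "(complex ^ 'n) measure" where
  "torus_borel \<equiv> restrict_space borel torus"

definition torus_measure :: "(complex ^ 'n) measure" where
  "torus_measure =
     distr (PiM UNIV (\<lambda>_::'n. uniform_measure lborel {0..2 * pi})) torus_borel
       (\<lambda>t. \<chi> j. cis (t j))"

text \<open>Holomorphy in several variables: complex differentiability, that is, real Frechet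
  differentiability with complex-linear derivative (only used on open sets).\<close>

definition holomorphic_sv :: "(complex ^ 'n \<Rightarrow> complex) \<Rightarrow> (complex ^ 'n) set \<Rightarrow> bool" where
  "holomorphic_sv f S \<longleftrightarrow>
     (\<forall>z\<in>S. \<exists>D. (f has_derivative D) (at z) \<and> (\<forall>c v. D (c *s v) = c * D v))"

definition polydisc_algebra :: "(complex ^ 'n \<Rightarrow> complex) set" where
  "polydisc_algebra = {f. continuous_on closed_polydisc f \<and> holomorphic_sv f polydisc}"


section \<open>Kernels and transforms\<close>

definition cauchy_kernel :: "complex ^ 'n \<Rightarrow> complex ^ 'n \<Rightarrow> complex" where
  "cauchy_kernel z \<zeta> = (\<Prod>j\<in>UNIV. 1 / (1 - z $ j * cnj (\<zeta> $ j)))"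

definition poisson_kernel :: "complex ^ 'n \<Rightarrow> complex ^ 'n \<Rightarrow> real" where
  "poisson_kernel z \<zeta> =
     (\<Prod>j\<in>UNIV. (1 - (norm (z $ j))\<^sup>2) / (norm (1 - z $ j * cnj (\<zeta> $ j)))\<^sup>2)"

lemma poisson_kernel_eq_cauchy_kernel:
  assumes "z \<in> polydisc" "\<zeta> \<in> torus"
  shows "of_real (poisson_kernel z \<zeta>) =
           cauchy_kernel z \<zeta> * cauchy_kernel \<zeta> z / cauchy_kernel z z"
proof -
  have *: "of_real ((1 - (norm (z $ j))\<^sup>2) / (norm (1 - z $ j * cnj (\<zeta> $ j)))\<^sup>2) =
      (1 / (1 - z $ j * cnj (\<zeta> $ j))) * (1 / (1 - \<zeta> $ j * cnj (z $ j)))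
        / (1 / (1 - z $ j * cnj (z $ j)))" for j
    by (simp add: complex_norm_square mult.commute del: of_real_power)
  show ?thesis
    unfolding poisson_kernel_def cauchy_kernel_def of_real_prod prod.distrib [symmetric]
      prod_dividef [symmetric] * ..
qed

definition poisson_integral :: "(complex ^ 'n) measure \<Rightarrow> complex ^ 'n \<Rightarrow> real" where
  "poisson_integral \<mu> z = (\<integral>\<zeta>. poisson_kernel z \<zeta> \<partial>\<mu>)"

text \<open>The Cauchy transform of the complex measure with density \<open>f\<close> with respect to the
  positive measure \<open>\<sigma>\<close>.\<close>

definition cauchy_transform ::
    "(complex ^ 'n) measure \<Rightarrow> (complex ^ 'n \<Rightarrow> complex) \<Rightarrow> complex ^ 'n \<Rightarrow> complex" where
  "cauchy_transform \<sigma> f z = (\<integral>\<xi>. cauchy_kernel z \<xi> * f \<xi> \<partial>\<sigma>)"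


section \<open>Inner functions and Clark measures\<close>

text \<open>Functions on the polydisc are total functions on the ambient space, whose values
  outside the polydisc are never used.\<close>

definition inner_function :: "(complex ^ 'n \<Rightarrow> complex) \<Rightarrow> bool" where
  "inner_function I \<longleftrightarrow>
     holomorphic_sv I polydisc \<and> (\<forall>z\<in>polydisc. norm (I z) < 1) \<and>
     (AE \<zeta> in torus_measure.
        \<exists>l. ((\<lambda>r. I (r *\<^sub>R \<zeta>)) \<longlongrightarrow> l) (at_left 1) \<and> norm l = 1)"

definition clark_measure ::
    "(complex ^ 'n \<Rightarrow> complex) \<Rightarrow> complex \<Rightarrow> (complex ^ 'n) measure \<Rightarrow> bool" where
  "clark_measure I \<alpha> \<sigma> \<longleftrightarrow>
     sets \<sigma> = sets torus_borel \<and> finite_measure \<sigma> \<and>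
     (\<forall>z\<in>polydisc. poisson_integral \<sigma> z = Re ((\<alpha> + I z) / (\<alpha> - I z)))"


section \<open>Square integrable functions and Hardy space\<close>

text \<open>Elements of an \<open>L\<^sup>2\<close> space are handled through representatives; equality in the space is
  equality almost everywhere.\<close>

definition L2 :: "'a measure \<Rightarrow> ('a \<Rightarrow> complex) set" where
  "L2 M = {f \<in> borel_measurable M. integrable M (\<lambda>x. (norm (f x))\<^sup>2)}"

definition L2_norm :: "'a measure \<Rightarrow> ('a \<Rightarrow> complex) \<Rightarrow> real" where
  "L2_norm M f = sqrt (\<integral>x. (norm (f x))\<^sup>2 \<partial>M)"

definition hardy2 :: "(complex ^ 'n \<Rightarrow> complex) set" where
  "hardy2 = {f. holomorphic_sv f polydisc \<and>
     bdd_above ((\<lambda>r. \<integral>\<zeta>. (norm (f (r *\<^sub>R \<zeta>)))\<^sup>2 \<partial>torus_measure) ` {0<..<1})}"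

text \<open>Radial boundary values; for functions in the Hardy space the limit exists almost
  everywhere on the torus.\<close>

definition boundary_value :: "(complex ^ 'n \<Rightarrow> complex) \<Rightarrow> complex ^ 'n \<Rightarrow> complex" where
  "boundary_value f \<zeta> = Lim (at_left 1) (\<lambda>r. f (r *\<^sub>R \<zeta>))"

definition hardy2_inner ::
    "(complex ^ 'n \<Rightarrow> complex) \<Rightarrow> (complex ^ 'n \<Rightarrow> complex) \<Rightarrow> complex" where
  "hardy2_inner f g =
     (\<integral>\<zeta>. boundary_value f \<zeta> * cnj (boundary_value g \<zeta>) \<partial>torus_measure)"

definition hardy2_norm :: "(complex ^ 'n \<Rightarrow> complex) \<Rightarrow> real" where
  "hardy2_norm f = L2_norm torus_measure (boundary_value f)"


section \<open>Model space and the Clark operator\<close>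

definition model_space :: "(complex ^ 'n \<Rightarrow> complex) \<Rightarrow> (complex ^ 'n \<Rightarrow> complex) set" where
  "model_space I = {f \<in> hardy2. \<forall>g\<in>hardy2. hardy2_inner f (\<lambda>z. I z * g z) = 0}"

definition model_kernel ::
    "(complex ^ 'n \<Rightarrow> complex) \<Rightarrow> complex ^ 'n \<Rightarrow> complex ^ 'n \<Rightarrow> complex" where
  "model_kernel I w z = (1 - I z * cnj (I w)) * cauchy_kernel z w"

definition linear_isometry_model ::
    "(complex ^ 'n \<Rightarrow> complex) \<Rightarrow> (complex ^ 'n) measure \<Rightarrow>
     ((complex ^ 'n \<Rightarrow> complex) \<Rightarrow> (complex ^ 'n \<Rightarrow> complex)) \<Rightarrow> bool" where
  "linear_isometry_model I \<sigma> T \<longleftrightarrow>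
     (\<forall>f\<in>model_space I. T f \<in> L2 \<sigma>) \<and>
     (\<forall>f\<in>model_space I. \<forall>g\<in>model_space I. \<forall>a b.
        AE \<xi> in \<sigma>. T (\<lambda>z. a * f z + b * g z) \<xi> = a * T f \<xi> + b * T g \<xi>) \<and>
     (\<forall>f\<in>model_space I. L2_norm \<sigma> (T f) = hardy2_norm f)"

definition unitary_model ::
    "(complex ^ 'n \<Rightarrow> complex) \<Rightarrow> (complex ^ 'n) measure \<Rightarrow>
     ((complex ^ 'n \<Rightarrow> complex) \<Rightarrow> (complex ^ 'n \<Rightarrow> complex)) \<Rightarrow> bool" where
  "unitary_model I \<sigma> T \<longleftrightarrow>
     linear_isometry_model I \<sigma> T \<and>
     (\<forall>h\<in>L2 \<sigma>. \<exists>f\<in>model_space I. AE \<xi> in \<sigma>. T f \<xi> = h \<xi>)"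

definition clark_operator ::
    "(complex ^ 'n \<Rightarrow> complex) \<Rightarrow> complex \<Rightarrow> (complex ^ 'n) measure \<Rightarrow>
     ((complex ^ 'n \<Rightarrow> complex) \<Rightarrow> (complex ^ 'n \<Rightarrow> complex)) \<Rightarrow> bool" where
  "clark_operator I \<alpha> \<sigma> T \<longleftrightarrow>
     linear_isometry_model I \<sigma> T \<and>
     (\<forall>w\<in>polydisc. AE \<xi> in \<sigma>.
        T (model_kernel I w) \<xi> = (1 - \<alpha> * cnj (I w)) * cauchy_kernel \<xi> w)"

definition dense_in_L2 :: "('a \<Rightarrow> complex) set \<Rightarrow> 'a measure \<Rightarrow> bool" where
  "dense_in_L2 A M \<longleftrightarrow>
     A \<subseteq> L2 M \<and> (\<forall>f\<in>L2 M. \<forall>\<epsilon>>0. \<exists>g\<in>A. L2_norm M (\<lambda>x. f x - g x) < \<epsilon>)"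

end

theory Submission
  imports Defs "HOL-Complex_Analysis.Cauchy_Integral_Formula"
begin

text \<open>The Cauchy transform of \<open>f \<sigma>\<close> at \<open>z\<close> is the inner product of \<open>f\<close> with the Cauchy kernel at
  \<open>z\<close>, and the Clark operator maps the reproducing kernels of the model space to nonzero multiples
  of the Cauchy kernels. So the kernels lie in the range of the isometry, and a vector \<open>T g\<close>
  orthogonal to them has \<open>g = 0\<close> by the reproducing property; since the model space is complete,
  the range is closed and injectivity of the Cauchy transform makes it everything. The Cauchy
  kernels lie in the polydisc algebra, and conversely each dilate of an element of the algebra is
  an average of Cauchy kernels by the Cauchy formula, so both have the same orthogonal complement.

  The reproducing property refers to radial boundary values, whose existence is Fatou's theorem in
  the Hardy space of the polydisc. It follows from a maximal inequality for \<open>f (r \<zeta>)\<close>: averages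
  over a geometric sequence of radii are controlled by the maximal ergodic theorem for the Poisson
  kernel, and the deviation from the averages by a discrete Littlewood-Paley function.\<close>

section \<open>Square integrable functions\<close>

text \<open>Everything about boundary values comes from a few properties of averaging against the
  Poisson kernel: it is positive and self-adjoint, fixes constants, and takes the dilate of
  \<open>f\<close> by \<open>r\<close> to the dilate by \<open>r * x\<close>. Consequently
  \<open>mean_square f\<close> is convex along geometric sequences of radii
  (\<open>dilation_diff_norm\<close>). Combined with boundedness, this one fact gives monotone
  means, L2 convergence of the dilates and, after weighting the second differences, the bound for
  the square function. L2 convergence alone is not enough, because \<open>boundary_value\<close> is
  a pointwise radial limit with an arbitrary value where there is none. The maximal inequality
  bridges this gap when it is applied to the difference of \<open>f\<close> and one of its own
  dilates: the difference has small norm, and the dilate is continuous up to the torus. A second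
  obstacle is the use of representatives: \<open>T\<close> is linear only almost everywhere, and
  members of the model space are determined only inside \<open>polydisc\<close>. The arguments
  therefore compare norms and almost everywhere classes instead of functions.\<close>

definition L2_inner :: "'a measure \<Rightarrow> ('a \<Rightarrow> complex) \<Rightarrow> ('a \<Rightarrow> complex) \<Rightarrow> complex" where
  "L2_inner M f g = (\<integral>x. f x * cnj (g x) \<partial>M)"

lemma L2_measurable [measurable_dest]: "f \<in> L2 M \<Longrightarrow> f \<in> borel_measurable M"
  by (simp add: L2_def)

lemma L2_integrable_square: "f \<in> L2 M \<Longrightarrow> integrable M (\<lambda>x. (norm (f x))\<^sup>2)"
  by (simp add: L2_def)

lemma borel_measurable_cnj [measurable (raw)]:
  "f \<in> borel_measurable M \<Longrightarrow> (\<lambda>x. cnj (f x)) \<in> borel_measurable M"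
  by (rule measurable_compose[OF _ borel_measurable_continuous_onI[OF continuous_on_cnj[OF continuous_on_id]]])

lemma L2_norm_nonneg [simp]: "0 \<le> L2_norm M f"
  by (simp add: L2_norm_def)

lemma L2_norm_square: "(L2_norm M f)\<^sup>2 = (\<integral>x. (norm (f x))\<^sup>2 \<partial>M)"
  by (simp add: L2_norm_def)

lemma L2_integrable_mult_cnj:
  assumes "f \<in> L2 M" "g \<in> L2 M"
  shows "integrable M (\<lambda>x. f x * cnj (g x))"
proof (rule Bochner_Integration.integrable_bound)
  show "integrable M (\<lambda>x. (norm (f x))\<^sup>2 + (norm (g x))\<^sup>2)"
    using assms by (intro Bochner_Integration.integrable_add L2_integrable_square)
  show "(\<lambda>x. f x * cnj (g x)) \<in> borel_measurable M"
    using assms[THEN L2_measurable] by measurable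
  have "norm (f x * cnj (g x)) \<le> (norm (f x))\<^sup>2 + (norm (g x))\<^sup>2" for x
    using sum_squares_bound[of "norm (f x)" "norm (g x)"]
      mult_nonneg_nonneg[OF norm_ge_zero[of "f x"] norm_ge_zero[of "g x"]]
    unfolding norm_mult complex_mod_cnj by linarith
  then show "AE x in M. norm (f x * cnj (g x)) \<le> norm ((norm (f x))\<^sup>2 + (norm (g x))\<^sup>2)"
    by (auto intro: order_trans)
qed

lemma norm_square_lincomb_le:
  fixes a b u v :: complex
  shows "(norm (a * u + b * v))\<^sup>2 \<le> 2 * ((norm a)\<^sup>2 * (norm u)\<^sup>2 + (norm b)\<^sup>2 * (norm v)\<^sup>2)"
proof -
  have "(norm (a * u + b * v))\<^sup>2 \<le> (norm a * norm u + norm b * norm v)\<^sup>2"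
    using norm_triangle_ineq[of "a * u" "b * v"] by (intro power_mono) (auto simp: norm_mult)
  also have "\<dots> \<le> 2 * ((norm a * norm u)\<^sup>2 + (norm b * norm v)\<^sup>2)"
    using sum_squares_bound[of "norm a * norm u" "norm b * norm v"] by (simp add: power2_sum)
  finally show ?thesis by (simp add: power_mult_distrib)
qed

lemma L2_lincomb:
  assumes "f \<in> L2 M" "g \<in> L2 M"
  shows "(\<lambda>x. a * f x + b * g x) \<in> L2 M"
proof -
  have [measurable]: "f \<in> borel_measurable M" "g \<in> borel_measurable M"
    using assms by (auto simp: L2_def)
  have "integrable M (\<lambda>x. (norm (a * f x + b * g x))\<^sup>2)"
  proof (rule Bochner_Integration.integrable_bound)
    show "integrable M (\<lambda>x. 2 * ((norm a)\<^sup>2 * (norm (f x))\<^sup>2 + (norm b)\<^sup>2 * (norm (g x))\<^sup>2))"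
      using assms by (intro integrable_mult_right Bochner_Integration.integrable_add L2_integrable_square)
    show "(\<lambda>x. (norm (a * f x + b * g x))\<^sup>2) \<in> borel_measurable M" by measurable
  qed (use norm_square_lincomb_le in auto)
  then show ?thesis by (simp add: L2_def)
qed

lemma L2_add: "f \<in> L2 M \<Longrightarrow> g \<in> L2 M \<Longrightarrow> (\<lambda>x. f x + g x) \<in> L2 M"
  and L2_diff: "f \<in> L2 M \<Longrightarrow> g \<in> L2 M \<Longrightarrow> (\<lambda>x. f x - g x) \<in> L2 M"
  and L2_cmult: "f \<in> L2 M \<Longrightarrow> (\<lambda>x. a * f x) \<in> L2 M"
  using L2_lincomb[of f M g 1 1] L2_lincomb[of f M g 1 "-1"] L2_lincomb[of f M f a 0] by auto

lemma L2_inner_add_left: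
  "f \<in> L2 M \<Longrightarrow> g \<in> L2 M \<Longrightarrow> h \<in> L2 M \<Longrightarrow>
    L2_inner M (\<lambda>x. a * f x + b * g x) h = a * L2_inner M f h + b * L2_inner M g h"
  unfolding L2_inner_def
  using L2_integrable_mult_cnj[of f M h] L2_integrable_mult_cnj[of g M h]
  by (simp add: distrib_right mult.assoc)

lemma L2_inner_diff_left:
  "f \<in> L2 M \<Longrightarrow> g \<in> L2 M \<Longrightarrow> h \<in> L2 M \<Longrightarrow>
    L2_inner M (\<lambda>x. f x - g x) h = L2_inner M f h - L2_inner M g h"
  using L2_inner_add_left[of f M g h 1 "-1"] by simp

lemma L2_inner_commute: "L2_inner M g f = cnj (L2_inner M f g)"
  unfolding L2_inner_def by (simp flip: Bochner_Integration.integral_cnj add: mult.commute)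

lemma L2_inner_self: "L2_inner M f f = of_real ((L2_norm M f)\<^sup>2)"
  unfolding L2_inner_def L2_norm_square
  by (simp flip: complex_norm_square of_real_power)

text \<open>The two cross terms in the expanded inner product are conjugate to each other, so a real
  part remains. Polarization, the parallelogram law and the variational arguments below are
  instances for special \<open>a\<close> and \<open>b\<close>.\<close>

lemma L2_norm_lincomb:
  assumes f: "f \<in> L2 M" and g: "g \<in> L2 M"
  shows "(L2_norm M (\<lambda>x. a * f x + b * g x))\<^sup>2 =
    (norm a)\<^sup>2 * (L2_norm M f)\<^sup>2 + (norm b)\<^sup>2 * (L2_norm M g)\<^sup>2 + 2 * Re (a * cnj b * L2_inner M f g)"
proof -
  let ?h = "\<lambda>x. a * f x + b * g x"
  have h: "?h \<in> L2 M" using f g by (rule L2_lincomb)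
  have "L2_inner M ?h ?h = a * L2_inner M f ?h + b * L2_inner M g ?h"
    using f g h by (rule L2_inner_add_left)
  also have "L2_inner M f ?h = cnj (a * L2_inner M f f + b * L2_inner M g f)"
    using L2_inner_commute[of M f ?h] L2_inner_add_left[OF f g f] by simp
  also have "L2_inner M g ?h = cnj (a * L2_inner M f g + b * L2_inner M g g)"
    using L2_inner_commute[of M g ?h] L2_inner_add_left[OF f g g] by simp
  also have "L2_inner M g f = cnj (L2_inner M f g)" by (rule L2_inner_commute)
  finally have "Re (L2_inner M ?h ?h) = Re (a * cnj (a * L2_inner M f f + b * cnj (L2_inner M f g))
      + b * cnj (a * L2_inner M f g + b * L2_inner M g g))" by simp
  then show ?thesis
    unfolding cmod_power2 L2_inner_self by (simp add: algebra_simps power2_eq_square)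
qed

lemma L2_norm_zero_AE:
  assumes "f \<in> L2 M" "L2_norm M f = 0"
  shows "AE x in M. f x = 0"
proof -
  have "(\<integral>x. (norm (f x))\<^sup>2 \<partial>M) = 0" using assms(2) L2_norm_square[of M f] by simp
  then have "AE x in M. (norm (f x))\<^sup>2 = 0"
    using L2_integrable_square[OF assms(1)] by (subst (asm) integral_nonneg_eq_0_iff_AE) auto
  then show ?thesis by auto
qed

lemma L2_norm_cong_AE:
  assumes "AE x in M. f x = g x" "f \<in> borel_measurable M" "g \<in> borel_measurable M"
  shows "L2_norm M f = L2_norm M g"
proof -
  have [measurable]: "f \<in> borel_measurable M" "g \<in> borel_measurable M" by fact+
  show ?thesis unfolding L2_norm_def
    by (intro arg_cong[where f=sqrt] integral_cong_AE) (use assms(1) in auto)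
qed

lemma L2_inner_cong_AE:
  assumes "AE x in M. f x = f' x" "AE x in M. g x = g' x"
    "f \<in> borel_measurable M" "g \<in> borel_measurable M"
    "f' \<in> borel_measurable M" "g' \<in> borel_measurable M"
  shows "L2_inner M f g = L2_inner M f' g'"
proof -
  have [measurable]: "f \<in> borel_measurable M" "g \<in> borel_measurable M"
    "f' \<in> borel_measurable M" "g' \<in> borel_measurable M"by fact+
  show ?thesis unfolding L2_inner_def
    by (intro integral_cong_AE) (use assms(1,2) in auto)
qed

lemma L2_Cauchy_Schwarz:
  assumes f: "f \<in> L2 M" and g: "g \<in> L2 M"
  shows "norm (L2_inner M f g) \<le> L2_norm M f * L2_norm M g"
proof (cases "L2_norm M g = 0")
  case True
  have "AE x in M. f x * cnj (g x) = 0"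
    using L2_norm_zero_AE[OF g True] by eventually_elim simp
  then have "L2_inner M f g = 0"
    unfolding L2_inner_def by (rule integral_eq_zero_AE)
  then show ?thesis by simp
next
  case False
  define G where "G = L2_norm M g"
  have G: "G > 0" using False unfolding G_def by (simp add: less_le)
  let ?i = "L2_inner M f g"
  \<comment> \<open>This is the component of \<open>f\<close> orthogonal to \<open>g\<close>, scaled
    by \<open>G^2\<close> to avoid a denominator. Expanding its squared norm and cancelling
    \<open>G^2\<close> gives the inequality.\<close>
  have "0 \<le> (L2_norm M (\<lambda>x. of_real (G\<^sup>2) * f x + (- ?i) * g x))\<^sup>2" by simp
  also have "\<dots> = (G\<^sup>2)\<^sup>2 * (L2_norm M f)\<^sup>2 + (norm ?i)\<^sup>2 * G\<^sup>2 + 2 * Re (of_real (G\<^sup>2) * cnj (- ?i) * ?i)"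
    unfolding L2_norm_lincomb[OF f g] by (simp add: G_def norm_power)
  also have "of_real (G\<^sup>2) * cnj (- ?i) * ?i = of_real (- (G\<^sup>2 * (norm ?i)\<^sup>2))"
    using complex_norm_square[of ?i] by simp
  finally have "G\<^sup>2 * (norm ?i)\<^sup>2 \<le> G\<^sup>2 * (G * L2_norm M f)\<^sup>2"
    by (simp add: power2_eq_square algebra_simps)
  then have "(norm ?i)\<^sup>2 \<le> (G * L2_norm M f)\<^sup>2"
    by (rule mult_left_le_imp_le) (use G in simp)
  then have "norm ?i \<le> G * L2_norm M f" by (rule power2_le_imp_le) (use G in simp)
  then show ?thesis by (simp add: G_def mult.commute)
qed

lemma L2_norm_triangle:
  assumes f: "f \<in> L2 M" and g: "g \<in> L2 M"
  shows "L2_norm M (\<lambda>x. f x + g x) \<le> L2_norm M f + L2_norm M g"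
proof (rule power2_le_imp_le)
  have "(L2_norm M (\<lambda>x. f x + g x))\<^sup>2 = (L2_norm M f)\<^sup>2 + (L2_norm M g)\<^sup>2 + 2 * Re (L2_inner M f g)"
    using L2_norm_lincomb[OF f g, of 1 1] by simp
  also have "Re (L2_inner M f g) \<le> L2_norm M f * L2_norm M g"
    using L2_Cauchy_Schwarz[OF f g] complex_Re_le_cmod order_trans by blast
  finally show "(L2_norm M (\<lambda>x. f x + g x))\<^sup>2 \<le> (L2_norm M f + L2_norm M g)\<^sup>2"
    by (simp add: power2_sum)
qed simp

lemma L2_norm_minus_commute: "L2_norm M (\<lambda>x. f x - g x) = L2_norm M (\<lambda>x. g x - f x)"
  by (simp add: L2_norm_def norm_minus_commute)

lemma L2_norm_triangle_diff:
  assumes "f \<in> L2 M" "g \<in> L2 M" "h \<in> L2 M"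
  shows "L2_norm M (\<lambda>x. f x - h x) \<le> L2_norm M (\<lambda>x. f x - g x) + L2_norm M (\<lambda>x. g x - h x)"
  using L2_norm_triangle[OF L2_diff[OF assms(1,2)] L2_diff[OF assms(2,3)]] by simp

text \<open>Fatou's lemma for the squared norms yields integrability of the limit together with its
  bound. The bound is asked only eventually, so that tails of Cauchy sequences can be used.\<close>

lemma L2_Fatou:
  assumes "\<And>m. f m \<in> borel_measurable M" "g \<in> borel_measurable M"
    and lim: "AE x in M. (\<lambda>m. f m x) \<longlonglongrightarrow> g x"
    and bd: "eventually (\<lambda>m. f m \<in> L2 M \<and> L2_norm M (f m) \<le> B) sequentially"
  shows "g \<in> L2 M" "L2_norm M g \<le> B"
proof -
  have [measurable]: "\<And>m. f m \<in> borel_measurable M" "g \<in> borel_measurable M" by fact+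
  obtain m where "L2_norm M (f m) \<le> B"
    using eventually_happens[OF bd] by auto
  then have B0: "B \<ge> 0" using L2_norm_nonneg[of M "f m"] by linarith
  have "(\<integral>\<^sup>+x. ennreal ((norm (g x))\<^sup>2) \<partial>M) = (\<integral>\<^sup>+x. liminf (\<lambda>m. ennreal ((norm (f m x))\<^sup>2)) \<partial>M)"
  proof (rule nn_integral_cong_AE)
    show "AE x in M. ennreal ((norm (g x))\<^sup>2) = liminf (\<lambda>m. ennreal ((norm (f m x))\<^sup>2))"
      using lim
    proof eventually_elim
      case (elim x)
      then have "(\<lambda>m. ennreal ((norm (f m x))\<^sup>2)) \<longlonglongrightarrow> ennreal ((norm (g x))\<^sup>2)"
        by (intro tendsto_intros)
      then show ?case by (intro lim_imp_Liminf[symmetric]) auto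
    qed
  qed
  also have "\<dots> \<le> liminf (\<lambda>m. \<integral>\<^sup>+x. ennreal ((norm (f m x))\<^sup>2) \<partial>M)"
    by (rule nn_integral_liminf) measurable
  also have "\<dots> \<le> ennreal (B\<^sup>2)"
  proof (rule Liminf_le)
    show "\<forall>\<^sub>F m in sequentially. (\<integral>\<^sup>+x. ennreal ((norm (f m x))\<^sup>2) \<partial>M) \<le> ennreal (B\<^sup>2)"
      using bd
    proof eventually_elim
      case (elim m)
      have "(\<integral>\<^sup>+x. ennreal ((norm (f m x))\<^sup>2) \<partial>M) = ennreal ((L2_norm M (f m))\<^sup>2)"
        unfolding L2_norm_square using elim
        by (intro nn_integral_eq_integral L2_integrable_square) auto
      also have "\<dots> \<le> ennreal (B\<^sup>2)" using elim by (intro ennreal_leI power_mono) auto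
      finally show ?case .
    qed
  qed auto
  finally have *: "(\<integral>\<^sup>+x. ennreal ((norm (g x))\<^sup>2) \<partial>M) \<le> ennreal (B\<^sup>2)" .
  have int: "integrable M (\<lambda>x. (norm (g x))\<^sup>2)"
    by (rule integrableI_bounded) (use * in \<open>auto simp: top.not_eq_extremum intro: le_less_trans\<close>)
  then show "g \<in> L2 M" by (simp add: L2_def)
  have "(L2_norm M g)\<^sup>2 \<le> B\<^sup>2"
    using * nn_integral_eq_integral[OF int] by (simp add: L2_norm_square)
  then show "L2_norm M g \<le> B" using B0 by (rule power2_le_imp_le)
qed

lemma (in finite_measure) L2_bounded:
  assumes "f \<in> borel_measurable M" "\<And>x. x \<in> space M \<Longrightarrow> norm (f x) \<le> B"
  shows "f \<in> L2 M"
proof -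
  have [measurable]: "f \<in> borel_measurable M" by fact
  have "integrable M (\<lambda>x. (norm (f x))\<^sup>2)"
  proof (rule integrable_const_bound[of _ "B\<^sup>2"])
    show "AE x in M. norm ((norm (f x))\<^sup>2) \<le> B\<^sup>2"
      using assms(2) by (intro AE_I2) (auto intro!: power_mono)
  qed measurable
  then show ?thesis by (simp add: L2_def)
qed

lemma (in finite_measure) L2_integrable:
  assumes "f \<in> L2 M"
  shows "integrable M f"
  using L2_integrable_mult_cnj[OF assms L2_bounded[of "\<lambda>_. 1" 1]] by simp

text \<open>Cauchy-Schwarz against the constant 1.\<close>

lemma (in finite_measure) L1_le_L2_norm:
  assumes "f \<in> L2 M"
  shows "(\<integral>x. norm (f x) \<partial>M) \<le> L2_norm M f * sqrt (measure M (space M))"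
proof -
  have nf: "(\<lambda>x. of_real (norm (f x)) :: complex) \<in> L2 M"
    using assms by (auto simp: L2_def)
  have one: "(\<lambda>_. 1) \<in> L2 M" by (rule L2_bounded[of _ 1]) auto
  have "norm (L2_inner M (\<lambda>x. of_real (norm (f x))) (\<lambda>_. 1)) \<le> L2_norm M f * L2_norm M (\<lambda>_. 1)"
    using L2_Cauchy_Schwarz[OF nf one] by (simp add: L2_norm_def)
  then show ?thesis
    by (simp add: L2_inner_def L2_norm_def)
qed

text \<open>Riesz-Fischer: along a rapidly convergent subsequence the increments have finite total
  L1 norm, so the subsequence converges almost everywhere. \<open>L2_Fatou\<close> then upgrades
  this to convergence of the whole sequence in norm.\<close>

lemma (in finite_measure) L2_complete:
  fixes f :: "nat \<Rightarrow> 'a \<Rightarrow> complex"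
  assumes f: "\<And>n. f n \<in> L2 M"
    and Cauchy: "\<And>e. e > 0 \<Longrightarrow> \<exists>N. \<forall>m\<ge>N. \<forall>n\<ge>N. L2_norm M (\<lambda>x. f m x - f n x) < e"
  obtains g where "g \<in> L2 M" "(\<lambda>n. L2_norm M (\<lambda>x. g x - f n x)) \<longlonglongrightarrow> 0"
proof -
  have [measurable]: "f n \<in> borel_measurable M" for n using f by (rule L2_measurable)
  have "\<forall>k. \<exists>N. \<forall>m\<ge>N. \<forall>n\<ge>N. L2_norm M (\<lambda>x. f m x - f n x) < (1/2) ^ k"
    by (intro allI Cauchy) simp
  from choice[OF this] obtain N where
    N: "\<And>k m n. m \<ge> N k \<Longrightarrow> n \<ge> N k \<Longrightarrow> L2_norm M (\<lambda>x. f m x - f n x) < (1/2) ^ k"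
    by blast
  \<comment> \<open>Summing all thresholds \<open>N j\<close> and adding \<open>k\<close> gives
    indices that are at once nondecreasing, at least \<open>N k\<close> and at least
    \<open>k\<close>, without a recursive choice.\<close>
  define r where "r k = (\<Sum>j\<le>k. N j) + k" for k
  have rN: "N k \<le> r k" for k
    unfolding r_def using member_le_sum[of k "{..k}" N] by simp
  have rk: "k \<le> r k" and rSuc: "r k \<le> r (Suc k)" for k by (auto simp: r_def)
  define c where "c = sqrt (measure M (space M))"
  define D where "D k x = norm (f (r (Suc k)) x - f (r k) x)" for k x
  have [measurable]: "D k \<in> borel_measurable M" for k unfolding D_def by measurable
  have D: "(\<integral>\<^sup>+x. ennreal (D k x) \<partial>M) \<le> ennreal ((1/2) ^ k * c)" for k
  proof -
    have d: "(\<lambda>x. f (r (Suc k)) x - f (r k) x) \<in> L2 M" by (intro L2_diff f)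
    then have "(\<integral>\<^sup>+x. ennreal (D k x) \<partial>M) = ennreal (\<integral>x. D k x \<partial>M)"
      unfolding D_def by (intro nn_integral_eq_integral integrable_norm L2_integrable) auto
    also have "(\<integral>x. D k x \<partial>M) \<le> L2_norm M (\<lambda>x. f (r (Suc k)) x - f (r k) x) * c"
      unfolding D_def c_def using d by (rule L1_le_L2_norm)
    also have "\<dots> \<le> (1/2) ^ k * c"
      using N[of k "r (Suc k)" "r k"] rN[of k] rSuc[of k] by (intro mult_right_mono) (auto simp: c_def)
    finally show ?thesis by (simp add: ennreal_leI)
  qed
  have "(\<integral>\<^sup>+x. (\<Sum>k. ennreal (D k x)) \<partial>M) = (\<Sum>k. \<integral>\<^sup>+x. ennreal (D k x) \<partial>M)"
    by (rule nn_integral_suminf) measurable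
  also have "\<dots> \<le> (\<Sum>k. ennreal ((1/2) ^ k * c))"
    using D by (intro suminf_le) auto
  also have "\<dots> = ennreal (\<Sum>k. (1/2) ^ k * c)"
    by (intro suminf_ennreal2 summable_mult2 summable_geometric) (auto simp: c_def)
  finally have "(\<integral>\<^sup>+x. (\<Sum>k. ennreal (D k x)) \<partial>M) \<noteq> \<infinity>"
    by (auto simp: top_unique)
  then have "AE x in M. (\<Sum>k. ennreal (D k x)) \<noteq> \<infinity>"
    by (intro nn_integral_PInf_AE) auto
  then have conv: "AE x in M. convergent (\<lambda>k. f (r k) x)"
  proof eventually_elim
    case (elim x)
    then have "summable (\<lambda>k. D k x)"
      by (intro summable_suminf_not_top) (auto simp: D_def)
    then have "summable (\<lambda>k. f (r (Suc k)) x - f (r k) x)"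
      unfolding D_def by (rule summable_norm_cancel)
    then have "convergent (\<lambda>n. f (r n) x - f (r 0) x)"
      unfolding summable_iff_convergent sum_lessThan_telescope[of "\<lambda>k. f (r k) x"] .
    then show ?case
      using convergent_diff_const_right_iff by blast
  qed
  define g where "g x = lim (\<lambda>k. f (r k) x)" for x
  have [measurable]: "g \<in> borel_measurable M" unfolding g_def by measurable
  have lim: "AE x in M. (\<lambda>k. f (r k) x) \<longlonglongrightarrow> g x"
    using conv by eventually_elim (simp add: g_def convergent_LIMSEQ_iff)
  \<comment> \<open>The index \<open>n\<close> stays fixed while the other one runs to infinity
    along the subsequence, so Fatou transfers the Cauchy estimate to the limit, with a weak
    inequality.\<close>
  have bound: "(\<lambda>x. g x - f n x) \<in> L2 M \<and> L2_norm M (\<lambda>x. g x - f n x) \<le> e"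
    if NN: "\<And>m. m \<ge> NN \<Longrightarrow> L2_norm M (\<lambda>x. f m x - f n x) < e" for n e NN
  proof -
    have "AE x in M. (\<lambda>k. f (r k) x - f n x) \<longlonglongrightarrow> g x - f n x"
      using lim by eventually_elim (intro tendsto_intros)
    moreover have "eventually (\<lambda>k. (\<lambda>x. f (r k) x - f n x) \<in> L2 M \<and> L2_norm M (\<lambda>x. f (r k) x - f n x) \<le> e) sequentially"
      using eventually_ge_at_top[of NN]
    proof eventually_elim
      case (elim k)
      then show ?case using NN[of "r k"] rk[of k] by (auto intro: L2_diff f)
    qed
    ultimately show ?thesis
      using L2_Fatou[of "\<lambda>k x. f (r k) x - f n x" M "\<lambda>x. g x - f n x" e] by auto
  qed
  have ev: "\<exists>N. \<forall>n\<ge>N. (\<lambda>x. g x - f n x) \<in> L2 M \<and> L2_norm M (\<lambda>x. g x - f n x) \<le> e" if "e > 0" for e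
    using Cauchy[OF that] bound by metis
  obtain n0 where "(\<lambda>x. g x - f n0 x) \<in> L2 M" using ev[of 1] by auto
  then have "g \<in> L2 M" using L2_add[OF _ f[of n0]] by fastforce
  moreover have "(\<lambda>n. L2_norm M (\<lambda>x. g x - f n x)) \<longlonglongrightarrow> 0"
  proof (rule LIMSEQ_I)
    fix e :: real assume "e > 0"
    then obtain N where "\<forall>n\<ge>N. L2_norm M (\<lambda>x. g x - f n x) \<le> e / 2" using ev[of "e / 2"] by auto
    then have "\<forall>n\<ge>N. norm (L2_norm M (\<lambda>x. g x - f n x) - 0) < e" using \<open>e > 0\<close> by fastforce
    then show "\<exists>no. \<forall>n\<ge>no. norm (L2_norm M (\<lambda>x. g x - f n x) - 0) < e" by blast
  qed
  ultimately show thesis by (rule that)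
qed

lemma L2_inner_tendsto:
  assumes "g \<in> L2 M" "\<And>n. f n \<in> L2 M" "w \<in> L2 M"
    and "(\<lambda>n. L2_norm M (\<lambda>x. g x - f n x)) \<longlonglongrightarrow> 0"
  shows "(\<lambda>n. L2_inner M (f n) w) \<longlonglongrightarrow> L2_inner M g w"
proof -
  have "(\<lambda>n. L2_inner M g w - L2_inner M (f n) w) \<longlonglongrightarrow> 0"
  proof (rule Lim_null_comparison)
    show "\<forall>\<^sub>F n in sequentially. norm (L2_inner M g w - L2_inner M (f n) w)
        \<le> L2_norm M (\<lambda>x. g x - f n x) * L2_norm M w"
      using L2_Cauchy_Schwarz[OF L2_diff[OF assms(1,2)] assms(3)]
      by (simp add: L2_inner_diff_left[OF assms(1,2,3)])
    show "(\<lambda>n. L2_norm M (\<lambda>x. g x - f n x) * L2_norm M w) \<longlonglongrightarrow> 0"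
      using tendsto_mult_left_zero[OF assms(4)] by simp
  qed
  then show ?thesis
    using tendsto_diff[OF tendsto_const[of "L2_inner M g w"]] by fastforce
qed

text \<open>The element of \<open>V\<close> closest to \<open>f\<close> need not exist, but a minimizing sequence is Cauchy and
  its limit differs from \<open>f\<close> by a vector orthogonal to \<open>V\<close>.\<close>

lemma (in finite_measure) L2_subspace_dense:
  assumes V: "V \<subseteq> L2 M" "V \<noteq> {}"
    and lin: "\<And>u v a b. u \<in> V \<Longrightarrow> v \<in> V \<Longrightarrow> (\<lambda>x. a * u x + b * v x) \<in> V"
    and orth: "\<And>h. h \<in> L2 M \<Longrightarrow> (\<And>v. v \<in> V \<Longrightarrow> L2_inner M h v = 0) \<Longrightarrow> AE x in M. h x = 0"
    and f: "f \<in> L2 M" and e: "e > 0"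
  shows "\<exists>v\<in>V. L2_norm M (\<lambda>x. f x - v x) < e"
proof -
  define d where "d = (INF v\<in>V. (L2_norm M (\<lambda>x. f x - v x))\<^sup>2)"
  have d_le: "d \<le> (L2_norm M (\<lambda>x. f x - v x))\<^sup>2" if "v \<in> V" for v
    unfolding d_def using that by (intro cINF_lower) (auto intro: bdd_belowI[of _ 0])
  have "\<exists>v\<in>V. (L2_norm M (\<lambda>x. f x - v x))\<^sup>2 < d + 1 / real (Suc n)" for n
    using V(2) cInf_lessD[of "(\<lambda>v. (L2_norm M (\<lambda>x. f x - v x))\<^sup>2) ` V" "d + 1 / real (Suc n)"]
    by (auto simp: d_def)
  then obtain v where v: "\<And>n. v n \<in> V"
    and v_d: "\<And>n. (L2_norm M (\<lambda>x. f x - v n x))\<^sup>2 < d + 1 / real (Suc n)" by metis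
  have vL: "v n \<in> L2 M" for n using v V by auto
  have fvL: "(\<lambda>x. f x - v n x) \<in> L2 M" for n using f vL by (rule L2_diff)
  \<comment> \<open>The midpoint of \<open>v m\<close> and \<open>v n\<close> lies in
    \<open>V\<close>, so its squared distance to \<open>f\<close> is at least \<open>d\<close>. By
    the parallelogram law the distance of \<open>v m\<close> and \<open>v n\<close> is then
    controlled by how much their squared distances to \<open>f\<close> exceed
    \<open>d\<close>.\<close>
  have diff: "(L2_norm M (\<lambda>x. v m x - v n x))\<^sup>2 \<le> 2 / real (Suc m) + 2 / real (Suc n)" for m n
  proof -
    let ?p = "\<lambda>x. f x - v m x" and ?q = "\<lambda>x. f x - v n x"
    have "(L2_norm M (\<lambda>x. 1/2 * ?p x + 1/2 * ?q x))\<^sup>2 =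
        ((L2_norm M ?p)\<^sup>2 + (L2_norm M ?q)\<^sup>2 + 2 * Re (L2_inner M ?p ?q)) / 4"
      unfolding L2_norm_lincomb[OF fvL fvL] by (simp add: power2_eq_square)
    moreover have "(\<lambda>x. 1/2 * ?p x + 1/2 * ?q x) = (\<lambda>x. f x - (1/2 * v m x + 1/2 * v n x))"
      by (simp add: algebra_simps)
    moreover have "d \<le> (L2_norm M (\<lambda>x. f x - (1/2 * v m x + 1/2 * v n x)))\<^sup>2"
      by (intro d_le lin v)
    moreover have "(L2_norm M (\<lambda>x. (-1) * ?p x + 1 * ?q x))\<^sup>2 =
        (L2_norm M ?p)\<^sup>2 + (L2_norm M ?q)\<^sup>2 - 2 * Re (L2_inner M ?p ?q)"
      unfolding L2_norm_lincomb[OF fvL fvL] by simp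
    ultimately show ?thesis
      using v_d[of m] v_d[of n] by (simp add: algebra_simps)
  qed
  obtain g where g: "g \<in> L2 M" and g_lim: "(\<lambda>n. L2_norm M (\<lambda>x. g x - v n x)) \<longlonglongrightarrow> 0"
  proof (rule L2_complete[of v])
    fix e :: real assume "e > 0"
    obtain N where N: "inverse (real (Suc N)) < e\<^sup>2 / 4"
      using reals_Archimedean[of "e\<^sup>2 / 4"] \<open>e > 0\<close> by auto
    have "L2_norm M (\<lambda>x. v m x - v n x) < e" if "m \<ge> N" "n \<ge> N" for m n
    proof (rule power2_less_imp_less)
      have "1 / real (Suc m) \<le> 1 / real (Suc N)" "1 / real (Suc n) \<le> 1 / real (Suc N)"
        using that by (auto simp: divide_simps)
      with diff[of m n] N show "(L2_norm M (\<lambda>x. v m x - v n x))\<^sup>2 < e\<^sup>2"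
        by (simp add: inverse_eq_divide)
    qed (use \<open>e > 0\<close> in auto)
    then show "\<exists>N. \<forall>m\<ge>N. \<forall>n\<ge>N. L2_norm M (\<lambda>x. v m x - v n x) < e" by blast
  qed (auto intro: vL)
  define h where "h x = f x - g x" for x
  have h: "h \<in> L2 M" unfolding h_def using f g by (rule L2_diff)
  have h_lim: "(\<lambda>n. L2_norm M (\<lambda>x. h x - (f x - v n x))) \<longlonglongrightarrow> 0"
    using g_lim by (simp add: h_def L2_norm_minus_commute)
  have "L2_inner M h w = 0" if w: "w \<in> V" for w
  proof (rule ccontr)
    assume neq: "L2_inner M h w \<noteq> 0"
    have wL: "w \<in> L2 M" using w V by auto
    \<comment> \<open>First variation: moving \<open>v n\<close> by \<open>c * w\<close> stays in
      \<open>V\<close> and cannot bring the squared distance below \<open>d\<close>. Expanding the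
      square and letting n grow removes the excess \<open>1 / real (Suc n)\<close>.\<close>
    have ineq: "2 * Re (cnj c * L2_inner M h w) \<le> (norm c)\<^sup>2 * (L2_norm M w)\<^sup>2" for c
    proof (rule LIMSEQ_le)
      show "(\<lambda>n. 2 * Re (cnj c * L2_inner M (\<lambda>x. f x - v n x) w)) \<longlonglongrightarrow> 2 * Re (cnj c * L2_inner M h w)"
        by (intro tendsto_intros L2_inner_tendsto h wL fvL h_lim)
      show "(\<lambda>n. (norm c)\<^sup>2 * (L2_norm M w)\<^sup>2 + 1 / real (Suc n)) \<longlonglongrightarrow> (norm c)\<^sup>2 * (L2_norm M w)\<^sup>2"
        using tendsto_add[OF tendsto_const LIMSEQ_inverse_real_of_nat] by (simp add: inverse_eq_divide)
      have "2 * Re (cnj c * L2_inner M (\<lambda>x. f x - v n x) w) \<le> (norm c)\<^sup>2 * (L2_norm M w)\<^sup>2 + 1 / real (Suc n)" for n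
      proof -
        have "d \<le> (L2_norm M (\<lambda>x. f x - (1 * v n x + c * w x)))\<^sup>2" by (intro d_le lin v w)
        also have "(\<lambda>x. f x - (1 * v n x + c * w x)) = (\<lambda>x. 1 * (f x - v n x) + (- c) * w x)"
          by (simp add: algebra_simps)
        finally show ?thesis
          unfolding L2_norm_lincomb[OF fvL wL] using v_d[of n] by simp
      qed
      then show "\<exists>N. \<forall>n\<ge>N. 2 * Re (cnj c * L2_inner M (\<lambda>x. f x - v n x) w) \<le> (norm c)\<^sup>2 * (L2_norm M w)\<^sup>2 + 1 / real (Suc n)"
        by blast
    qed
    let ?p = "L2_inner M h w" and ?W = "(L2_norm M w)\<^sup>2"
    \<comment> \<open>Testing with \<open>t * ?p\<close> makes the left side of \<open>ineq\<close>
      linear and the right side quadratic in \<open>t\<close>, a contradiction for small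
      \<open>t\<close>. The added 1 keeps the quotient meaningful when \<open>w\<close> has norm
      zero.\<close>
    define t where "t = 1 / (?W + 1)"
    have t: "t > 0" "t * ?W < 1" by (auto simp: t_def divide_simps add_nonneg_pos)
    have "cnj (of_real t * ?p) * ?p = of_real (t * (norm ?p)\<^sup>2)"
      using complex_norm_square[of ?p] by simp
    with ineq[of "of_real t * ?p"] have "2 * (t * (norm ?p)\<^sup>2) \<le> (norm (of_real t * ?p))\<^sup>2 * ?W"
      by (metis Re_complex_of_real)
    then have "2 * (t * (norm ?p)\<^sup>2) \<le> (t * ?W) * (t * (norm ?p)\<^sup>2)"
      by (simp add: norm_mult power_mult_distrib power2_eq_square mult_ac)
    also have "\<dots> \<le> 1 * (t * (norm ?p)\<^sup>2)"
      using t by (intro mult_right_mono) auto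
    finally show False using neq t by simp
  qed
  then have "AE x in M. h x = 0" by (intro orth h)
  then have "AE x in M. norm (h x) = 0" by auto
  then have "L2_norm M h = 0" unfolding L2_norm_def
    by (simp add: integral_eq_zero_AE)
  moreover have "L2_norm M (\<lambda>x. f x - v n x) \<le> L2_norm M h + L2_norm M (\<lambda>x. g x - v n x)" for n
    unfolding h_def using f g vL by (rule L2_norm_triangle_diff)
  ultimately have "L2_norm M (\<lambda>x. f x - v n x) \<le> L2_norm M (\<lambda>x. g x - v n x)" for n by simp
  moreover obtain n where "L2_norm M (\<lambda>x. g x - v n x) < e"
    using order_tendstoD(2)[OF g_lim e] by (auto dest: eventually_happens)
  ultimately show ?thesis using v by (meson le_less_trans)
qed

text \<open>By orthogonality the squared norm of \<open>h\<close> equals the inner product of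
  \<open>h - v\<close> with \<open>h\<close>, hence is at most \<open>e\<close> times the norm.
  Taking for \<open>e\<close> half the norm of \<open>h\<close> forces the norm to vanish.\<close>

lemma L2_orthogonal_dense:
  assumes h: "h \<in> L2 M" and V: "V \<subseteq> L2 M"
    and dense: "\<And>e. e > 0 \<Longrightarrow> \<exists>v\<in>V. L2_norm M (\<lambda>x. h x - v x) < e"
    and orth: "\<And>v. v \<in> V \<Longrightarrow> L2_inner M h v = 0"
  shows "AE x in M. h x = 0"
proof -
  have "(L2_norm M h)\<^sup>2 \<le> L2_norm M h * e" if e: "e > 0" for e
  proof -
    obtain v where v: "v \<in> V" "L2_norm M (\<lambda>x. h x - v x) < e" using dense[OF e] by auto
    then have vL: "v \<in> L2 M" using V by auto
    have "L2_inner M v h = 0" using orth[OF v(1)] L2_inner_commute[of M v h] by simp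
    then have "L2_inner M (\<lambda>x. h x - v x) h = of_real ((L2_norm M h)\<^sup>2)"
      using L2_inner_diff_left[OF h vL h] L2_inner_self[of M h] by simp
    then have "(L2_norm M h)\<^sup>2 = norm (L2_inner M (\<lambda>x. h x - v x) h)" by (simp add: norm_power)
    also have "\<dots> \<le> L2_norm M (\<lambda>x. h x - v x) * L2_norm M h"
      by (intro L2_Cauchy_Schwarz L2_diff h vL)
    also have "\<dots> \<le> e * L2_norm M h" using v by (intro mult_right_mono) auto
    finally show ?thesis by (simp add: mult.commute)
  qed
  from this[of "L2_norm M h / 2"] have "L2_norm M h = 0"
    by (cases "L2_norm M h = 0") (auto simp: power2_eq_square less_le)
  then show ?thesis using h by (intro L2_norm_zero_AE)
qed

section \<open>The Cauchy formula on the polydisc\<close>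

lemma borel_measurable_vec_lambda:
  fixes f :: "'n::finite \<Rightarrow> 'a \<Rightarrow> complex"
  assumes "\<And>j. f j \<in> borel_measurable M"
  shows "(\<lambda>x. \<chi> j. f j x) \<in> borel_measurable M"
proof (subst borel_measurable_euclidean_space, rule ballI)
  fix b :: "complex ^ 'n" assume "b \<in> Basis"
  then obtain k u where b: "b = axis k u" by (auto simp: Basis_vec_def)
  have [measurable]: "f k \<in> borel_measurable M" by fact
  show "(\<lambda>x. (\<chi> j. f j x) \<bullet> b) \<in> borel_measurable M"
    unfolding b inner_axis by simp
qed

lemma borel_measurable_vec_nth:
  fixes f :: "'a \<Rightarrow> complex ^ 'n"
  shows "f \<in> borel_measurable M \<Longrightarrow> (\<lambda>x. f x $ j) \<in> borel_measurable M"
  by (rule measurable_compose[OF _ borel_measurable_continuous_onI])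
    (auto intro: continuous_intros)

lemma measurable_torus_borel_ident:
  "(\<lambda>x. x) \<in> borel_measurable (torus_borel :: (complex ^ 'n) measure)"
  by (rule measurable_restrict_space1) simp

lemma
  assumes "f \<in> borel_measurable M" "g \<in> borel_measurable M"
  shows cauchy_kernel_measurable:
      "(\<lambda>x. cauchy_kernel (f x) (g x)) \<in> borel_measurable M"
    and poisson_kernel_measurable:
      "(\<lambda>x. poisson_kernel (f x) (g x)) \<in> borel_measurable M"
proof -
  have [measurable]: "(\<lambda>x. f x $ j) \<in> borel_measurable M" "(\<lambda>x. cnj (g x $ j)) \<in> borel_measurable M" for j
    using assms by (auto intro: borel_measurable_cnj borel_measurable_vec_nth)
  show "(\<lambda>x. cauchy_kernel (f x) (g x)) \<in> borel_measurable M"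
    unfolding cauchy_kernel_def by measurable
  show "(\<lambda>x. poisson_kernel (f x) (g x)) \<in> borel_measurable M"
    unfolding poisson_kernel_def by measurable
qed

section \<open>Topology of the polydisc and torus, and complex lines\<close>

lemma polydisc_subset_closed_polydisc: "polydisc \<subseteq> closed_polydisc"
  and torus_subset_closed_polydisc: "torus \<subseteq> closed_polydisc"
  by (auto simp: polydisc_def torus_def closed_polydisc_def intro: less_imp_le)

lemma compact_closed_polydisc: "compact (closed_polydisc :: (complex ^ 'n) set)"
proof -
  have "closed (closed_polydisc :: (complex ^ 'n) set)"
    unfolding closed_polydisc_def
    by (intro closed_Collect_all closed_Collect_le continuous_intros)
  moreover have "norm z \<le> real CARD('n)" if "z \<in> closed_polydisc" for z :: "complex ^ 'n"
  proof -
    have "norm z \<le> (\<Sum>j\<in>UNIV. norm (z $ j))"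
      unfolding norm_vec_def by (intro L2_set_le_sum) auto
    also have "\<dots> \<le> (\<Sum>j\<in>(UNIV :: 'n set). 1)"
      using that by (intro sum_mono) (auto simp: closed_polydisc_def)
    finally show ?thesis by simp
  qed
  then have "bounded (closed_polydisc :: (complex ^ 'n) set)"
    by (intro boundedI)
  ultimately show ?thesis by (simp add: compact_eq_bounded_closed)
qed

lemma closed_torus: "closed (torus :: (complex ^ 'n) set)"
  unfolding torus_def by (intro closed_Collect_all closed_Collect_eq continuous_intros)

lemma compact_torus: "compact (torus :: (complex ^ 'n) set)"
  using compact_closed_polydisc closed_torus torus_subset_closed_polydisc
  by (metis compact_Int_closed inf.absorb_iff2)

lemma bounded_linear_scale: "bounded_linear (\<lambda>u. u *s (v :: complex ^ 'n))"
  unfolding linear_conv_bounded_linear[symmetric]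
  by (intro linearI) (auto simp: vec_eq_iff algebra_simps)

text \<open>On a complex line the derivative acts as multiplication by the number
  \<open>D v\<close>, by its complex linearity. This makes one-variable theory available on
  slices.\<close>

lemma holomorphic_sv_line:
  assumes "holomorphic_sv F S" "a + u *s v \<in> S"
  shows "(\<lambda>u. F (a + u *s v)) field_differentiable at u"
proof -
  obtain D where D: "(F has_derivative D) (at (a + u *s v))" "\<And>c v. D (c *s v) = c * D v"
    using assms by (auto simp: holomorphic_sv_def)
  have "((\<lambda>u. a + u *s v) has_derivative (\<lambda>h. h *s v)) (at u)"
    using has_derivative_add[OF has_derivative_const bounded_linear_imp_has_derivative[OF bounded_linear_scale]]
    by fastforce
  from has_derivative_compose[OF this D(1)]
  have "((\<lambda>u. F (a + u *s v)) has_derivative (\<lambda>h. D v * h)) (at u)"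
    by (simp add: D(2) mult.commute)
  then show ?thesis
    unfolding field_differentiable_def has_field_derivative_def by blast
qed

lemma holomorphic_sv_continuous: "holomorphic_sv F S \<Longrightarrow> continuous_on S F"
  unfolding holomorphic_sv_def
  by (intro continuous_at_imp_continuous_on) (auto intro: has_derivative_continuous)

lemma holomorphic_sv_subset: "holomorphic_sv F S \<Longrightarrow> R \<subseteq> S \<Longrightarrow> holomorphic_sv F R"
  by (auto simp: holomorphic_sv_def)

lemma integral_uniform_measure_interval:
  fixes g :: "real \<Rightarrow> complex"
  assumes "continuous_on UNIV g" "a < b"
  shows "(\<integral>t. g t \<partial>uniform_measure lborel {a..b}) = integral {a..b} g / of_real (b - a)"
proof -
  have [measurable]: "g \<in> borel_measurable borel"
    using assms(1) by (rule borel_measurable_continuous_onI)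
  have si: "set_integrable lborel {a..b} g"
    by (rule borel_integrable_atLeastAtMost') (rule continuous_on_subset[OF assms(1) subset_UNIV])
  have "uniform_measure lborel {a..b} = density lborel (\<lambda>t. ennreal (indicator {a..b} t / (b - a)))"
    unfolding uniform_measure_def
    using assms(2) by (intro arg_cong2[where f=density] refl ext)
      (auto simp: divide_ennreal[symmetric] ennreal_indicator split: split_indicator)
  also have "(\<integral>t. g t \<partial>\<dots>) = (\<integral>t. (indicator {a..b} t / (b - a)) *\<^sub>R g t \<partial>lborel)"
    using assms(2) by (intro integral_density) auto
  also have "\<dots> = (\<integral>t. (1 / (b - a)) *\<^sub>R (indicator {a..b} t *\<^sub>R g t) \<partial>lborel)"
    by (simp add: scaleR_scaleR)
  also have "\<dots> = (1 / (b - a)) *\<^sub>R (LINT t:{a..b}|lborel. g t)"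
    unfolding set_lebesgue_integral_def by (rule integral_scaleR_right)
  also have "(LINT t:{a..b}|lborel. g t) = integral {a..b} g"
    using si by (rule set_borel_integral_eq_integral)
  finally show ?thesis by (simp add: scaleR_conv_of_real)
qed

text \<open>The kernel \<open>1 / (1 - w * cis (- t))\<close> equals
  \<open>cis t / (cis t - w)\<close>, and \<open>\<i> * cis t\<close> is the derivative of the
  parametrisation. So this is Cauchy's formula on the unit circle after the factor
  \<open>2 * pi * \<i>\<close> is removed.\<close>

lemma cauchy_formula_circle:
  assumes "continuous_on (cball 0 1) G" "G holomorphic_on ball 0 1" "norm w < 1"
  shows "(\<integral>t. 1 / (1 - w * cis (- t)) * G (cis t) \<partial>uniform_measure lborel {0..2*pi}) = G w"
proof -
  have nz: "1 - w * cis (- t) \<noteq> 0" "cis t - w \<noteq> 0" for t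
    using assms(3) norm_cis[of "- t"] norm_cis[of t] by (auto simp: norm_mult dest: arg_cong[where f=norm])
  have "((\<lambda>u. G u / (u - w)) has_contour_integral (2 * pi) * \<i> * G w) (circlepath 0 1)"
    using Cauchy_integral_circlepath[OF assms(1,2), of w] assms(3) by simp
  then have "((\<lambda>t. G (cis t) / (cis t - w) * \<i> * cis t) has_integral (2 * pi) * \<i> * G w) {0..2*pi}"
    unfolding circlepath_def using has_contour_integral_part_circlepath_iff[of 0 "2*pi" "\<lambda>u. G u / (u - w)" _ 0 1]
    by simp
  also have "(\<lambda>t. G (cis t) / (cis t - w) * \<i> * cis t) = (\<lambda>t. \<i> * (1 / (1 - w * cis (- t)) * G (cis t)))"
  proof
    fix t
    have "1 - w * cis (- t) = (cis t - w) / cis t"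
      by (simp add: divide_simps cis_inverse[symmetric])
    then show "G (cis t) / (cis t - w) * \<i> * cis t = \<i> * (1 / (1 - w * cis (- t)) * G (cis t))"
      by simp
  qed
  finally have "((\<lambda>t. (- \<i>) * (\<i> * (1 / (1 - w * cis (- t)) * G (cis t)))) has_integral (- \<i>) * ((2 * pi) * \<i> * G w)) {0..2*pi}"
    by (rule has_integral_mult_right)
  then have "integral {0..2*pi} (\<lambda>t. 1 / (1 - w * cis (- t)) * G (cis t)) = 2 * pi * G w"
    by (intro integral_unique) (simp add: mult_ac)
  moreover have "continuous_on UNIV (\<lambda>t. 1 / (1 - w * cis (- t)) * G (cis t))"
    by (intro continuous_intros continuous_on_compose2[OF assms(1)]) (use nz in auto)
  ultimately show ?thesis by (subst integral_uniform_measure_interval) auto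
qed

section \<open>The torus measure as the image of a product of circle measures\<close>

abbreviation circle_measure :: "real measure" where
  "circle_measure \<equiv> uniform_measure lborel {0..2*pi}"

lemma product_sigma_finite_circle: "product_sigma_finite (\<lambda>_::'n. circle_measure)"
proof -
  have "finite_measure circle_measure" by (rule finite_measureI) simp
  then show ?thesis
    unfolding product_sigma_finite_def finite_measure_def by blast
qed

lemma emeasure_PiM_circle:
  assumes "finite J"
  shows "emeasure (PiM J (\<lambda>_. circle_measure)) (space (PiM J (\<lambda>_. circle_measure))) = 1"
proof -
  interpret product_sigma_finite "\<lambda>_. circle_measure" by (rule product_sigma_finite_circle)
  have "emeasure (PiM J (\<lambda>_. circle_measure)) (Pi\<^sub>E J (\<lambda>_. UNIV)) = (\<Prod>j\<in>J. emeasure circle_measure UNIV)"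
    using assms by (intro emeasure_PiM) auto
  then show ?thesis by (simp add: space_PiM)
qed

definition torus_param :: "('n \<Rightarrow> real) \<Rightarrow> complex ^ 'n" where
  "torus_param t = (\<chi> j. cis (t j))"

lemma cis_component_measurable [measurable]:
  assumes "j \<in> J"
  shows "(\<lambda>t. cis (t j)) \<in> borel_measurable (PiM J (\<lambda>_. circle_measure))"
proof -
  have "cis \<in> borel_measurable borel"
    by (rule borel_measurable_continuous_onI) (intro continuous_intros)
  then have "cis \<in> borel_measurable circle_measure" by (simp cong: measurable_cong_sets)
  with measurable_component_singleton[OF assms] show ?thesis by (rule measurable_compose)
qed

lemma torus_param_measurable:
  "torus_param \<in> measurable (PiM UNIV (\<lambda>_::'n::finite. circle_measure)) torus_borel"
proof (rule measurable_restrict_space2)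
  show "torus_param \<in> space (Pi\<^sub>M UNIV (\<lambda>_. circle_measure)) \<rightarrow> torus"
    by (auto simp: torus_param_def torus_def)
  show "torus_param \<in> borel_measurable (Pi\<^sub>M UNIV (\<lambda>_. circle_measure))"
    unfolding torus_param_def by (intro borel_measurable_vec_lambda cis_component_measurable) simp
qed

lemma torus_measure_eq: "torus_measure = distr (PiM UNIV (\<lambda>_. circle_measure)) torus_borel torus_param"
  unfolding torus_measure_def torus_param_def ..

lemma space_torus_measure [simp]: "space (torus_measure :: (complex ^ 'n) measure) = torus"
  and sets_torus_measure [measurable_cong, simp]: "sets torus_measure = sets torus_borel"
  by (simp_all add: torus_measure_eq space_restrict_space)

lemma emeasure_torus_measure: "emeasure torus_measure (torus :: (complex ^ 'n) set) = 1"
proof -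
  have "emeasure torus_measure (torus :: (complex ^ 'n) set) =
      emeasure (PiM UNIV (\<lambda>_::'n. circle_measure)) (torus_param -` torus \<inter> space (PiM UNIV (\<lambda>_. circle_measure)))"
    unfolding torus_measure_eq
    by (rule emeasure_distr[OF torus_param_measurable])
      (use sets.top[of "torus_borel :: (complex ^ 'n) measure"] in \<open>simp add: space_restrict_space\<close>)
  also have "torus_param -` torus \<inter> space (PiM UNIV (\<lambda>_. circle_measure)) = space (PiM UNIV (\<lambda>_::'n. circle_measure))"
    using measurable_space[OF torus_param_measurable] by (auto simp: space_restrict_space)
  finally show ?thesis by (simp add: emeasure_PiM_circle)
qed

interpretation torus: finite_measure "torus_measure :: (complex ^ 'n) measure"
  by (rule finite_measureI) (simp add: emeasure_torus_measure)

lemma measure_torus_measure [simp]: "measure torus_measure (torus :: (complex ^ 'n) set) = 1"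
  by (simp add: measure_def emeasure_torus_measure)

lemma cauchy_kernel_cis_bound:
  assumes "norm w < 1"
  shows "norm (1 / (1 - w * cis (- t))) \<le> 1 / (1 - norm w)"
proof -
  have "1 - norm w \<le> norm (1 - w * cis (- t))"
    using norm_triangle_ineq2[of 1 "w * cis (- t)"] by (simp add: norm_mult)
  then show ?thesis using assms by (simp add: norm_divide frac_le)
qed

lemma partial_kernel_measurable:
  "(\<lambda>t. \<Prod>j\<in>J. 1 / (1 - w $ j * cis (- t j))) \<in> borel_measurable (PiM J (\<lambda>_. circle_measure))"
proof (rule borel_measurable_prod)
  fix j assume "j \<in> J"
  then have "(\<lambda>t. cnj (cis (t j))) \<in> borel_measurable (PiM J (\<lambda>_. circle_measure))"
    by (intro borel_measurable_cnj cis_component_measurable)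
  then have "(\<lambda>t. cis (- t j)) \<in> borel_measurable (PiM J (\<lambda>_. circle_measure))"
    by (simp only: cis_cnj)
  then show "(\<lambda>t. 1 / (1 - w $ j * cis (- t j))) \<in> borel_measurable (PiM J (\<lambda>_. circle_measure))"
    by (intro borel_measurable_divide borel_measurable_diff borel_measurable_times borel_measurable_const)
qed

lemma partial_param_measurable:
  "(\<lambda>t. (\<chi> j. if j \<in> J then cis (t j) else w $ j) :: complex ^ 'n)
    \<in> borel_measurable (PiM J (\<lambda>_. circle_measure))"
proof (rule borel_measurable_vec_lambda)
  fix j
  show "(\<lambda>t. if j \<in> J then cis (t j) else w $ j) \<in> borel_measurable (PiM J (\<lambda>_. circle_measure))"
  proof (cases "j \<in> J")
    case True
    then show ?thesis unfolding if_P[OF True] by (rule cis_component_measurable)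
  qed simp
qed

text \<open>The coordinates in \<open>J\<close> are moved to the torus one at a time, the others staying at \<open>w\<close>.\<close>

lemma cauchy_formula_partial:
  fixes F :: "complex ^ 'n \<Rightarrow> complex"
  assumes F: "holomorphic_sv F closed_polydisc" and w: "w \<in> polydisc" and "finite J"
  shows "(\<integral>t. (\<Prod>j\<in>J. 1 / (1 - w $ j * cis (- t j))) * F (\<chi> j. if j \<in> J then cis (t j) else w $ j)
      \<partial>PiM J (\<lambda>_. circle_measure)) = F w"
  using \<open>finite J\<close>
proof induction
  case empty
  then show ?case by (simp add: PiM_empty lebesgue_integral_count_space_finite)
next
  case (insert i J)
  interpret product_sigma_finite "\<lambda>_::'n. circle_measure" by (rule product_sigma_finite_circle)
  let ?I = "insert i J"
  let ?P = "\<lambda>J t. (\<chi> j. if j \<in> J then cis (t j) else w $ j) :: complex ^ 'n"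
  let ?K = "\<lambda>J t. \<Prod>j\<in>J. 1 / (1 - w $ j * cis (- t j))"
  have wj: "norm (w $ j) < 1" for j using w by (simp add: polydisc_def)
  have contF: "continuous_on closed_polydisc F" using F by (rule holomorphic_sv_continuous)
  have P_closed: "?P J t \<in> closed_polydisc" for J t
    using wj by (auto simp: closed_polydisc_def intro: less_imp_le)
  obtain B where B: "\<And>z. z \<in> closed_polydisc \<Longrightarrow> norm (F z) \<le> B"
    using compact_imp_bounded[OF compact_continuous_image[OF contF compact_closed_polydisc]]
    unfolding bounded_iff by (meson imageI)
  \<comment> \<open>Splitting off one coordinate requires integrability on the whole product. The
    integrand is bounded: the kernel factors because \<open>w\<close> is interior, \<open>F\<close>
    because it is continuous on a compact set.\<close>
  have int: "integrable (PiM ?I (\<lambda>_. circle_measure)) (\<lambda>t. ?K ?I t * F (?P ?I t))"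
  proof -
    interpret PM: finite_measure "PiM ?I (\<lambda>_. circle_measure)"
      using emeasure_PiM_circle[of ?I] insert(1) by (intro finite_measureI) simp
    have K: "(\<lambda>t. ?K ?I t) \<in> borel_measurable (PiM ?I (\<lambda>_. circle_measure))"
      by (rule partial_kernel_measurable)
    have "?P ?I \<in> measurable (PiM ?I (\<lambda>_. circle_measure)) (restrict_space borel closed_polydisc)"
      using partial_param_measurable P_closed by (intro measurable_restrict_space2 funcsetI)
    from measurable_compose[OF this borel_measurable_continuous_on_restrict[OF contF]]
    have FP: "(\<lambda>t. F (?P ?I t)) \<in> borel_measurable (PiM ?I (\<lambda>_. circle_measure))" .
    show ?thesis
    proof (rule PM.integrable_const_bound)
      show "AE t in PiM ?I (\<lambda>_. circle_measure). norm (?K ?I t * F (?P ?I t)) \<le> (\<Prod>j\<in>?I. 1 / (1 - norm (w $ j))) * B"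
      proof (rule AE_I2)
        fix t
        have "norm (?K ?I t) \<le> (\<Prod>j\<in>?I. 1 / (1 - norm (w $ j)))"
          unfolding prod_norm[symmetric]
          using cauchy_kernel_cis_bound[OF wj] by (intro prod_mono) auto
        then show "norm (?K ?I t * F (?P ?I t)) \<le> (\<Prod>j\<in>?I. 1 / (1 - norm (w $ j))) * B"
          unfolding norm_mult
        proof (rule mult_mono)
          show "norm (F (?P ?I t)) \<le> B" by (rule B[OF P_closed])
          show "0 \<le> (\<Prod>j\<in>?I. 1 / (1 - norm (w $ j)))"
            using wj by (intro prod_nonneg) (auto simp: less_imp_le)
        qed simp
      qed
    qed (rule borel_measurable_times[OF K FP])
  qed
  have inner: "(\<integral>y. ?K ?I (t(i := y)) * F (?P ?I (t(i := y))) \<partial>circle_measure) = ?K J t * F (?P J t)" for t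
  proof -
    \<comment> \<open>Coordinate \<open>i\<close> is set to zero so that adding \<open>u\<close>
      times the unit vector places exactly \<open>u\<close> there. \<open>G\<close> is the slice to
      which the circle formula applies, evaluated at \<open>w $ i\<close>.\<close>
    define p where "p = (\<chi> j. if j = i then 0 else ?P J t $ j)"
    define G where "G u = F (p + u *s axis i 1)" for u
    have p_eq: "p + u *s axis i 1 = (\<chi> j. if j = i then u else ?P J t $ j)" for u
      by (auto simp: p_def vec_eq_iff axis_def)
    have "p + u *s axis i 1 \<in> closed_polydisc" if "norm u \<le> 1" for u
      using that P_closed[of J t] unfolding p_eq by (auto simp: closed_polydisc_def)
    then have diff: "G field_differentiable at u" if "norm u \<le> 1" for u
      unfolding G_def using holomorphic_sv_line[OF F] that by auto
    have "(\<integral>y. 1 / (1 - w $ i * cis (- y)) * G (cis y) \<partial>circle_measure) = G (w $ i)"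
    proof (rule cauchy_formula_circle)
      show "continuous_on (cball 0 1) G"
        using diff by (intro continuous_at_imp_continuous_on ballI field_differentiable_imp_continuous_at) auto
      show "G holomorphic_on ball 0 1"
        unfolding holomorphic_on_def using diff by (auto intro: field_differentiable_at_within)
    qed (rule wj)
    moreover have "G (w $ i) = F (?P J t)"
      unfolding G_def p_eq using insert(2) by (intro arg_cong[where f=F]) (auto simp: vec_eq_iff)
    moreover have "?K ?I (t(i := y)) * F (?P ?I (t(i := y))) =
        ?K J t * (1 / (1 - w $ i * cis (- y)) * G (cis y))" for y
    proof -
      have "?K J (t(i := y)) = ?K J t" using insert(2) by (intro prod.cong) auto
      moreover have "F (?P ?I (t(i := y))) = G (cis y)"
        unfolding G_def p_eq by (intro arg_cong[where f=F]) (auto simp: vec_eq_iff)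
      ultimately show ?thesis using insert(1,2) by (simp add: mult_ac)
    qed
    ultimately show ?thesis by (simp only: integral_mult_right_zero)
  qed
  have "(\<integral>t. ?K ?I t * F (?P ?I t) \<partial>PiM ?I (\<lambda>_. circle_measure)) =
      (\<integral>t. (\<integral>y. ?K ?I (t(i := y)) * F (?P ?I (t(i := y))) \<partial>circle_measure) \<partial>PiM J (\<lambda>_. circle_measure))"
    using insert(1,2) int by (rule product_integral_insert)
  also have "\<dots> = F w" unfolding inner by (rule insert.IH)
  finally show ?case .
qed

lemma continuous_on_torus_measurable:
  fixes f :: "complex ^ 'n \<Rightarrow> 'b::topological_space"
  assumes "continuous_on torus f"
  shows "f \<in> borel_measurable torus_borel"
  using assms by (rule borel_measurable_continuous_on_restrict)

text \<open>The partial formula with all coordinates moved, transported to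
  \<open>torus_measure\<close>. Holomorphy on \<open>closed_polydisc\<close> includes
  differentiability at boundary points in the ambient space; dilates of functions holomorphic on
  \<open>polydisc\<close> have it.\<close>

lemma cauchy_formula:
  fixes F :: "complex ^ 'n \<Rightarrow> complex"
  assumes F: "holomorphic_sv F closed_polydisc" and w: "w \<in> polydisc"
  shows "(\<integral>\<zeta>. cauchy_kernel w \<zeta> * F \<zeta> \<partial>torus_measure) = F w"
proof -
  have "F \<in> borel_measurable torus_borel"
    by (rule continuous_on_torus_measurable[OF continuous_on_subset[OF
          holomorphic_sv_continuous[OF F] torus_subset_closed_polydisc]])
  then have "(\<lambda>\<zeta>. cauchy_kernel w \<zeta> * F \<zeta>) \<in> borel_measurable torus_borel"
    by (intro borel_measurable_times cauchy_kernel_measurable measurable_torus_borel_ident) simp_all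
  then have "(\<integral>\<zeta>. cauchy_kernel w \<zeta> * F \<zeta> \<partial>torus_measure) =
      (\<integral>t. cauchy_kernel w (torus_param t) * F (torus_param t) \<partial>PiM UNIV (\<lambda>_. circle_measure))"
    unfolding torus_measure_eq by (intro integral_distr torus_param_measurable)
  also have "\<dots> = F w"
    using cauchy_formula_partial[OF F w, of UNIV]
    by (simp add: cauchy_kernel_def torus_param_def cis_cnj)
  finally show ?thesis .
qed

section \<open>The Poisson kernel\<close>

lemma holomorphic_sv_const: "holomorphic_sv (\<lambda>z. c) S"
  unfolding holomorphic_sv_def by (auto intro!: exI[of _ "\<lambda>_. 0"])

lemma holomorphic_sv_lincomb:
  assumes "holomorphic_sv f S" "holomorphic_sv g S"
  shows "holomorphic_sv (\<lambda>z. a * f z + b * g z) S"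
  unfolding holomorphic_sv_def
proof (rule ballI)
  fix z assume z: "z \<in> S"
  obtain D where D: "(f has_derivative D) (at z)" "\<And>c v. D (c *s v) = c * D v"
    using assms z by (auto simp: holomorphic_sv_def)
  obtain E where E: "(g has_derivative E) (at z)" "\<And>c v. E (c *s v) = c * E v"
    using assms z by (auto simp: holomorphic_sv_def)
  have "((\<lambda>z. a * f z + b * g z) has_derivative (\<lambda>h. a * D h + b * E h)) (at z)"
    by (rule has_derivative_add[OF has_derivative_mult_right[OF D(1)] has_derivative_mult_right[OF E(1)]])
  then show "\<exists>D. ((\<lambda>z. a * f z + b * g z) has_derivative D) (at z) \<and> (\<forall>c v. D (c *s v) = c * D v)"
    by (rule exI[of _ "\<lambda>h. a * D h + b * E h", OF conjI]) (simp add: D(2) E(2) algebra_simps)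
qed

lemma holomorphic_sv_diff:
  "holomorphic_sv f S \<Longrightarrow> holomorphic_sv g S \<Longrightarrow> holomorphic_sv (\<lambda>z. f z - g z) S"
  using holomorphic_sv_lincomb[of f S g 1 "-1"] by simp

lemma holomorphic_sv_mult:
  assumes "holomorphic_sv f S" "holomorphic_sv g S"
  shows "holomorphic_sv (\<lambda>z. f z * g z) S"
  unfolding holomorphic_sv_def
proof (rule ballI)
  fix z assume z: "z \<in> S"
  obtain D where D: "(f has_derivative D) (at z)" "\<And>c v. D (c *s v) = c * D v"
    using assms z by (auto simp: holomorphic_sv_def)
  obtain E where E: "(g has_derivative E) (at z)" "\<And>c v. E (c *s v) = c * E v"
    using assms z by (auto simp: holomorphic_sv_def)
  have "((\<lambda>z. f z * g z) has_derivative (\<lambda>h. f z * E h + D h * g z)) (at z)"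
    by (rule has_derivative_mult[OF D(1) E(1)])
  then show "\<exists>D. ((\<lambda>z. f z * g z) has_derivative D) (at z) \<and> (\<forall>c v. D (c *s v) = c * D v)"
    by (rule exI[of _ "\<lambda>h. f z * E h + D h * g z", OF conjI]) (simp add: D(2) E(2) algebra_simps)
qed

lemma holomorphic_sv_prod:
  "finite J \<Longrightarrow> (\<And>j. j \<in> J \<Longrightarrow> holomorphic_sv (f j) S) \<Longrightarrow> holomorphic_sv (\<lambda>z. \<Prod>j\<in>J. f j z) S"
  by (induction J rule: finite_induct) (auto intro: holomorphic_sv_const holomorphic_sv_mult)

lemma holomorphic_sv_nth_compose:
  assumes "\<And>z. z \<in> S \<Longrightarrow> g field_differentiable at (z $ j)"
  shows "holomorphic_sv (\<lambda>z. g (z $ j)) S"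
  unfolding holomorphic_sv_def
proof (rule ballI)
  fix z assume "z \<in> S"
  then obtain d where d: "(g has_derivative (*) d) (at (z $ j))"
    using assms by (auto simp: field_differentiable_def has_field_derivative_def)
  have "((\<lambda>z. g (z $ j)) has_derivative (\<lambda>h. d * (h $ j))) (at z)"
    by (rule has_derivative_compose[OF bounded_linear_imp_has_derivative[OF bounded_linear_vec_nth] d])
  then show "\<exists>D. ((\<lambda>z. g (z $ j)) has_derivative D) (at z) \<and> (\<forall>c v. D (c *s v) = c * D v)"
    by (rule exI[of _ "\<lambda>h. d * (h $ j)", OF conjI]) simp
qed

lemma one_minus_mult_cnj_nonzero:
  fixes u v :: complex
  assumes "norm u * norm v < 1"
  shows "1 - u * cnj v \<noteq> 0"
  using assms by (metis complex_mod_cnj eq_iff_diff_eq_0 less_irrefl norm_mult norm_one)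

lemma closed_polydisc_mult_polydisc:
  assumes "z \<in> closed_polydisc" "w \<in> polydisc"
  shows "norm (z $ j) * norm (w $ j) < 1"
proof -
  have "norm (z $ j) * norm (w $ j) \<le> 1 * norm (w $ j)"
    using assms(1) by (intro mult_right_mono) (auto simp: closed_polydisc_def)
  also have "\<dots> < 1" using assms(2) by (simp add: polydisc_def)
  finally show ?thesis .
qed

lemma holomorphic_cauchy_kernel:
  assumes w: "w \<in> polydisc"
  shows "holomorphic_sv (\<lambda>z. cauchy_kernel z w) closed_polydisc"
  unfolding cauchy_kernel_def
proof (intro holomorphic_sv_prod finite)
  fix j
  show "holomorphic_sv (\<lambda>z. 1 / (1 - z $ j * cnj (w $ j))) closed_polydisc"
  proof (rule holomorphic_sv_nth_compose)
    fix z :: "complex ^ 'a" assume z: "z \<in> closed_polydisc"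
    show "(\<lambda>u. 1 / (1 - u * cnj (w $ j))) field_differentiable at (z $ j)"
      using one_minus_mult_cnj_nonzero[OF closed_polydisc_mult_polydisc[OF z w]]
      by (intro derivative_intros) auto
  qed
qed

lemma scaleR_eq_vector_scale: "r *\<^sub>R (z :: complex ^ 'n) = of_real r *s z"
  by (simp add: vec_eq_iff) (simp add: scaleR_conv_of_real)

lemma holomorphic_sv_dilation:
  assumes f: "holomorphic_sv f T" and sub: "\<And>z. z \<in> S \<Longrightarrow> r *\<^sub>R z \<in> T"
  shows "holomorphic_sv (\<lambda>z. f (r *\<^sub>R z)) S"
  unfolding holomorphic_sv_def
proof (rule ballI)
  fix z assume z: "z \<in> S"
  obtain D where D: "(f has_derivative D) (at (r *\<^sub>R z))" "\<And>c v. D (c *s v) = c * D v"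
    using f sub[OF z] by (auto simp: holomorphic_sv_def)
  have "((\<lambda>z. f (r *\<^sub>R z)) has_derivative (\<lambda>h. D (r *\<^sub>R h))) (at z)"
    by (rule has_derivative_compose[OF has_derivative_scaleR_right[OF has_derivative_ident] D(1)])
  then show "\<exists>D. ((\<lambda>z. f (r *\<^sub>R z)) has_derivative D) (at z) \<and> (\<forall>c v. D (c *s v) = c * D v)"
    by (rule exI[of _ "\<lambda>h. D (r *\<^sub>R h)", OF conjI])
      (simp add: scaleR_eq_vector_scale D(2) mult_ac)
qed

lemma scaleR_closed_polydisc_in_polydisc:
  assumes "z \<in> closed_polydisc" "0 \<le> r" "r < 1"
  shows "r *\<^sub>R z \<in> polydisc"
  unfolding polydisc_def
proof (intro CollectI allI)
  fix j
  have "norm ((r *\<^sub>R z) $ j) = r * norm (z $ j)" using assms by simp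
  also have "\<dots> \<le> r * 1" using assms by (intro mult_left_mono) (auto simp: closed_polydisc_def)
  finally show "norm ((r *\<^sub>R z) $ j) < 1" using assms by simp
qed

lemma scaleR_torus_in_polydisc: "\<zeta> \<in> torus \<Longrightarrow> 0 \<le> r \<Longrightarrow> r < 1 \<Longrightarrow> r *\<^sub>R \<zeta> \<in> polydisc"
  using torus_subset_closed_polydisc scaleR_closed_polydisc_in_polydisc by blast

lemma scaleR_polydisc_in_polydisc:
  assumes "z \<in> polydisc" "0 \<le> r" "r \<le> 1"
  shows "r *\<^sub>R z \<in> polydisc"
proof (cases "r = 1")
  case False
  then show ?thesis
    using assms scaleR_closed_polydisc_in_polydisc polydisc_subset_closed_polydisc by fastforce
qed (use assms in simp)

section \<open>Positivity, reproduction and symmetry of the Poisson kernel\<close>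

lemma poisson_kernel_nonneg: "z \<in> polydisc \<Longrightarrow> 0 \<le> poisson_kernel z \<zeta>"
  unfolding poisson_kernel_def polydisc_def
  by (intro prod_nonneg) (auto intro!: divide_nonneg_nonneg simp: power_le_one less_imp_le)

lemma cauchy_kernel_nonzero:
  assumes "z \<in> closed_polydisc" "w \<in> polydisc"
  shows "cauchy_kernel z w \<noteq> 0"
  unfolding cauchy_kernel_def
  using one_minus_mult_cnj_nonzero[OF closed_polydisc_mult_polydisc[OF assms]] by simp

text \<open>Up to a constant the Poisson kernel is \<open>cauchy_kernel z \<eta>\<close> times
  \<open>cauchy_kernel \<eta> z\<close>. The second factor is holomorphic in \<open>\<eta>\<close>
  across the closed polydisc, so the Cauchy formula applies to its product with \<open>F\<close>,
  and its value at \<open>z\<close> cancels the constant.\<close>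

lemma poisson_formula:
  assumes F: "holomorphic_sv F closed_polydisc" and z: "z \<in> polydisc"
  shows "(\<integral>\<eta>. of_real (poisson_kernel z \<eta>) * F \<eta> \<partial>torus_measure) = F z"
proof -
  have "(\<integral>\<eta>. of_real (poisson_kernel z \<eta>) * F \<eta> \<partial>torus_measure) =
      (\<integral>\<eta>. cauchy_kernel z \<eta> * (cauchy_kernel \<eta> z * F \<eta>) / cauchy_kernel z z \<partial>torus_measure)"
    using z by (intro Bochner_Integration.integral_cong refl)
      (simp add: poisson_kernel_eq_cauchy_kernel)
  also have "\<dots> = (\<integral>\<eta>. cauchy_kernel z \<eta> * (cauchy_kernel \<eta> z * F \<eta>) \<partial>torus_measure) / cauchy_kernel z z"
    by (rule integral_divide_zero)
  also have "\<dots> = F z"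
    using cauchy_formula[OF holomorphic_sv_mult[OF holomorphic_cauchy_kernel[OF z] F] z]
      cauchy_kernel_nonzero[of z z] z polydisc_subset_closed_polydisc by auto
  finally show ?thesis .
qed

text \<open>Swapping the two torus points conjugates the number inside each denominator, and each
  numerator depends on \<open>x\<close> alone. This is the source of self-adjointness.\<close>

lemma poisson_kernel_commute:
  assumes "\<zeta> \<in> torus" "\<eta> \<in> torus"
  shows "poisson_kernel (x *\<^sub>R \<zeta>) \<eta> = poisson_kernel (x *\<^sub>R \<eta>) \<zeta>"
  unfolding poisson_kernel_def
proof (rule prod.cong[OF refl])
  fix j
  have "norm (1 - (x *\<^sub>R \<zeta>) $ j * cnj (\<eta> $ j)) = norm (cnj (1 - (x *\<^sub>R \<eta>) $ j * cnj (\<zeta> $ j)))"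
    by (simp add: mult.commute)
  then show "(1 - (norm ((x *\<^sub>R \<zeta>) $ j))\<^sup>2) / (norm (1 - (x *\<^sub>R \<zeta>) $ j * cnj (\<eta> $ j)))\<^sup>2 =
      (1 - (norm ((x *\<^sub>R \<eta>) $ j))\<^sup>2) / (norm (1 - (x *\<^sub>R \<eta>) $ j * cnj (\<zeta> $ j)))\<^sup>2"
    using assms unfolding complex_mod_cnj by (simp add: torus_def)
qed

lemma poisson_kernel_bound:
  fixes \<zeta> \<eta> :: "complex ^ 'n"
  assumes "\<zeta> \<in> torus" "\<eta> \<in> torus" "0 \<le> x" "x < 1"
  shows "poisson_kernel (x *\<^sub>R \<zeta>) \<eta> \<le> (1 / (1 - x)\<^sup>2) ^ CARD('n)"
proof -
  have "poisson_kernel (x *\<^sub>R \<zeta>) \<eta> \<le> (\<Prod>j\<in>(UNIV :: 'n set). 1 / (1 - x)\<^sup>2)"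
    unfolding poisson_kernel_def
  proof (rule prod_mono)
    fix j
    have n: "norm (\<zeta> $ j) = 1" "norm (\<eta> $ j) = 1" using assms by (auto simp: torus_def)
    have "1 - x \<le> norm (1 - (x *\<^sub>R \<zeta>) $ j * cnj (\<eta> $ j))"
      using norm_triangle_ineq2[of 1 "(x *\<^sub>R \<zeta>) $ j * cnj (\<eta> $ j)"] assms n by (simp add: norm_mult)
    then have "(1 - x)\<^sup>2 \<le> (norm (1 - (x *\<^sub>R \<zeta>) $ j * cnj (\<eta> $ j)))\<^sup>2"
      using assms by (intro power_mono) auto
    moreover have "0 \<le> 1 - (norm ((x *\<^sub>R \<zeta>) $ j))\<^sup>2" "1 - (norm ((x *\<^sub>R \<zeta>) $ j))\<^sup>2 \<le> 1"
      using assms n by (auto simp: power_le_one)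
    ultimately show "0 \<le> (1 - (norm ((x *\<^sub>R \<zeta>) $ j))\<^sup>2) / (norm (1 - (x *\<^sub>R \<zeta>) $ j * cnj (\<eta> $ j)))\<^sup>2 \<and>
        (1 - (norm ((x *\<^sub>R \<zeta>) $ j))\<^sup>2) / (norm (1 - (x *\<^sub>R \<zeta>) $ j * cnj (\<eta> $ j)))\<^sup>2 \<le> 1 / (1 - x)\<^sup>2"
      using assms by (intro conjI divide_nonneg_nonneg frac_le) auto
  qed
  then show ?thesis by simp
qed

lemma Fubini_bounded:
  fixes k :: "'a \<Rightarrow> 'b \<Rightarrow> complex"
  assumes "finite_measure M" "finite_measure N"
    and k: "(\<lambda>(x, y). k x y) \<in> borel_measurable (M \<Otimes>\<^sub>M N)"
    and B: "\<And>x y. x \<in> space M \<Longrightarrow> y \<in> space N \<Longrightarrow> norm (k x y) \<le> B"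
  shows "(\<integral>y. (\<integral>x. k x y \<partial>M) \<partial>N) = (\<integral>x. (\<integral>y. k x y \<partial>N) \<partial>M)"
proof -
  interpret M: finite_measure M by fact
  interpret N: finite_measure N by fact
  interpret pair_sigma_finite M N ..
  interpret MN: finite_measure "M \<Otimes>\<^sub>M N"
    by (rule finite_measure_pair_measure[OF assms(2,1)])
  have "integrable (M \<Otimes>\<^sub>M N) (\<lambda>(x, y). k x y)"
    by (rule MN.integrable_const_bound[OF _ k]) (auto intro!: AE_I2 B simp: space_pair_measure)
  then show ?thesis by (rule Fubini_integral)
qed

lemma poisson_kernel_measurable_pair:
  assumes "sets M = sets torus_borel" "sets N = sets torus_borel"
  shows "(\<lambda>(\<zeta>, \<eta>). poisson_kernel (x *\<^sub>R \<zeta>) \<eta>) \<in> borel_measurable (M \<Otimes>\<^sub>M N)"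
proof -
  have M: "(\<lambda>\<zeta>. \<zeta>) \<in> borel_measurable M" and N: "(\<lambda>\<eta>. \<eta>) \<in> borel_measurable N"
    using measurable_torus_borel_ident
    by (simp_all add: measurable_cong_sets[OF assms(1) refl] measurable_cong_sets[OF assms(2) refl])
  have "fst \<in> borel_measurable (M \<Otimes>\<^sub>M N)" "snd \<in> borel_measurable (M \<Otimes>\<^sub>M N)"
    using measurable_compose[OF measurable_fst[of M N] M] measurable_compose[OF measurable_snd[of M N] N]
    by simp_all
  then have "(\<lambda>p. poisson_kernel (x *\<^sub>R fst p) (snd p)) \<in> borel_measurable (M \<Otimes>\<^sub>M N)"
    by (intro poisson_kernel_measurable borel_measurable_scaleR borel_measurable_const)
  then show ?thesis by (simp add: case_prod_beta')
qed

text \<open>For fixed \<open>x\<close> below 1 the kernel is bounded, so the order of integration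
  can be exchanged; the symmetry of the kernel then places the average on the other factor.\<close>

lemma poisson_symmetric:
  fixes f g :: "complex ^ 'n \<Rightarrow> complex"
  assumes f: "f \<in> borel_measurable torus_borel" "\<And>\<zeta>. \<zeta> \<in> torus \<Longrightarrow> norm (f \<zeta>) \<le> A"
    and g: "g \<in> borel_measurable torus_borel" "\<And>\<zeta>. \<zeta> \<in> torus \<Longrightarrow> norm (g \<zeta>) \<le> B"
    and x: "0 \<le> x" "x < 1"
  shows "(\<integral>\<zeta>. (\<integral>\<eta>. of_real (poisson_kernel (x *\<^sub>R \<zeta>) \<eta>) * f \<eta> \<partial>torus_measure) * g \<zeta> \<partial>torus_measure) =
    (\<integral>\<eta>. f \<eta> * (\<integral>\<zeta>. of_real (poisson_kernel (x *\<^sub>R \<eta>) \<zeta>) * g \<zeta> \<partial>torus_measure) \<partial>torus_measure)"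
proof -
  let ?k = "\<lambda>\<zeta> \<eta>. of_real (poisson_kernel (x *\<^sub>R \<zeta>) \<eta>) * f \<eta> * g \<zeta> :: complex"
  let ?C = "(1 / (1 - x)\<^sup>2) ^ CARD('n)"
  have C0: "0 \<le> ?C" by simp
  obtain \<zeta>\<^sub>0 :: "complex ^ 'n" where z0: "\<zeta>\<^sub>0 \<in> torus"
    using that[of "\<chi> j. 1"] by (auto simp: torus_def)
  have A0: "0 \<le> A" using f(2)[OF z0] norm_ge_zero order_trans by blast
  have "(\<integral>\<eta>. (\<integral>\<zeta>. ?k \<zeta> \<eta> \<partial>torus_measure) \<partial>torus_measure) = (\<integral>\<zeta>. (\<integral>\<eta>. ?k \<zeta> \<eta> \<partial>torus_measure) \<partial>torus_measure)"
  proof (rule Fubini_bounded)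
    have "(\<lambda>p. poisson_kernel (x *\<^sub>R fst p) (snd p)) \<in> borel_measurable (torus_measure \<Otimes>\<^sub>M (torus_measure :: (complex ^ 'n) measure))"
      using poisson_kernel_measurable_pair[of torus_measure torus_measure x] by (simp add: case_prod_beta')
    moreover have "(\<lambda>p. f (snd p)) \<in> borel_measurable (torus_measure \<Otimes>\<^sub>M (torus_measure :: (complex ^ 'n) measure))"
      by (rule measurable_compose[OF measurable_snd]) (use f in simp)
    moreover have "(\<lambda>p. g (fst p)) \<in> borel_measurable (torus_measure \<Otimes>\<^sub>M (torus_measure :: (complex ^ 'n) measure))"
      by (rule measurable_compose[OF measurable_fst]) (use g in simp)
    ultimately show "(\<lambda>(\<zeta>, \<eta>). ?k \<zeta> \<eta>) \<in> borel_measurable (torus_measure \<Otimes>\<^sub>M torus_measure)"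
      unfolding case_prod_beta'
      by (intro borel_measurable_times borel_measurable_of_real[THEN measurable_compose[rotated]])
    fix \<zeta> \<eta> :: "complex ^ 'n" assume "\<zeta> \<in> space torus_measure" "\<eta> \<in> space torus_measure"
    then have t: "\<zeta> \<in> torus" "\<eta> \<in> torus" by simp_all
    have "norm (of_real (poisson_kernel (x *\<^sub>R \<zeta>) \<eta>) :: complex) \<le> ?C"
      using poisson_kernel_bound[OF t x] poisson_kernel_nonneg[OF scaleR_torus_in_polydisc[OF t(1) x], of \<eta>] by simp
    then show "norm (?k \<zeta> \<eta>) \<le> ?C * A * B"
      unfolding norm_mult using f(2)[OF t(2)] g(2)[OF t(1)] C0 A0
      by (intro mult_mono mult_nonneg_nonneg) auto
  qed (rule torus.finite_measure_axioms)+
  moreover have "(\<integral>\<zeta>. (\<integral>\<eta>. ?k \<zeta> \<eta> \<partial>torus_measure) \<partial>torus_measure) =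
      (\<integral>\<zeta>. (\<integral>\<eta>. of_real (poisson_kernel (x *\<^sub>R \<zeta>) \<eta>) * f \<eta> \<partial>torus_measure) * g \<zeta> \<partial>torus_measure)"
    by simp
  moreover have "(\<integral>\<eta>. (\<integral>\<zeta>. ?k \<zeta> \<eta> \<partial>torus_measure) \<partial>torus_measure) =
      (\<integral>\<eta>. f \<eta> * (\<integral>\<zeta>. of_real (poisson_kernel (x *\<^sub>R \<eta>) \<zeta>) * g \<zeta> \<partial>torus_measure) \<partial>torus_measure)"
  proof (intro Bochner_Integration.integral_cong refl)
    fix \<eta> :: "complex ^ 'n" assume "\<eta> \<in> space torus_measure"
    then have "(\<integral>\<zeta>. ?k \<zeta> \<eta> \<partial>torus_measure) =
        (\<integral>\<zeta>. f \<eta> * (of_real (poisson_kernel (x *\<^sub>R \<eta>) \<zeta>) * g \<zeta>) \<partial>torus_measure)"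
      by (intro Bochner_Integration.integral_cong refl) (auto simp: poisson_kernel_commute[of _ \<eta>])
    then show "(\<integral>\<zeta>. ?k \<zeta> \<eta> \<partial>torus_measure) =
        f \<eta> * (\<integral>\<zeta>. of_real (poisson_kernel (x *\<^sub>R \<eta>) \<zeta>) * g \<zeta> \<partial>torus_measure)"
      by simp
  qed
  ultimately show ?thesis by simp
qed

section \<open>Dilates of holomorphic functions on the torus\<close>

lemma continuous_on_torus_L2:
  fixes f :: "complex ^ 'n \<Rightarrow> complex"
  assumes "finite_measure \<sigma>" "sets \<sigma> = sets torus_borel" "continuous_on torus f"
  shows "f \<in> L2 \<sigma>"
proof -
  have sp: "space \<sigma> = torus"
    using sets_eq_imp_space_eq[OF assms(2)] by (simp add: space_restrict_space)
  obtain B where "\<And>\<zeta>. \<zeta> \<in> torus \<Longrightarrow> norm (f \<zeta>) \<le> B"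
    using compact_imp_bounded[OF compact_continuous_image[OF assms(3) compact_torus]]
    unfolding bounded_iff by (meson imageI)
  moreover have "f \<in> borel_measurable \<sigma>"
    using continuous_on_torus_measurable[OF assms(3)]
    by (simp add: measurable_cong_sets[OF assms(2) refl])
  ultimately show ?thesis
    using finite_measure.L2_bounded[OF assms(1), of f B] sp by blast
qed

lemma borel_measurable_torus_measure [simp]:
  "borel_measurable torus_measure = borel_measurable torus_borel"
  by (rule measurable_cong_sets) simp_all

lemma dilation_continuous:
  assumes "holomorphic_sv f polydisc" "0 \<le> r" "r < 1"
  shows "continuous_on closed_polydisc (\<lambda>z. f (r *\<^sub>R z))"
  by (rule holomorphic_sv_continuous[OF holomorphic_sv_dilation[OF assms(1)]])
    (use assms(2,3) scaleR_closed_polydisc_in_polydisc in blast)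

lemma dilation_continuous_torus:
  assumes "holomorphic_sv f polydisc" "0 \<le> r" "r < 1"
  shows "continuous_on torus (\<lambda>z. f (r *\<^sub>R z))"
  by (rule continuous_on_subset[OF dilation_continuous[OF assms] torus_subset_closed_polydisc])

lemma dilation_L2:
  assumes "holomorphic_sv f polydisc" "0 \<le> r" "r < 1"
  shows "(\<lambda>\<zeta>. f (r *\<^sub>R \<zeta>)) \<in> L2 torus_measure"
  by (rule continuous_on_torus_L2[OF torus.finite_measure_axioms sets_torus_measure
        dilation_continuous_torus[OF assms]])

lemma dilation_bounded:
  assumes "holomorphic_sv f polydisc" "0 \<le> r" "r < 1"
  obtains B where "\<And>\<zeta>. \<zeta> \<in> torus \<Longrightarrow> norm (f (r *\<^sub>R \<zeta>)) \<le> B"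
  using compact_imp_bounded[OF compact_continuous_image[OF dilation_continuous_torus[OF assms] compact_torus]]
  unfolding bounded_iff by (meson imageI)

text \<open>This is the Poisson formula for the dilate by \<open>r\<close>, which is holomorphic
  across the closed polydisc because \<open>r\<close> is below 1. Read in terms of radii, it is the
  semigroup law behind the later estimates.\<close>

lemma dilation_poisson:
  assumes f: "holomorphic_sv f polydisc" and r: "0 \<le> r" "r < 1" and x: "0 \<le> x" "x < 1"
    and \<zeta>: "\<zeta> \<in> torus"
  shows "(\<integral>\<eta>. of_real (poisson_kernel (x *\<^sub>R \<zeta>) \<eta>) * f (r *\<^sub>R \<eta>) \<partial>torus_measure) = f ((r * x) *\<^sub>R \<zeta>)"
proof -
  have "holomorphic_sv (\<lambda>z. f (r *\<^sub>R z)) closed_polydisc"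
    using f r scaleR_closed_polydisc_in_polydisc by (intro holomorphic_sv_dilation) blast+
  from poisson_formula[OF this scaleR_torus_in_polydisc[OF \<zeta> x]] show ?thesis by simp
qed

text \<open>Since the Poisson kernel is symmetric, the inner product of the dilates by \<open>r\<close> and \<open>s\<close> only
  depends on \<open>r * s\<close>.\<close>

lemma dilation_inner_shift:
  assumes f: "holomorphic_sv f polydisc" and r: "0 \<le> r" "r < 1" and s: "0 \<le> s" "s < 1"
    and x: "0 \<le> x" "x < 1"
  shows "L2_inner torus_measure (\<lambda>\<zeta>. f ((r * x) *\<^sub>R \<zeta>)) (\<lambda>\<zeta>. f (s *\<^sub>R \<zeta>)) =
    L2_inner torus_measure (\<lambda>\<zeta>. f (r *\<^sub>R \<zeta>)) (\<lambda>\<zeta>. f ((s * x) *\<^sub>R \<zeta>))"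
proof -
  obtain A where A: "\<And>\<zeta>. \<zeta> \<in> torus \<Longrightarrow> norm (f (r *\<^sub>R \<zeta>)) \<le> A"
    using dilation_bounded[OF f r] by blast
  obtain B where B: "\<And>\<zeta>. \<zeta> \<in> torus \<Longrightarrow> norm (f (s *\<^sub>R \<zeta>)) \<le> B"
    using dilation_bounded[OF f s] by blast
  have m: "(\<lambda>\<zeta>. f (r *\<^sub>R \<zeta>)) \<in> borel_measurable torus_borel"
    "(\<lambda>\<zeta>. cnj (f (s *\<^sub>R \<zeta>))) \<in> borel_measurable torus_borel"
    using dilation_continuous_torus[OF f r] dilation_continuous_torus[OF f s]
    by (auto intro!: borel_measurable_cnj continuous_on_torus_measurable)
  have "L2_inner torus_measure (\<lambda>\<zeta>. f ((r * x) *\<^sub>R \<zeta>)) (\<lambda>\<zeta>. f (s *\<^sub>R \<zeta>)) =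
      (\<integral>\<zeta>. (\<integral>\<eta>. of_real (poisson_kernel (x *\<^sub>R \<zeta>) \<eta>) * f (r *\<^sub>R \<eta>) \<partial>torus_measure) * cnj (f (s *\<^sub>R \<zeta>)) \<partial>torus_measure)"
    unfolding L2_inner_def
    by (intro Bochner_Integration.integral_cong refl) (simp add: dilation_poisson[OF f r x])
  also have "\<dots> = (\<integral>\<eta>. f (r *\<^sub>R \<eta>) * (\<integral>\<zeta>. of_real (poisson_kernel (x *\<^sub>R \<eta>) \<zeta>) * cnj (f (s *\<^sub>R \<zeta>)) \<partial>torus_measure) \<partial>torus_measure)"
    by (rule poisson_symmetric[OF m(1) A m(2) _ x]) (use B in auto)
  also have "\<dots> = L2_inner torus_measure (\<lambda>\<zeta>. f (r *\<^sub>R \<zeta>)) (\<lambda>\<zeta>. f ((s * x) *\<^sub>R \<zeta>))"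
    unfolding L2_inner_def
  proof (intro Bochner_Integration.integral_cong refl)
    fix \<eta> :: "complex ^ 'a" assume "\<eta> \<in> space torus_measure"
    then have "cnj (f ((s * x) *\<^sub>R \<eta>)) = cnj (\<integral>\<zeta>. of_real (poisson_kernel (x *\<^sub>R \<eta>) \<zeta>) * f (s *\<^sub>R \<zeta>) \<partial>torus_measure)"
      by (simp add: dilation_poisson[OF f s x])
    also have "\<dots> = (\<integral>\<zeta>. of_real (poisson_kernel (x *\<^sub>R \<eta>) \<zeta>) * cnj (f (s *\<^sub>R \<zeta>)) \<partial>torus_measure)"
      by (simp flip: Bochner_Integration.integral_cnj)
    finally show "f (r *\<^sub>R \<eta>) * (\<integral>\<zeta>. of_real (poisson_kernel (x *\<^sub>R \<eta>) \<zeta>) * cnj (f (s *\<^sub>R \<zeta>)) \<partial>torus_measure) =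
        f (r *\<^sub>R \<eta>) * cnj (f ((s * x) *\<^sub>R \<eta>))" by simp
  qed
  finally show ?thesis .
qed

section \<open>Convexity of the mean squares in the logarithm of the radius\<close>

definition mean_square :: "(complex ^ 'n \<Rightarrow> complex) \<Rightarrow> real \<Rightarrow> real" where
  "mean_square f r = (L2_norm torus_measure (\<lambda>\<zeta>. f (r *\<^sub>R \<zeta>)))\<^sup>2"

lemma mean_square_nonneg [simp]: "0 \<le> mean_square f r"
  by (simp add: mean_square_def)

lemma mult_less_one_real: "0 \<le> a \<Longrightarrow> a < 1 \<Longrightarrow> x \<le> 1 \<Longrightarrow> a * x < (1 :: real)"
  using mult_left_le[of x a] by linarith

text \<open>The cross term pairs the radii \<open>s\<close> and \<open>s * x\<^sup>2\<close>;
  shifting one factor \<open>x\<close> across turns it into the mean square at their geometric mean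
  \<open>s * x\<close>. Since the left side is nonnegative, this is also a convexity
  statement.\<close>

lemma dilation_diff_norm:
  assumes f: "holomorphic_sv f polydisc" and s: "0 \<le> s" "s < 1" and x: "0 \<le> x" "x < 1"
  shows "(L2_norm torus_measure (\<lambda>\<zeta>. f (s *\<^sub>R \<zeta>) - f ((s * x\<^sup>2) *\<^sub>R \<zeta>)))\<^sup>2 =
    mean_square f s + mean_square f (s * x\<^sup>2) - 2 * mean_square f (s * x)"
proof -
  have sx: "0 \<le> s * x" "s * x < 1" "0 \<le> s * x\<^sup>2" "s * x\<^sup>2 < 1"
    using s x mult_less_one_real[of s x] mult_less_one_real[of s "x\<^sup>2"] power_le_one[of x 2] by auto
  let ?h = "\<lambda>r \<zeta>. f (r *\<^sub>R \<zeta>)"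
  have "L2_inner torus_measure (?h s) (?h (s * x\<^sup>2)) = cnj (L2_inner torus_measure (?h (s * x\<^sup>2)) (?h s))"
    by (rule L2_inner_commute)
  also have "L2_inner torus_measure (?h (s * x\<^sup>2)) (?h s) = L2_inner torus_measure (?h (s * x)) (?h (s * x))"
    using dilation_inner_shift[OF f sx(1,2) s x] by (simp add: power2_eq_square mult.assoc)
  finally have "Re (L2_inner torus_measure (?h s) (?h (s * x\<^sup>2))) = mean_square f (s * x)"
    by (simp add: L2_inner_self mean_square_def)
  then show ?thesis
    using L2_norm_lincomb[OF dilation_L2[OF f s] dilation_L2[OF f sx(3,4)], of 1 "-1"]
    by (simp add: mean_square_def)
qed

text \<open>By convexity one upward step would be followed by steps at least as large forever,
  contradicting the upper bound.\<close>

lemma bounded_convex_seq_decreasing: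
  fixes b :: "nat \<Rightarrow> real"
  assumes convex: "\<And>m. 2 * b (Suc m) \<le> b (Suc (Suc m)) + b m" and bound: "\<And>m. b m \<le> A"
  shows "b (Suc m) \<le> b m"
proof (rule ccontr)
  assume *: "\<not> ?thesis"
  define c where "c = b (Suc m) - b m"
  have c: "c > 0" using * by (simp add: c_def)
  have step: "c \<le> b (Suc (m + k)) - b (m + k)" for k
  proof (induction k)
    case (Suc k)
    then show ?case using convex[of "m + k"] by simp
  qed (simp add: c_def)
  have grow: "b m + real k * c \<le> b (m + k)" for k
  proof (induction k)
    case (Suc k)
    then show ?case using step[of k] by (simp add: algebra_simps)
  qed simp
  obtain k where "A - b m < real k * c" using reals_Archimedean3[OF c] by blast
  then show False using grow[of k] bound[of "m + k"] by linarith
qed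

text \<open>Along the radii \<open>s * x ^ m\<close> with \<open>x = r / s\<close> the means form a
  bounded convex sequence, and its first two terms are the means at \<open>s\<close> and at
  \<open>r\<close>.\<close>

lemma mean_square_mono:
  assumes f: "holomorphic_sv f polydisc" and A: "\<And>r. 0 < r \<Longrightarrow> r < 1 \<Longrightarrow> mean_square f r \<le> A"
    and r: "0 < r" "r \<le> s" "s < 1"
  shows "mean_square f r \<le> mean_square f s"
proof (cases "r = s")
  case False
  define x where "x = r / s"
  have s: "0 < s" using r by linarith
  have x: "0 < x" "x < 1" using r s False by (auto simp: x_def)
  have sx: "0 < s * x ^ m" "s * x ^ m < 1" for m
    using s x r mult_less_one_real[of s "x ^ m"] power_le_one[of x m] by auto
  have "mean_square f (s * x ^ Suc 0) \<le> mean_square f (s * x ^ 0)"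
  proof (rule bounded_convex_seq_decreasing)
    fix m
    show "mean_square f (s * x ^ m) \<le> A" using sx by (rule A)
    have "0 \<le> mean_square f (s * x ^ m) + mean_square f (s * x ^ m * x\<^sup>2) - 2 * mean_square f (s * x ^ m * x)"
      unfolding dilation_diff_norm[OF f less_imp_le[OF sx(1)] sx(2) less_imp_le[OF x(1)] x(2), symmetric]
      by simp
    then show "2 * mean_square f (s * x ^ Suc m) \<le> mean_square f (s * x ^ Suc (Suc m)) + mean_square f (s * x ^ m)"
      by (simp add: power2_eq_square mult_ac)
  qed
  then show ?thesis using s by (simp add: x_def)
qed simp

text \<open>The squared distance of two dilates is the sum of their means minus twice the mean at
  the geometric mean of the radii. Beyond \<open>R\<close> all means lie between
  \<open>L - e / 2\<close> and the supremum \<open>L\<close>, so this is below \<open>e\<close>. The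
  choice \<open>x = sqrt (r / s)\<close> makes \<open>s * x\<close> that geometric mean and
  \<open>s * x\<^sup>2\<close> equal to \<open>r\<close>.\<close>

lemma dilation_L2_Cauchy:
  assumes f: "holomorphic_sv f polydisc" and A: "\<And>r. 0 < r \<Longrightarrow> r < 1 \<Longrightarrow> mean_square f r \<le> A" and "e > 0"
  obtains R where "0 < R" "R < 1"
    "\<And>r s. R \<le> r \<Longrightarrow> r < 1 \<Longrightarrow> R \<le> s \<Longrightarrow> s < 1 \<Longrightarrow>
      (L2_norm torus_measure (\<lambda>\<zeta>. f (r *\<^sub>R \<zeta>) - f (s *\<^sub>R \<zeta>)))\<^sup>2 < e"
proof -
  define L where "L = (SUP r\<in>{0<..<1}. mean_square f r)"
  have bdd: "bdd_above (mean_square f ` {0<..<1})" using A by (auto intro!: bdd_aboveI[of _ A])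
  have le_L: "mean_square f r \<le> L" if "0 < r" "r < 1" for r
    unfolding L_def using that by (intro cSUP_upper bdd) auto
  have "L - e / 2 < L" using \<open>e > 0\<close> by simp
  then obtain R where R: "0 < R" "R < 1" "L - e / 2 < mean_square f R"
    unfolding L_def using bdd by (subst (asm) less_cSUP_iff) auto
  have close: "(L2_norm torus_measure (\<lambda>\<zeta>. f (s *\<^sub>R \<zeta>) - f (r *\<^sub>R \<zeta>)))\<^sup>2 < e"
    if rs: "R \<le> r" "r < s" "s < 1" for r s
  proof -
    define x where "x = sqrt (r / s)"
    have pos: "0 < r" "0 < s" using rs R by linarith+
    have x: "0 \<le> x" "x < 1" "x\<^sup>2 = r / s" using pos rs by (auto simp: x_def)
    have "x\<^sup>2 \<le> x" using mult_left_mono[of x 1 x] x(1,2) by (simp only: power2_eq_square) simp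
    then have "s * x\<^sup>2 \<le> s * x" using pos by simp
    then have sx: "R \<le> s * x" using x pos rs by simp
    moreover have sx1: "s * x < 1" using x pos rs mult_less_one_real[of s x] by simp
    ultimately have "mean_square f R \<le> mean_square f (s * x)"
      using R by (intro mean_square_mono[OF f A]) auto
    moreover have "mean_square f s \<le> L" "mean_square f r \<le> L" using pos rs by (auto intro: le_L)
    ultimately show ?thesis
      using dilation_diff_norm[OF f _ rs(3) x(1,2)] x(3) pos R(3) by simp
  qed
  show thesis
  proof (rule that[OF R(1,2)])
    fix r s assume *: "R \<le> r" "r < 1" "R \<le> s" "s < 1"
    consider "r = s" | "r < s" | "s < r" by linarith
    then show "(L2_norm torus_measure (\<lambda>\<zeta>. f (r *\<^sub>R \<zeta>) - f (s *\<^sub>R \<zeta>)))\<^sup>2 < e"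
    proof cases
      case 1
      then show ?thesis using \<open>e > 0\<close> by (simp add: L2_norm_def)
    next
      case 2
      then show ?thesis using close[of r s] * by (subst L2_norm_minus_commute) simp
    qed (use close[of s r] * in simp)
  qed
qed

section \<open>A maximal inequality for dilations\<close>

definition poisson_average :: "real \<Rightarrow> (complex ^ 'n \<Rightarrow> real) \<Rightarrow> complex ^ 'n \<Rightarrow> real" where
  "poisson_average x f \<zeta> = (\<integral>\<eta>. poisson_kernel (x *\<^sub>R \<zeta>) \<eta> * f \<eta> \<partial>torus_measure)"

lemma poisson_kernel_measurable_torus:
  "poisson_kernel z \<in> borel_measurable torus_borel"
  using poisson_kernel_measurable[OF borel_measurable_const measurable_torus_borel_ident, of z] by simp

lemma poisson_kernel_integral:
  assumes "z \<in> polydisc"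
  shows "(\<integral>\<eta>. poisson_kernel z \<eta> \<partial>torus_measure) = 1"
proof -
  have "(\<integral>\<eta>. complex_of_real (poisson_kernel z \<eta>) \<partial>torus_measure) = 1"
    using poisson_formula[OF holomorphic_sv_const[of 1] assms] by simp
  then show ?thesis by (simp only: integral_complex_of_real of_real_eq_1_iff)
qed

lemma continuous_on_torus_bounded:
  fixes f :: "complex ^ 'n \<Rightarrow> 'b::real_normed_vector"
  assumes "continuous_on torus f"
  obtains B where "\<And>\<zeta>. \<zeta> \<in> torus \<Longrightarrow> norm (f \<zeta>) \<le> B"
  using compact_imp_bounded[OF compact_continuous_image[OF assms compact_torus]]
  unfolding bounded_iff by (meson imageI)

lemma continuous_on_torus_integrable:
  fixes f :: "complex ^ 'n \<Rightarrow> 'b::{banach, second_countable_topology}"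
  assumes "continuous_on torus f"
  shows "integrable torus_measure f"
proof -
  obtain B where "\<And>\<zeta>. \<zeta> \<in> torus \<Longrightarrow> norm (f \<zeta>) \<le> B"
    using continuous_on_torus_bounded[OF assms] by blast
  then show ?thesis
    using continuous_on_torus_measurable[OF assms]
    by (intro torus.integrable_const_bound[of _ B] AE_I2) auto
qed

context
  fixes x :: real
  assumes x: "0 \<le> x" "x < 1"
begin

lemma poisson_average_integrable:
  fixes f :: "complex ^ 'n \<Rightarrow> real"
  assumes f: "continuous_on torus f" and \<zeta>: "\<zeta> \<in> torus"
  shows "integrable torus_measure (\<lambda>\<eta>. poisson_kernel (x *\<^sub>R \<zeta>) \<eta> * f \<eta>)"
proof -
  obtain B where B: "\<And>\<zeta>. \<zeta> \<in> torus \<Longrightarrow> norm (f \<zeta>) \<le> B"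
    using continuous_on_torus_bounded[OF f] by blast
  show ?thesis
  proof (rule torus.integrable_const_bound[of _ "(1 / (1 - x)\<^sup>2) ^ CARD('n) * B"])
    show "AE \<eta> in torus_measure. norm (poisson_kernel (x *\<^sub>R \<zeta>) \<eta> * f \<eta>) \<le> (1 / (1 - x)\<^sup>2) ^ CARD('n) * B"
    proof (rule AE_I2)
      fix \<eta> :: "complex ^ 'n" assume "\<eta> \<in> space torus_measure"
      then have \<eta>: "\<eta> \<in> torus" by simp
      show "norm (poisson_kernel (x *\<^sub>R \<zeta>) \<eta> * f \<eta>) \<le> (1 / (1 - x)\<^sup>2) ^ CARD('n) * B"
        unfolding norm_mult
        using poisson_kernel_bound[OF \<zeta> \<eta> x] B[OF \<eta>] poisson_kernel_nonneg[OF scaleR_torus_in_polydisc[OF \<zeta> x], of \<eta>]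
        by (intro mult_mono) auto
    qed
    show "(\<lambda>\<eta>. poisson_kernel (x *\<^sub>R \<zeta>) \<eta> * f \<eta>) \<in> borel_measurable torus_measure"
      unfolding borel_measurable_torus_measure
      by (intro borel_measurable_times poisson_kernel_measurable_torus continuous_on_torus_measurable f)
  qed
qed

lemma poisson_average_mono:
  fixes f g :: "complex ^ 'n \<Rightarrow> real"
  assumes "continuous_on torus f" "continuous_on torus g" "\<zeta> \<in> torus" "\<And>\<eta>. \<eta> \<in> torus \<Longrightarrow> f \<eta> \<le> g \<eta>"
  shows "poisson_average x f \<zeta> \<le> poisson_average x g \<zeta>"
  unfolding poisson_average_def
  by (intro integral_mono poisson_average_integrable assms mult_left_mono
      poisson_kernel_nonneg scaleR_torus_in_polydisc x) (use assms(4) in simp)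

lemma poisson_average_const: "\<zeta> \<in> torus \<Longrightarrow> poisson_average x (\<lambda>_. c) \<zeta> = c"
  unfolding poisson_average_def
  by (simp add: poisson_kernel_integral scaleR_torus_in_polydisc x)

lemma poisson_average_sum_shift:
  fixes g :: "nat \<Rightarrow> complex ^ 'n \<Rightarrow> real"
  assumes "\<And>k. continuous_on torus (g k)" "\<zeta> \<in> torus"
  shows "poisson_average x (\<lambda>\<eta>. \<Sum>k<p. (g k \<eta> - l)) \<zeta> = (\<Sum>k<p. (poisson_average x (g k) \<zeta> - l))"
proof -
  have "poisson_average x (\<lambda>\<eta>. \<Sum>k<p. (g k \<eta> - l)) \<zeta> =
      (\<Sum>k<p. \<integral>\<eta>. poisson_kernel (x *\<^sub>R \<zeta>) \<eta> * (g k \<eta> - l) \<partial>torus_measure)"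
    unfolding poisson_average_def sum_distrib_left
    by (intro Bochner_Integration.integral_sum poisson_average_integrable continuous_on_diff
        continuous_on_const assms)
  also have "\<dots> = (\<Sum>k<p. (poisson_average x (g k) \<zeta> - poisson_average x (\<lambda>_. l) \<zeta>))"
    unfolding poisson_average_def right_diff_distrib
    by (intro sum.cong refl Bochner_Integration.integral_diff poisson_average_integrable
        continuous_on_const assms)
  finally show ?thesis using poisson_average_const[OF assms(2)] by simp
qed

lemma poisson_average_measurable:
  fixes f :: "complex ^ 'n \<Rightarrow> real"
  assumes f: "continuous_on torus f"
  shows "poisson_average x f \<in> borel_measurable torus_borel"
proof -
  have "(\<lambda>p. poisson_kernel (x *\<^sub>R fst p) (snd p)) \<in> borel_measurable (torus_borel \<Otimes>\<^sub>M (torus_measure :: (complex ^ 'n) measure))"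
    using poisson_kernel_measurable_pair[of torus_borel torus_measure x] by (simp add: case_prod_beta')
  moreover have "(\<lambda>p. f (snd p)) \<in> borel_measurable (torus_borel \<Otimes>\<^sub>M (torus_measure :: (complex ^ 'n) measure))"
    by (rule measurable_compose[OF measurable_snd]) (use continuous_on_torus_measurable[OF f] in simp)
  ultimately have "(\<lambda>(\<zeta>, \<eta>). poisson_kernel (x *\<^sub>R \<zeta>) \<eta> * f \<eta>) \<in> borel_measurable (torus_borel \<Otimes>\<^sub>M (torus_measure :: (complex ^ 'n) measure))"
    unfolding case_prod_beta' by (intro borel_measurable_times)
  then show ?thesis
    unfolding poisson_average_def by (rule torus.borel_measurable_lebesgue_integral)
qed

lemma poisson_average_integrable_outer:
  fixes f :: "complex ^ 'n \<Rightarrow> real"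
  assumes f: "continuous_on torus f"
  shows "integrable torus_measure (poisson_average x f)"
proof -
  obtain B where B: "\<And>\<zeta>. \<zeta> \<in> torus \<Longrightarrow> norm (f \<zeta>) \<le> B"
    using continuous_on_torus_bounded[OF f] by blast
  have B': "f \<zeta> \<le> B" "- B \<le> f \<zeta>" if "\<zeta> \<in> torus" for \<zeta>
    using B[OF that] by (auto simp: abs_le_iff)
  have "norm (poisson_average x f \<zeta>) \<le> B" if "\<zeta> \<in> torus" for \<zeta>
  proof -
    have "poisson_average x f \<zeta> \<le> poisson_average x (\<lambda>_. B) \<zeta>"
      using f that B' by (intro poisson_average_mono) auto
    moreover have "poisson_average x (\<lambda>_. - B) \<zeta> \<le> poisson_average x f \<zeta>"
      using f that B' by (intro poisson_average_mono) auto
    ultimately show ?thesis using that by (simp add: poisson_average_const)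
  qed
  then show ?thesis
    using poisson_average_measurable[OF f]
    by (intro torus.integrable_const_bound[of _ B] AE_I2) auto
qed

text \<open>Self-adjointness tested against the constant 1, which the average fixes.\<close>

lemma integral_poisson_average:
  fixes f :: "complex ^ 'n \<Rightarrow> real"
  assumes f: "continuous_on torus f"
  shows "(\<integral>\<zeta>. poisson_average x f \<zeta> \<partial>torus_measure) = (\<integral>\<zeta>. f \<zeta> \<partial>torus_measure)"
proof -
  obtain B where B: "\<And>\<zeta>. \<zeta> \<in> torus \<Longrightarrow> norm (f \<zeta>) \<le> B"
    using continuous_on_torus_bounded[OF f] by blast
  have m: "(\<lambda>\<eta>. complex_of_real (f \<eta>)) \<in> borel_measurable torus_borel"
    using f by (intro continuous_on_torus_measurable continuous_on_of_real)
  have "(\<integral>\<zeta>. (\<integral>\<eta>. of_real (poisson_kernel (x *\<^sub>R \<zeta>) \<eta>) * of_real (f \<eta>) \<partial>torus_measure) * (1::complex) \<partial>torus_measure) =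
    (\<integral>\<eta>. of_real (f \<eta>) * (\<integral>\<zeta>. of_real (poisson_kernel (x *\<^sub>R \<eta>) \<zeta>) * 1 \<partial>torus_measure) \<partial>torus_measure)"
    by (rule poisson_symmetric[OF m _ _ _ x]) (use B in auto)
  moreover have "(\<integral>\<eta>. of_real (f \<eta>) * (\<integral>\<zeta>. of_real (poisson_kernel (x *\<^sub>R \<eta>) \<zeta>) * 1 \<partial>torus_measure) \<partial>torus_measure) =
    (\<integral>\<eta>. complex_of_real (f \<eta>) \<partial>torus_measure)"
    by (intro Bochner_Integration.integral_cong refl)
      (simp add: poisson_kernel_integral scaleR_torus_in_polydisc x)
  ultimately have "complex_of_real (\<integral>\<zeta>. poisson_average x f \<zeta> \<partial>torus_measure) = of_real (\<integral>\<zeta>. f \<zeta> \<partial>torus_measure)"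
    unfolding poisson_average_def by (simp flip: of_real_mult)
  then show ?thesis by simp
qed

text \<open>Garsia's proof of the maximal ergodic theorem. On the set where the maximal partial sum \<open>M\<close>
  is positive, \<open>M \<le> g 0 - l + P M\<close> with \<open>P\<close> the Poisson average, and elsewhere \<open>M = 0 \<le> P M\<close>;
  since \<open>P\<close> preserves integrals, the integral of \<open>g 0 - l\<close> over that set is nonnegative.\<close>

lemma maximal_ergodic:
  fixes g :: "nat \<Rightarrow> complex ^ 'n \<Rightarrow> real" and l :: real and N :: nat
  assumes cont: "\<And>k. continuous_on torus (g k)"
    and sub: "\<And>k \<zeta>. \<zeta> \<in> torus \<Longrightarrow> g (Suc k) \<zeta> \<le> poisson_average x (g k) \<zeta>"
    and g0: "\<And>\<zeta>. \<zeta> \<in> torus \<Longrightarrow> 0 \<le> g 0 \<zeta>"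
  defines "E \<equiv> {\<zeta> \<in> torus. \<exists>n\<le>N. real (Suc n) * l < (\<Sum>k\<le>n. g k \<zeta>)}"
  shows "E \<in> sets torus_measure" "l * measure torus_measure E \<le> (\<integral>\<zeta>. g 0 \<zeta> \<partial>torus_measure)"
proof -
  define S where "S n \<zeta> = (\<Sum>k<n. (g k \<zeta> - l))" for n \<zeta>
  define M where "M K \<zeta> = Max ((\<lambda>n. S n \<zeta>) ` {..K})" for K :: nat and \<zeta>
  have S_cont: "continuous_on torus (S n)" for n
    unfolding S_def by (intro continuous_on_sum continuous_on_diff cont continuous_on_const)
  have M_cont: "continuous_on torus (M K)" for K
  proof (induction K)
    case (Suc K)
    have "M (Suc K) = (\<lambda>\<zeta>. max (S (Suc K) \<zeta>) (M K \<zeta>))"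
      unfolding M_def atMost_Suc image_insert by (intro ext Max_insert) auto
    then show ?case using continuous_on_max[OF S_cont Suc.IH] by simp
  qed (simp add: M_def S_cont)
  have S_le: "S n \<zeta> \<le> M (Suc N) \<zeta>" if "n \<le> Suc N" for n \<zeta>
    unfolding M_def using that by (intro Max_ge) auto
  have M_ex: "\<exists>n\<le>Suc N. M (Suc N) \<zeta> = S n \<zeta>" for \<zeta>
  proof -
    have "M (Suc N) \<zeta> \<in> (\<lambda>n. S n \<zeta>) ` {..Suc N}" unfolding M_def by (rule Max_in) auto
    then show ?thesis by blast
  qed
  have S_Suc: "S (Suc n) \<zeta> = (\<Sum>k\<le>n. g k \<zeta>) - real (Suc n) * l" for n \<zeta>
    unfolding S_def by (simp add: sum_subtractf lessThan_Suc_atMost)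
  \<comment> \<open>The empty sum \<open>S 0\<close> takes part in the maximum. So \<open>M\<close>
    is nonnegative, and where it is positive it is attained by a nonempty sum.\<close>
  have M0: "0 \<le> M (Suc N) \<zeta>" for \<zeta>
    using S_le[of 0 \<zeta>] by (simp add: S_def)
  have E_eq: "E = {\<zeta> \<in> torus. 0 < M (Suc N) \<zeta>}"
  proof -
    have "(\<exists>n\<le>N. real (Suc n) * l < (\<Sum>k\<le>n. g k \<zeta>)) \<longleftrightarrow> 0 < M (Suc N) \<zeta>" for \<zeta>
    proof
      assume "\<exists>n\<le>N. real (Suc n) * l < (\<Sum>k\<le>n. g k \<zeta>)"
      then obtain n where n: "n \<le> N" "0 < S (Suc n) \<zeta>" using S_Suc[of _ \<zeta>] by auto
      then show "0 < M (Suc N) \<zeta>" using S_le[of "Suc n" \<zeta>] by simp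
    next
      assume M: "0 < M (Suc N) \<zeta>"
      obtain n where n: "n \<le> Suc N" "M (Suc N) \<zeta> = S n \<zeta>" using M_ex by blast
      with M obtain p where p: "n = Suc p" by (cases n) (auto simp: S_def)
      then have "p \<le> N" "real (Suc p) * l < (\<Sum>k\<le>p. g k \<zeta>)" using n M S_Suc[of p \<zeta>] by auto
      then show "\<exists>n\<le>N. real (Suc n) * l < (\<Sum>k\<le>n. g k \<zeta>)" by blast
    qed
    then show ?thesis by (simp add: E_def)
  qed
  have "M (Suc N) \<in> borel_measurable torus_measure"
    using continuous_on_torus_measurable[OF M_cont] by simp
  then have "{\<zeta> \<in> space torus_measure. 0 < M (Suc N) \<zeta>} \<in> sets torus_measure"
    unfolding borel_measurable_iff_greater by blast
  then show E_sets: "E \<in> sets torus_measure" by (simp add: E_eq)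
  have key: "M (Suc N) \<zeta> \<le> poisson_average x (M (Suc N)) \<zeta> + indicator E \<zeta> * (g 0 \<zeta> - l)"
    if \<zeta>: "\<zeta> \<in> torus" for \<zeta>
  proof (cases "0 < M (Suc N) \<zeta>")
    case True
    obtain n where n: "n \<le> Suc N" "M (Suc N) \<zeta> = S n \<zeta>" using M_ex by blast
    with True obtain p where p: "n = Suc p" by (cases n) (auto simp: S_def)
    \<comment> \<open>Splitting off the first term leaves \<open>p\<close> terms with shifted index,
      which \<open>sub\<close> bounds by the average of \<open>S p\<close>. Having one term fewer
      than \<open>S (Suc p)\<close>, the sum \<open>S p\<close> is still among those below
      \<open>M (Suc N)\<close>.\<close>
    have "S (Suc p) \<zeta> = (g 0 \<zeta> - l) + (\<Sum>k<p. (g (Suc k) \<zeta> - l))"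
      unfolding S_def by (rule sum.lessThan_Suc_shift)
    also have "(\<Sum>k<p. (g (Suc k) \<zeta> - l)) \<le> (\<Sum>k<p. (poisson_average x (g k) \<zeta> - l))"
      using sub[OF \<zeta>] by (intro sum_mono) simp
    also have "\<dots> = poisson_average x (S p) \<zeta>"
      unfolding S_def by (rule poisson_average_sum_shift[OF cont \<zeta>, symmetric])
    also have "\<dots> \<le> poisson_average x (M (Suc N)) \<zeta>"
      using n p by (intro poisson_average_mono S_cont M_cont \<zeta> S_le) simp
    finally show ?thesis using n p True \<zeta> by (simp add: E_eq)
  next
    case False
    then have "M (Suc N) \<zeta> = poisson_average x (\<lambda>_. 0) \<zeta>"
      using M0[of \<zeta>] poisson_average_const[OF \<zeta>] by simp
    also have "\<dots> \<le> poisson_average x (M (Suc N)) \<zeta>"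
      by (intro poisson_average_mono M_cont \<zeta> M0 continuous_on_const)
    finally show ?thesis using False by (simp add: E_eq)
  qed
  have int_g: "integrable torus_measure (\<lambda>\<zeta>. indicator E \<zeta> * g 0 \<zeta>)"
    using integrable_mult_indicator[OF E_sets continuous_on_torus_integrable[OF cont[of 0]]] by simp
  have int_l: "integrable torus_measure (\<lambda>\<zeta>. indicator E \<zeta> * l)"
    using integrable_mult_indicator[OF E_sets continuous_on_torus_integrable[OF continuous_on_const[of _ l]]] by simp
  have "(\<integral>\<zeta>. M (Suc N) \<zeta> \<partial>torus_measure) \<le>
      (\<integral>\<zeta>. poisson_average x (M (Suc N)) \<zeta> + (indicator E \<zeta> * g 0 \<zeta> - indicator E \<zeta> * l) \<partial>torus_measure)"
  proof (rule integral_mono[OF continuous_on_torus_integrable[OF M_cont]])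
    show "integrable torus_measure (\<lambda>\<zeta>. poisson_average x (M (Suc N)) \<zeta> + (indicator E \<zeta> * g 0 \<zeta> - indicator E \<zeta> * l))"
      by (intro Bochner_Integration.integrable_add Bochner_Integration.integrable_diff int_g int_l
          poisson_average_integrable_outer M_cont)
  qed (use key in \<open>auto simp: right_diff_distrib\<close>)
  also have "\<dots> = (\<integral>\<zeta>. M (Suc N) \<zeta> \<partial>torus_measure) +
      ((\<integral>\<zeta>. indicator E \<zeta> * g 0 \<zeta> \<partial>torus_measure) - (\<integral>\<zeta>. indicator E \<zeta> * l \<partial>torus_measure))"
    using poisson_average_integrable_outer[OF M_cont[of "Suc N"]] int_g int_l
    by (simp add: integral_poisson_average[OF M_cont])
  also have "(\<integral>\<zeta>. indicator E \<zeta> * l \<partial>torus_measure) = l * measure torus_measure E"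
  proof -
    have "E \<inter> torus = E" by (auto simp: E_def)
    then show ?thesis by (simp add: mult.commute)
  qed
  \<comment> \<open>Passing from \<open>E\<close> to the whole torus uses that \<open>g 0\<close> is
    nonnegative.\<close>
  also have "(\<integral>\<zeta>. indicator E \<zeta> * g 0 \<zeta> \<partial>torus_measure) \<le> (\<integral>\<zeta>. g 0 \<zeta> \<partial>torus_measure)"
    using g0 by (intro integral_mono int_g continuous_on_torus_integrable cont) (auto split: split_indicator)
  finally show "l * measure torus_measure E \<le> (\<integral>\<zeta>. g 0 \<zeta> \<partial>torus_measure)" by simp
qed

end

section \<open>The discrete square function\<close>

lemma mult_eq_sum_plus_increments:
  fixes h :: "nat \<Rightarrow> complex"
  shows "of_nat (Suc n) * h n = (\<Sum>k\<le>n. h k) + (\<Sum>k<n. of_nat (Suc k) * (h (Suc k) - h k))"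
proof (induction n)
  case (Suc n)
  have "of_nat (Suc (Suc n)) * h (Suc n) =
      of_nat (Suc n) * h n + h (Suc n) + of_nat (Suc n) * (h (Suc n) - h n)"
    by (simp add: algebra_simps)
  then show ?case unfolding Suc.IH by simp
qed simp

text \<open>Abel summation writes \<open>h n\<close> as an average plus weighted increments.
  Cauchy-Schwarz with each weight \<open>Suc k\<close> split into two square roots bounds the
  increments by the discrete Littlewood-Paley function, because the weights sum to at most the
  square of \<open>Suc n\<close>.\<close>

lemma norm_le_average_plus_square_function:
  fixes h :: "nat \<Rightarrow> complex"
  shows "norm (h n) \<le> (\<Sum>k\<le>n. norm (h k)) / real (Suc n) +
    sqrt (\<Sum>k<n. real (Suc k) * (norm (h (Suc k) - h k))\<^sup>2)"
proof -
  let ?d = "\<lambda>k. norm (h (Suc k) - h k)" and ?Q = "\<Sum>k<n. real (Suc k) * (norm (h (Suc k) - h k))\<^sup>2"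
  have Q0: "0 \<le> ?Q" by (intro sum_nonneg) auto
  have "(\<Sum>k<n. real (Suc k) * ?d k) = (\<Sum>k<n. sqrt (real (Suc k)) * (sqrt (real (Suc k)) * ?d k))"
    by (simp add: mult.assoc[symmetric])
  also have "\<dots>\<^sup>2 \<le> (\<Sum>k<n. (sqrt (real (Suc k)))\<^sup>2) * (\<Sum>k<n. (sqrt (real (Suc k)) * ?d k)\<^sup>2)"
    by (rule Cauchy_Schwarz_ineq_sum)
  also have "\<dots> = (\<Sum>k<n. real (Suc k)) * ?Q"
    by (simp add: power_mult_distrib)
  also have "\<dots> \<le> (real (Suc n))\<^sup>2 * ?Q"
  proof (intro mult_right_mono Q0)
    have "(\<Sum>k<n. real (Suc k)) \<le> (\<Sum>k<n. real (Suc n))" by (intro sum_mono) auto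
    then have "(\<Sum>k<n. real (Suc k)) \<le> real n * real (Suc n)" by simp
    also have "\<dots> \<le> (real (Suc n))\<^sup>2"
      unfolding power2_eq_square by (intro mult_right_mono) auto
    finally show "(\<Sum>k<n. real (Suc k)) \<le> (real (Suc n))\<^sup>2" .
  qed
  finally have "(\<Sum>k<n. real (Suc k) * ?d k)\<^sup>2 \<le> (real (Suc n) * sqrt ?Q)\<^sup>2"
    using Q0 by (simp add: power_mult_distrib)
  then have var: "(\<Sum>k<n. real (Suc k) * ?d k) \<le> real (Suc n) * sqrt ?Q"
    by (rule power2_le_imp_le) (use Q0 in simp)
  have "real (Suc n) * norm (h n) = norm (of_nat (Suc n) * h n)"
    unfolding norm_mult norm_of_nat ..
  also have "\<dots> \<le> norm (\<Sum>k\<le>n. h k) + norm (\<Sum>k<n. of_nat (Suc k) * (h (Suc k) - h k))"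
    unfolding mult_eq_sum_plus_increments by (rule norm_triangle_ineq)
  also have "norm (\<Sum>k\<le>n. h k) \<le> (\<Sum>k\<le>n. norm (h k))" by (rule norm_sum)
  also have "norm (\<Sum>k<n. of_nat (Suc k) * (h (Suc k) - h k)) \<le> (\<Sum>k<n. norm (of_nat (Suc k) * (h (Suc k) - h k)))"
    by (rule norm_sum)
  also have "\<dots> = (\<Sum>k<n. real (Suc k) * ?d k)"
    by (simp only: norm_mult norm_of_nat)
  also note var
  finally have "real (Suc n) * norm (h n) \<le> (\<Sum>k\<le>n. norm (h k)) + real (Suc n) * sqrt ?Q" by simp
  then show ?thesis by (simp add: field_simps del: of_nat_Suc)
qed

text \<open>Discrete counterpart of integrating t b''(t) by parts for a nonnegative decreasing
  convex b. Sampling the second differences only at odd centres matches the geometric means of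
  neighbouring even radii.\<close>

lemma weighted_second_differences_le:
  fixes b :: "nat \<Rightarrow> real"
  assumes convex: "\<And>m. 2 * b (Suc m) \<le> b (Suc (Suc m)) + b m"
    and dec: "\<And>m. b (Suc m) \<le> b m" and nonneg: "\<And>m. 0 \<le> b m"
  shows "(\<Sum>k<N. real (Suc k) * (b (2 * k) + b (2 * k + 2) - 2 * b (2 * k + 1))) \<le> b 0"
proof -
  \<comment> \<open>The induction keeps the boundary terms of the summation by parts. Convexity
    centred at \<open>2 * N + 2\<close> replaces the last difference by the next one, and
    monotonicity absorbs the extra unit of weight.\<close>
  have "(\<Sum>k<N. real (Suc k) * (b (2 * k) + b (2 * k + 2) - 2 * b (2 * k + 1))) \<le>
      b 0 - b (2 * N) - real N * (b (2 * N) - b (2 * N + 1))"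
  proof (induction N)
    case (Suc N)
    let ?b = "\<lambda>i. b (2 * N + i)"
    have c: "2 * ?b 2 \<le> ?b 3 + ?b 1" using convex[of "2 * N + 1"] by (simp add: eval_nat_numeral)
    have d: "?b 2 \<le> ?b 1" using dec[of "2 * N + 1"] by simp
    have "real (Suc N) * (2 * ?b 2 - ?b 3 - ?b 1) \<le> 0"
      by (rule mult_nonneg_nonpos) (use c in auto)
    then have "real (Suc N) * (?b 0 + ?b 2 - 2 * ?b 1) \<le>
        ?b 0 - ?b 2 + real N * (?b 0 - ?b 1) - real (Suc N) * (?b 2 - ?b 3)"
      using d by (simp add: algebra_simps)
    with Suc.IH show ?case by (simp add: eval_nat_numeral algebra_simps)
  qed simp
  moreover have "0 \<le> real N * (b (2 * N) - b (2 * N + 1))" using dec[of "2 * N"] by simp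
  ultimately show ?thesis using nonneg[of "2 * N"] by linarith
qed

text \<open>The triangle inequality under the Poisson integral, that is, subharmonicity of the
  modulus. It gives an inequality instead of an equality, which is why
  \<open>maximal_ergodic\<close> lets \<open>g (Suc k)\<close> lie below the average of
  \<open>g k\<close>.\<close>

lemma dilation_norm_subaverage:
  assumes f: "holomorphic_sv f polydisc" and r: "0 \<le> r" "r < 1" and x: "0 \<le> x" "x < 1"
    and \<zeta>: "\<zeta> \<in> torus"
  shows "norm (f ((r * x) *\<^sub>R \<zeta>)) \<le> poisson_average x (\<lambda>\<zeta>. norm (f (r *\<^sub>R \<zeta>))) \<zeta>"
proof -
  have "norm (f ((r * x) *\<^sub>R \<zeta>)) = norm (\<integral>\<eta>. of_real (poisson_kernel (x *\<^sub>R \<zeta>) \<eta>) * f (r *\<^sub>R \<eta>) \<partial>torus_measure)"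
    by (simp add: dilation_poisson[OF f r x \<zeta>])
  also have "\<dots> \<le> (\<integral>\<eta>. norm (of_real (poisson_kernel (x *\<^sub>R \<zeta>) \<eta>) * f (r *\<^sub>R \<eta>)) \<partial>torus_measure)"
    by (rule integral_norm_bound)
  also have "\<dots> = poisson_average x (\<lambda>\<zeta>. norm (f (r *\<^sub>R \<zeta>))) \<zeta>"
    unfolding poisson_average_def
    using poisson_kernel_nonneg[OF scaleR_torus_in_polydisc[OF \<zeta> x]] by (simp add: norm_mult)
  finally show ?thesis .
qed

text \<open>The bound is uniform in \<open>N\<close>, \<open>\<rho>\<close> and \<open>x\<close>, so
  the grid of radii can be refined later. Half of the threshold \<open>2 * l\<close> goes to the
  averages, giving \<open>sqrt A / l\<close> by the maximal ergodic theorem; the other half goes to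
  the square function, giving \<open>A / l\<^sup>2\<close> by Chebyshev.\<close>

lemma dilation_maximal_discrete:
  fixes f :: "complex ^ 'n \<Rightarrow> complex" and l :: real and N :: nat
  assumes f: "holomorphic_sv f polydisc" and A: "\<And>r. 0 < r \<Longrightarrow> r < 1 \<Longrightarrow> mean_square f r \<le> A"
    and \<rho>: "0 < \<rho>" "\<rho> < 1" and x: "0 < x" "x < 1" and l: "0 < l"
  defines "E \<equiv> {\<zeta> \<in> torus. \<exists>n\<le>N. 2 * l < norm (f ((\<rho> * x ^ (2 * n)) *\<^sub>R \<zeta>))}"
  shows "E \<in> sets torus_measure" "measure torus_measure E \<le> sqrt A / l + A / l\<^sup>2"
proof -
  \<comment> \<open>Even powers of \<open>x\<close> are sampled so that the odd power between two
    samples is their geometric mean, as \<open>dilation_diff_norm\<close> requires.\<close>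
  define h where "h k \<zeta> = f ((\<rho> * x ^ (2 * k)) *\<^sub>R \<zeta>)" for k \<zeta>
  define b where "b m = mean_square f (\<rho> * x ^ m)" for m
  have \<rho>x: "0 < \<rho> * x ^ m" "\<rho> * x ^ m < 1" for m
    using \<rho> x mult_less_one_real[of \<rho> "x ^ m"] power_le_one[of x m] by auto
  have x2: "0 \<le> x\<^sup>2" "x\<^sup>2 < 1" using x by (auto simp: power_less_one_iff abs_square_less_1)
  have h_Suc: "h (Suc k) \<zeta> = f ((\<rho> * x ^ (2 * k) * x\<^sup>2) *\<^sub>R \<zeta>)" for k \<zeta>
    by (simp add: h_def power2_eq_square mult_ac)
  have h_cont: "continuous_on torus (h k)" for k
    unfolding h_def by (rule dilation_continuous_torus[OF f less_imp_le[OF \<rho>x(1)] \<rho>x(2)])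
  have h_L2: "h k \<in> L2 torus_measure" for k
    unfolding h_def by (rule dilation_L2[OF f less_imp_le[OF \<rho>x(1)] \<rho>x(2)])
  define E1 where "E1 = {\<zeta> \<in> torus. \<exists>n\<le>N. real (Suc n) * l < (\<Sum>k\<le>n. norm (h k \<zeta>))}"
  have E1: "E1 \<in> sets torus_measure" "l * measure torus_measure E1 \<le> (\<integral>\<zeta>. norm (h 0 \<zeta>) \<partial>torus_measure)"
  proof -
    have sub: "norm (h (Suc k) \<zeta>) \<le> poisson_average (x\<^sup>2) (\<lambda>\<zeta>. norm (h k \<zeta>)) \<zeta>" if "\<zeta> \<in> torus" for k \<zeta>
      unfolding h_Suc unfolding h_def
      by (rule dilation_norm_subaverage[OF f less_imp_le[OF \<rho>x(1)] \<rho>x(2) x2 that])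
    show "E1 \<in> sets torus_measure" "l * measure torus_measure E1 \<le> (\<integral>\<zeta>. norm (h 0 \<zeta>) \<partial>torus_measure)"
      unfolding E1_def
      using maximal_ergodic[where g = "\<lambda>k \<zeta>. norm (h k \<zeta>)" and l = l and N = N,
          OF x2 continuous_on_norm[OF h_cont] sub norm_ge_zero] by blast+
  qed
  \<comment> \<open>The torus has total mass 1, so the L1 norm is at most the L2 norm.\<close>
  have "(\<integral>\<zeta>. norm (h 0 \<zeta>) \<partial>torus_measure) \<le> L2_norm torus_measure (h 0)"
    using torus.L1_le_L2_norm[OF h_L2[of 0]] by simp
  also have "\<dots> = sqrt (b 0)" by (simp add: b_def h_def[abs_def] mean_square_def)
  also have "\<dots> \<le> sqrt A" using A \<rho> by (simp add: b_def)
  finally have mE1: "measure torus_measure E1 \<le> sqrt A / l"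
    using E1(2) l by (simp add: pos_le_divide_eq mult.commute)
  define Q where "Q \<zeta> = (\<Sum>k<N. real (Suc k) * (norm (h (Suc k) \<zeta> - h k \<zeta>))\<^sup>2)" for \<zeta>
  have Q_cont: "continuous_on torus Q"
    unfolding Q_def by (intro continuous_intros h_cont)
  have d_L2: "(\<lambda>\<zeta>. h (Suc k) \<zeta> - h k \<zeta>) \<in> L2 torus_measure" for k
    by (intro L2_diff h_L2)
  have step: "(\<integral>\<zeta>. (norm (h (Suc k) \<zeta> - h k \<zeta>))\<^sup>2 \<partial>torus_measure) = b (2 * k) + b (2 * k + 2) - 2 * b (2 * k + 1)" for k
  proof -
    have "(\<integral>\<zeta>. (norm (h (Suc k) \<zeta> - h k \<zeta>))\<^sup>2 \<partial>torus_measure) =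
        (L2_norm torus_measure (\<lambda>\<zeta>. h k \<zeta> - h (Suc k) \<zeta>))\<^sup>2"
      by (simp add: L2_norm_square norm_minus_commute)
    then show ?thesis
      unfolding h_Suc unfolding h_def dilation_diff_norm[OF f less_imp_le[OF \<rho>x(1)] \<rho>x(2) less_imp_le[OF x(1)] x(2)]
      by (simp add: b_def power_add power2_eq_square mult_ac)
  qed
  have "(\<integral>\<zeta>. Q \<zeta> \<partial>torus_measure) = (\<Sum>k<N. real (Suc k) * (b (2 * k) + b (2 * k + 2) - 2 * b (2 * k + 1)))"
    unfolding Q_def step[symmetric]
    by (simp only: Bochner_Integration.integral_sum integrable_mult_right L2_integrable_square[OF d_L2] integral_mult_right_zero)
  also have "\<dots> \<le> b 0"
  proof (rule weighted_second_differences_le)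
    fix m
    show "0 \<le> b m" by (simp add: b_def)
    show "b (Suc m) \<le> b m"
      unfolding b_def by (rule mean_square_mono[OF f A])
        (use \<rho>x \<rho> x in \<open>auto intro!: mult_left_mono simp: mult_left_le_one_le\<close>)
    have "0 \<le> mean_square f (\<rho> * x ^ m) + mean_square f (\<rho> * x ^ m * x\<^sup>2) - 2 * mean_square f (\<rho> * x ^ m * x)"
      unfolding dilation_diff_norm[OF f less_imp_le[OF \<rho>x(1)] \<rho>x(2) less_imp_le[OF x(1)] x(2), symmetric]
      by simp
    then show "2 * b (Suc m) \<le> b (Suc (Suc m)) + b m"
      by (simp add: b_def power2_eq_square mult_ac)
  qed
  also have "b 0 \<le> A" using A \<rho> by (simp add: b_def)
  finally have Q_int: "(\<integral>\<zeta>. Q \<zeta> \<partial>torus_measure) \<le> A" .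
  define E2 where "E2 = {\<zeta> \<in> torus. l\<^sup>2 < Q \<zeta>}"
  have "Q \<in> borel_measurable torus_measure"
    using continuous_on_torus_measurable[OF Q_cont] by simp
  then have "{\<zeta> \<in> space torus_measure. l\<^sup>2 < Q \<zeta>} \<in> sets torus_measure"
    unfolding borel_measurable_iff_greater by blast
  then have E2: "E2 \<in> sets torus_measure" by (simp add: E2_def)
  have "(\<integral>\<zeta>. indicator E2 \<zeta> * l\<^sup>2 \<partial>torus_measure) \<le> (\<integral>\<zeta>. Q \<zeta> \<partial>torus_measure)"
  proof (rule integral_mono)
    show "integrable torus_measure (\<lambda>\<zeta>. indicator E2 \<zeta> * l\<^sup>2)"
      using integrable_mult_indicator[OF E2 continuous_on_torus_integrable[OF continuous_on_const[of _ "l\<^sup>2"]]] by simp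
    show "integrable torus_measure Q" by (rule continuous_on_torus_integrable[OF Q_cont])
    fix \<zeta>
    have "0 \<le> Q \<zeta>" unfolding Q_def by (intro sum_nonneg) auto
    then show "indicator E2 \<zeta> * l\<^sup>2 \<le> Q \<zeta>" by (auto simp: E2_def split: split_indicator)
  qed
  moreover have "E2 \<inter> torus = E2" by (auto simp: E2_def)
  ultimately have mE2: "measure torus_measure E2 \<le> A / l\<^sup>2"
    using Q_int l by (simp add: pos_le_divide_eq)
  have sub: "E \<subseteq> E1 \<union> E2"
  proof
    fix \<zeta> assume "\<zeta> \<in> E"
    then obtain n where \<zeta>: "\<zeta> \<in> torus" and n: "n \<le> N" "2 * l < norm (h n \<zeta>)"
      by (auto simp: E_def h_def)
    let ?a = "(\<Sum>k\<le>n. norm (h k \<zeta>)) / real (Suc n)"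
    let ?q = "\<Sum>k<n. real (Suc k) * (norm (h (Suc k) \<zeta> - h k \<zeta>))\<^sup>2"
    have "2 * l < ?a + sqrt ?q"
      using norm_le_average_plus_square_function[of "\<lambda>k. h k \<zeta>" n] n(2) by linarith
    then consider "l < ?a" | "l < sqrt ?q" by linarith
    then show "\<zeta> \<in> E1 \<union> E2"
    proof cases
      case 1
      then have "real (Suc n) * l < (\<Sum>k\<le>n. norm (h k \<zeta>))"
        by (simp add: field_simps del: of_nat_Suc)
      then show ?thesis using \<zeta> n by (auto simp: E1_def)
    next
      case 2
      have "0 \<le> ?q" by (intro sum_nonneg) auto
      with 2 l have "l\<^sup>2 < ?q" using power_strict_mono[of l "sqrt ?q" 2] by simp
      also have "?q \<le> Q \<zeta>" unfolding Q_def using n by (intro sum_mono2) auto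
      finally show ?thesis using \<zeta> by (auto simp: E2_def)
    qed
  qed
  have "E = (\<Union>n\<in>{..N}. {\<zeta> \<in> space torus_measure. 2 * l < norm (h n \<zeta>)})"
    by (auto simp: E_def h_def)
  moreover have "{\<zeta> \<in> space torus_measure. 2 * l < norm (h n \<zeta>)} \<in> sets torus_measure" for n
  proof -
    have "(\<lambda>\<zeta>. norm (h n \<zeta>)) \<in> borel_measurable torus_measure"
      using continuous_on_torus_measurable[OF continuous_on_norm[OF h_cont[of n]]] by simp
    then show ?thesis unfolding borel_measurable_iff_greater by blast
  qed
  ultimately show "E \<in> sets torus_measure" by (auto intro!: sets.finite_UN)
  have "measure torus_measure E \<le> measure torus_measure (E1 \<union> E2)"
    using sub E1(1) E2 by (intro torus.finite_measure_mono) auto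
  also have "\<dots> \<le> measure torus_measure E1 + measure torus_measure E2"
    using E1(1) E2 by (rule measure_Un_le)
  finally show "measure torus_measure E \<le> sqrt A / l + A / l\<^sup>2" using mE1 mE2 by linarith
qed

section \<open>Radial limits\<close>

lemma holomorphic_sv_isCont: "holomorphic_sv f S \<Longrightarrow> z \<in> S \<Longrightarrow> isCont f z"
  unfolding holomorphic_sv_def by (auto intro: has_derivative_continuous)

lemma isCont_radial:
  assumes "holomorphic_sv f polydisc" "\<zeta> \<in> torus" "0 \<le> r" "r < 1"
  shows "isCont (\<lambda>r. f (r *\<^sub>R \<zeta>)) r"
proof (rule isCont_o2[where f = "\<lambda>r. r *\<^sub>R \<zeta>" and g = f])
  show "isCont (\<lambda>r. r *\<^sub>R \<zeta>) r" by (intro continuous_intros)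
  show "isCont f (r *\<^sub>R \<zeta>)"
    by (rule holomorphic_sv_isCont[OF assms(1) scaleR_torus_in_polydisc[OF assms(2-4)]])
qed

text \<open>Exceeding \<open>2 * l\<close> is an open condition on the radius, so it is detected by
  fine enough grids. The discrete bound is uniform, and the measure is continuous along the
  increasing sets \<open>F i\<close>.\<close>

lemma dilation_maximal:
  fixes f :: "complex ^ 'n \<Rightarrow> complex" and l :: real
  assumes f: "holomorphic_sv f polydisc" and A: "\<And>r. 0 < r \<Longrightarrow> r < 1 \<Longrightarrow> mean_square f r \<le> A"
    and l: "0 < l"
  defines "E \<equiv> {\<zeta> \<in> torus. \<exists>r. 0 < r \<and> r < 1 \<and> 2 * l < norm (f (r *\<^sub>R \<zeta>))}"
  shows "E \<in> sets torus_measure" "measure torus_measure E \<le> sqrt A / l + A / l\<^sup>2"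
proof -
  \<comment> \<open>Radii are \<open>exp (- t)\<close> with \<open>t\<close> in steps of
    \<open>1 / 2 ^ i\<close> up to about \<open>2 ^ i\<close>, so the grid becomes both finer and
    longer. \<open>Suc n\<close> keeps \<open>t\<close> positive and the radius below 1.\<close>
  define F where "F i = {\<zeta> \<in> torus. \<exists>n\<le>4 ^ i. 2 * l < norm (f (exp (- (real (Suc n) / 2 ^ i)) *\<^sub>R \<zeta>))}" for i :: nat
  have F: "F i \<in> sets torus_measure" "measure torus_measure (F i) \<le> sqrt A / l + A / l\<^sup>2" for i
  proof -
    define \<rho> x where "\<rho> = exp (- (1 / 2 ^ i) :: real)" and "x = exp (- (1 / 2 ^ Suc i) :: real)"
    have eq: "exp (- (real (Suc n) / 2 ^ i)) = \<rho> * x ^ (2 * n)" for n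
      unfolding \<rho>_def x_def exp_of_nat_mult[symmetric] exp_add[symmetric]
      by (intro arg_cong[where f=exp]) (simp add: field_simps)
    have pos: "0 < \<rho>" "\<rho> < 1" "0 < x" "x < 1" by (auto simp: \<rho>_def x_def)
    show "F i \<in> sets torus_measure"
      unfolding F_def eq by (rule dilation_maximal_discrete(1)[OF f A pos l])
    show "measure torus_measure (F i) \<le> sqrt A / l + A / l\<^sup>2"
      unfolding F_def eq by (rule dilation_maximal_discrete(2)[OF f A pos l])
  qed
  have inc: "incseq F"
  proof (rule incseq_SucI, rule subsetI)
    fix i \<zeta> assume "\<zeta> \<in> F i"
    then obtain n where \<zeta>: "\<zeta> \<in> torus" "n \<le> 4 ^ i" "2 * l < norm (f (exp (- (real (Suc n) / 2 ^ i)) *\<^sub>R \<zeta>))"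
      by (auto simp: F_def)
    \<comment> \<open>An old grid point has index \<open>2 * n + 1\<close> on the next grid, not
      \<open>2 * n\<close>, because of the offset in \<open>Suc n\<close>.\<close>
    have "real (Suc (2 * n + 1)) / 2 ^ Suc i = real (Suc n) / 2 ^ i" by (simp add: field_simps)
    moreover have "2 * n + 1 \<le> 4 ^ Suc i"
    proof -
      have "(1::nat) \<le> 4 ^ i" by simp
      then show ?thesis using \<zeta>(2) unfolding power_Suc by linarith
    qed
    ultimately show "\<zeta> \<in> F (Suc i)"
      using \<zeta> unfolding F_def by (auto intro!: exI[of _ "2 * n + 1"] simp del: of_nat_Suc)
  qed
  have E_eq: "E = (\<Union>i. F i)"
  proof (intro set_eqI iffI)
    fix \<zeta> assume "\<zeta> \<in> (\<Union>i. F i)"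
    then obtain i n where "\<zeta> \<in> torus" "2 * l < norm (f (exp (- (real (Suc n) / 2 ^ i)) *\<^sub>R \<zeta>))"
      by (auto simp: F_def)
    then show "\<zeta> \<in> E"
      unfolding E_def by (auto intro!: exI[of _ "exp (- (real (Suc n) / 2 ^ i))"])
  next
    fix \<zeta> assume "\<zeta> \<in> E"
    then obtain r where \<zeta>: "\<zeta> \<in> torus" and r: "0 < r" "r < 1" "2 * l < norm (f (r *\<^sub>R \<zeta>))"
      by (auto simp: E_def)
    define t where "t = - ln r"
    have t: "0 < t" "exp (- t) = r" using r by (auto simp: t_def)
    \<comment> \<open>\<open>real (Suc (n i)) / 2 ^ i\<close> is the least grid point at or above
      \<open>t\<close>, hence within one step of \<open>t\<close>.\<close>
    define n where "n i = nat \<lceil>t * 2 ^ i\<rceil> - 1" for i :: nat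
    have n: "t * 2 ^ i \<le> real (Suc (n i))" "real (n i) < t * 2 ^ i" for i
    proof -
      have pos: "0 < t * 2 ^ i" using t by simp
      then have "0 < \<lceil>t * 2 ^ i\<rceil>" by simp
      then have eq: "real (Suc (n i)) = of_int \<lceil>t * 2 ^ i\<rceil>" by (simp add: n_def)
      show "t * 2 ^ i \<le> real (Suc (n i))" unfolding eq by (rule le_of_int_ceiling)
      have "of_int \<lceil>t * 2 ^ i\<rceil> < t * 2 ^ i + 1" by linarith
      then show "real (n i) < t * 2 ^ i" using eq by simp
    qed
    have lim: "(\<lambda>i. real (Suc (n i)) / 2 ^ i) \<longlonglongrightarrow> t"
    proof (rule tendsto_sandwich)
      show "\<forall>\<^sub>F i in sequentially. t \<le> real (Suc (n i)) / 2 ^ i"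
        using n(1) by (auto simp: pos_le_divide_eq)
      show "\<forall>\<^sub>F i in sequentially. real (Suc (n i)) / 2 ^ i \<le> t + (1 / 2) ^ i"
        using n(2) by (intro always_eventually allI) (simp add: field_simps less_imp_le)
      show "(\<lambda>i. t + (1 / 2) ^ i) \<longlonglongrightarrow> t"
        using tendsto_add[OF tendsto_const LIMSEQ_power_zero[of "1/2::real"]] by simp
    qed simp
    have "(\<lambda>i. exp (- (real (Suc (n i)) / 2 ^ i))) \<longlonglongrightarrow> exp (- t)"
      by (intro tendsto_intros lim)
    then have "(\<lambda>i. f (exp (- (real (Suc (n i)) / 2 ^ i)) *\<^sub>R \<zeta>)) \<longlonglongrightarrow> f (r *\<^sub>R \<zeta>)"
      unfolding t(2) using isCont_tendsto_compose[OF isCont_radial[OF f \<zeta> less_imp_le[OF r(1)] r(2)]] by blast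
    then have "(\<lambda>i. norm (f (exp (- (real (Suc (n i)) / 2 ^ i)) *\<^sub>R \<zeta>))) \<longlonglongrightarrow> norm (f (r *\<^sub>R \<zeta>))"
      by (rule tendsto_norm)
    then have "\<forall>\<^sub>F i in sequentially. 2 * l < norm (f (exp (- (real (Suc (n i)) / 2 ^ i)) *\<^sub>R \<zeta>))"
      using r(3) by (rule order_tendstoD)
    \<comment> \<open>The grid is eventually long enough: \<open>t < 2 ^ i\<close> gives
      \<open>n i < 4 ^ i\<close>.\<close>
    moreover have "\<forall>\<^sub>F i in sequentially. t < 2 ^ i"
    proof -
      obtain i0 where i0: "t < 2 ^ i0" using real_arch_pow[of 2 t] by auto
      have "t < 2 ^ i" if "i0 \<le> i" for i
        by (rule less_le_trans[OF i0 power_increasing[OF that]]) simp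
      then show ?thesis by (rule eventually_sequentiallyI)
    qed
    ultimately have "\<forall>\<^sub>F i in sequentially. \<zeta> \<in> F i"
    proof eventually_elim
      case (elim i)
      have "real (n i) < 2 ^ i * 2 ^ i"
        by (rule less_trans[OF n(2) mult_strict_right_mono[OF elim(2)]]) simp
      also have "\<dots> = real (4 ^ i)" by (simp flip: power_mult_distrib)
      finally have "n i < 4 ^ i" by (simp only: of_nat_less_iff)
      then show ?case using \<zeta> elim(1) unfolding F_def by (auto simp del: of_nat_Suc intro!: exI[of _ "n i"])
    qed
    then obtain i where "\<zeta> \<in> F i" by (auto dest: eventually_happens)
    then show "\<zeta> \<in> (\<Union>i. F i)" by blast
  qed
  show "E \<in> sets torus_measure" unfolding E_eq using F(1) by blast
  have "(\<lambda>i. measure torus_measure (F i)) \<longlonglongrightarrow> measure torus_measure (\<Union>i. F i)"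
    by (rule torus.finite_Lim_measure_incseq[OF _ inc]) (use F(1) in blast)
  then show "measure torus_measure E \<le> sqrt A / l + A / l\<^sup>2"
    unfolding E_eq by (rule LIMSEQ_le_const2) (use F(2) in blast)
qed

text \<open>\<open>f\<close> is the sum of its dilate by \<open>\<rho>\<close>, continuous up to the
  torus and so without radial oscillation at the end, and a remainder \<open>F\<close> of tiny mean
  square. By the maximal inequality \<open>F\<close> stays below or at \<open>2 * l\<close> on all
  radii off a small set.\<close>

lemma radial_oscillation:
  fixes f :: "complex ^ 'n \<Rightarrow> complex"
  assumes f: "holomorphic_sv f polydisc" and A: "\<And>r. 0 < r \<Longrightarrow> r < 1 \<Longrightarrow> mean_square f r \<le> A"
    and e: "0 < e" and \<delta>: "0 < \<delta>"
  shows "\<exists>E\<in>sets torus_measure. measure torus_measure E \<le> \<delta> \<and>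
    (\<forall>\<zeta>\<in>torus - E. \<exists>b<1. \<forall>r s. b < r \<longrightarrow> r < 1 \<longrightarrow> b < s \<longrightarrow> s < 1 \<longrightarrow>
      norm (f (r *\<^sub>R \<zeta>) - f (s *\<^sub>R \<zeta>)) < e)"
proof -
  \<comment> \<open>The final estimate spends \<open>3 * l\<close> at each of two radii, and
    \<open>6 * l < e\<close>. With \<open>\<eta>\<close> the square of \<open>l * u\<close>, the
    maximal bound becomes \<open>u + u * u\<close>, which is at most \<open>2 * u\<close> and so at
    most \<open>\<delta>\<close>.\<close>
  define l u where "l = e / 8" and "u = min 1 (\<delta> / 2)"
  have l: "0 < l" and u: "0 < u" "u \<le> 1" "2 * u \<le> \<delta>" using e \<delta> by (auto simp: l_def u_def)
  define \<eta> where "\<eta> = (l * u)\<^sup>2"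
  have \<eta>: "0 < \<eta>" using l u by (simp add: \<eta>_def)
  have small: "sqrt \<eta> / l + \<eta> / l\<^sup>2 \<le> \<delta>"
  proof -
    have "sqrt \<eta> / l + \<eta> / l\<^sup>2 = u + u * u"
      using l u by (simp add: \<eta>_def power_mult_distrib power2_eq_square)
    also have "\<dots> \<le> u + u * 1" using u by (intro add_left_mono mult_left_mono) auto
    finally show ?thesis using u by simp
  qed
  obtain R where R: "0 < R" "R < 1" and close: "\<And>r s. R \<le> r \<Longrightarrow> r < 1 \<Longrightarrow> R \<le> s \<Longrightarrow> s < 1 \<Longrightarrow>
      (L2_norm torus_measure (\<lambda>\<zeta>. f (r *\<^sub>R \<zeta>) - f (s *\<^sub>R \<zeta>)))\<^sup>2 < \<eta>"
    using dilation_L2_Cauchy[OF f A \<eta>] by blast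
  \<comment> \<open>The square root ensures that \<open>\<rho> * r\<close> is at least
    \<open>R\<close> whenever \<open>r\<close> is at least \<open>\<rho>\<close>.\<close>
  define \<rho> where "\<rho> = sqrt R"
  have \<rho>: "0 < \<rho>" "\<rho> < 1" "\<rho> * \<rho> = R" using R by (auto simp: \<rho>_def)
  then have R\<rho>: "R \<le> \<rho>" using mult_left_mono[of \<rho> 1 \<rho>] by simp
  define F where "F z = f z - f (\<rho> *\<^sub>R z)" for z
  have F: "holomorphic_sv F polydisc"
    unfolding F_def
    by (intro holomorphic_sv_diff f holomorphic_sv_dilation[OF f] scaleR_polydisc_in_polydisc)
      (use \<rho> in auto)
  have F_ms: "mean_square F r = (L2_norm torus_measure (\<lambda>\<zeta>. f (r *\<^sub>R \<zeta>) - f ((\<rho> * r) *\<^sub>R \<zeta>)))\<^sup>2" for r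
    by (simp add: mean_square_def F_def)
  have \<rho>r: "0 < \<rho> * r" "\<rho> * r < 1" if "0 < r" "r < 1" for r
    using \<rho> that mult_less_one_real[of \<rho> r] by auto
  \<comment> \<open>A crude bound from the parallelogram law. It makes the means of \<open>F\<close>
    monotone, and monotonicity then extends the bound \<open>\<eta>\<close> from radii beyond
    \<open>\<rho>\<close> to all radii.\<close>
  have F_bd: "mean_square F r \<le> 4 * A" if r: "0 < r" "r < 1" for r
  proof -
    let ?p = "\<lambda>\<zeta>. f (r *\<^sub>R \<zeta>)" and ?q = "\<lambda>\<zeta>. f ((\<rho> * r) *\<^sub>R \<zeta>)"
    have p: "?p \<in> L2 torus_measure" and q: "?q \<in> L2 torus_measure"
      using r \<rho>r[OF r] by (auto intro!: dilation_L2[OF f])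
    have "(L2_norm torus_measure (\<lambda>\<zeta>. ?p \<zeta> - ?q \<zeta>))\<^sup>2 + (L2_norm torus_measure (\<lambda>\<zeta>. ?p \<zeta> + ?q \<zeta>))\<^sup>2
        = 2 * mean_square f r + 2 * mean_square f (\<rho> * r)"
      using L2_norm_lincomb[OF p q, of 1 "-1"] L2_norm_lincomb[OF p q, of 1 1]
      by (simp add: mean_square_def)
    then have "mean_square F r \<le> 2 * mean_square f r + 2 * mean_square f (\<rho> * r)"
      unfolding F_ms using zero_le_power2[of "L2_norm torus_measure (\<lambda>\<zeta>. ?p \<zeta> + ?q \<zeta>)"] by linarith
    then show ?thesis using A[OF r] A[OF \<rho>r[OF r]] by linarith
  qed
  have F_small: "mean_square F r \<le> \<eta>" if r: "0 < r" "r < 1" for r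
  proof -
    let ?s = "max r \<rho>"
    have s: "?s < 1" "\<rho> \<le> ?s" "0 < ?s" using r \<rho> by auto
    have "R \<le> \<rho> * ?s" unfolding \<rho>(3)[symmetric] using \<rho> s by (intro mult_left_mono) auto
    then have "mean_square F ?s < \<eta>"
      unfolding F_ms using R\<rho> s \<rho>r[OF s(3,1)] by (intro close) auto
    moreover have "mean_square F r \<le> mean_square F ?s"
      using r s by (intro mean_square_mono[OF F F_bd]) auto
    ultimately show ?thesis by simp
  qed
  define E where "E = {\<zeta> \<in> torus. \<exists>r. 0 < r \<and> r < 1 \<and> 2 * l < norm (F (r *\<^sub>R \<zeta>))}"
  have E: "E \<in> sets torus_measure" "measure torus_measure E \<le> sqrt \<eta> / l + \<eta> / l\<^sup>2"
    using dilation_maximal[OF F F_small l] by (simp_all only: E_def)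
  moreover have "\<exists>b<1. \<forall>r s. b < r \<longrightarrow> r < 1 \<longrightarrow> b < s \<longrightarrow> s < 1 \<longrightarrow>
      norm (f (r *\<^sub>R \<zeta>) - f (s *\<^sub>R \<zeta>)) < e" if \<zeta>: "\<zeta> \<in> torus - E" for \<zeta>
  proof -
    \<comment> \<open>Radius 1 for the dilate is the interior radius \<open>\<rho>\<close> for
      \<open>f\<close>, where \<open>f\<close> is continuous.\<close>
    have "isCont (\<lambda>r. f (r *\<^sub>R \<zeta>)) (\<rho> * 1)"
      using isCont_radial[OF f _ less_imp_le[OF \<rho>(1)] \<rho>(2)] \<zeta> by simp
    moreover have "((\<lambda>r. \<rho> * r) \<longlongrightarrow> \<rho> * 1) (at_left 1)" by (intro tendsto_intros)
    ultimately have "((\<lambda>r. f ((\<rho> * r) *\<^sub>R \<zeta>)) \<longlongrightarrow> f ((\<rho> * 1) *\<^sub>R \<zeta>)) (at_left 1)"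
      by (rule isCont_tendsto_compose)
    then have "\<forall>\<^sub>F r in at_left 1. dist (f ((\<rho> * r) *\<^sub>R \<zeta>)) (f ((\<rho> * 1) *\<^sub>R \<zeta>)) < l"
      using l by (rule tendstoD)
    then obtain b where b: "b < 1"
      and fb: "\<And>r. b < r \<Longrightarrow> r < 1 \<Longrightarrow> norm (f ((\<rho> * r) *\<^sub>R \<zeta>) - f ((\<rho> * 1) *\<^sub>R \<zeta>)) < l"
      unfolding eventually_at_left_field dist_norm by blast
    have "norm (f (r *\<^sub>R \<zeta>) - f (s *\<^sub>R \<zeta>)) < e"
      if rs: "max b 0 < r" "r < 1" "max b 0 < s" "s < 1" for r s
    proof -
      have dr: "norm (f (r *\<^sub>R \<zeta>) - f ((\<rho> * 1) *\<^sub>R \<zeta>)) < 3 * l" if "max b 0 < r" "r < 1" for r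
      proof -
        have "norm (F (r *\<^sub>R \<zeta>)) \<le> 2 * l" using \<zeta> that unfolding E_def by fastforce
        then have "norm (f (r *\<^sub>R \<zeta>) - f ((\<rho> * r) *\<^sub>R \<zeta>)) \<le> 2 * l" by (simp add: F_def)
        moreover have "norm (f ((\<rho> * r) *\<^sub>R \<zeta>) - f ((\<rho> * 1) *\<^sub>R \<zeta>)) < l" using that by (intro fb) auto
        ultimately show ?thesis
          using norm_triangle_ineq[of "f (r *\<^sub>R \<zeta>) - f ((\<rho> * r) *\<^sub>R \<zeta>)" "f ((\<rho> * r) *\<^sub>R \<zeta>) - f ((\<rho> * 1) *\<^sub>R \<zeta>)"]
          by simp
      qed
      show ?thesis
        using dr[of r] dr[of s] rs l_def e norm_triangle_ineq4[of "f (r *\<^sub>R \<zeta>) - f ((\<rho> * 1) *\<^sub>R \<zeta>)" "f (s *\<^sub>R \<zeta>) - f ((\<rho> * 1) *\<^sub>R \<zeta>)"]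
        by simp
    qed
    moreover have "max b 0 < 1" using b by simp
    ultimately show ?thesis by blast
  qed
  ultimately show ?thesis using small order_trans by blast
qed

text \<open>The Cauchy criterion for a left limit, with countably many tolerances so that the
  exceptional null sets can be united.\<close>

lemma Cauchy_at_left_convergent:
  fixes g :: "real \<Rightarrow> complex"
  assumes "\<And>k. \<exists>b<1. \<forall>r s. b < r \<longrightarrow> r < 1 \<longrightarrow> b < s \<longrightarrow> s < 1 \<longrightarrow> norm (g r - g s) < inverse (real (Suc k))"
  shows "\<exists>L. (g \<longlongrightarrow> L) (at_left 1)"
proof -
  have Cauchy_g: "\<exists>b<1. \<forall>r s. b < r \<longrightarrow> r < 1 \<longrightarrow> b < s \<longrightarrow> s < 1 \<longrightarrow> norm (g r - g s) < e" if e0: "0 < e" for e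
  proof -
    obtain k where "inverse (real (Suc k)) < e" using reals_Archimedean[OF e0] by blast
    with assms[of k] show ?thesis using less_trans by blast
  qed
  define p where "p m = 1 - inverse (real (Suc m))" for m
  have p: "p m < 1" for m by (simp add: p_def)
  have p_lim: "p \<longlonglongrightarrow> 1"
    unfolding p_def using tendsto_diff[OF tendsto_const[of 1] LIMSEQ_inverse_real_of_nat] by simp
  have "Cauchy (\<lambda>m. g (p m))"
  proof (rule metric_CauchyI)
    fix e :: real assume "0 < e"
    then obtain b where b: "b < 1" "\<And>r s. b < r \<Longrightarrow> r < 1 \<Longrightarrow> b < s \<Longrightarrow> s < 1 \<Longrightarrow> norm (g r - g s) < e"
      using Cauchy_g by blast
    obtain M where "\<And>m. m \<ge> M \<Longrightarrow> b < p m"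
      using order_tendstoD(1)[OF p_lim b(1)] by (auto simp: eventually_sequentially)
    then show "\<exists>M. \<forall>m\<ge>M. \<forall>n\<ge>M. dist (g (p m)) (g (p n)) < e"
      unfolding dist_norm using b(2) p by blast
  qed
  then obtain L where L: "(\<lambda>m. g (p m)) \<longlonglongrightarrow> L"
    by (auto simp: Cauchy_convergent_iff convergent_def)
  have "(g \<longlongrightarrow> L) (at_left 1)"
  proof (rule tendstoI)
    fix e :: real assume e: "0 < e"
    then obtain b where b: "b < 1" "\<And>r s. b < r \<Longrightarrow> r < 1 \<Longrightarrow> b < s \<Longrightarrow> s < 1 \<Longrightarrow> norm (g r - g s) < e / 2"
      using Cauchy_g[of "e / 2"] by auto
    have "\<forall>\<^sub>F m in sequentially. dist (g (p m)) L < e / 2 \<and> b < p m"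
      using tendstoD[OF L, of "e / 2"] order_tendstoD(1)[OF p_lim b(1)] e by (auto intro: eventually_conj)
    then obtain m where m: "dist (g (p m)) L < e / 2" "b < p m" by (auto dest: eventually_happens)
    have "dist (g r) L < e" if "b < r" "r < 1" for r
      using b(2)[OF that m(2) p] m(1) dist_triangle[of "g r" L "g (p m)"] by (simp add: dist_norm)
    then show "\<forall>\<^sub>F r in at_left 1. dist (g r) L < e"
      unfolding eventually_at_left_field using b(1) by blast
  qed
  then show ?thesis by blast
qed

text \<open>For one tolerance the exceptional sets can be chosen with measures tending to 0, and the
  bad points lie in all of them. Countably many tolerances then suffice for the Cauchy
  criterion.\<close>

lemma radial_limit_AE:
  fixes f :: "complex ^ 'n \<Rightarrow> complex"
  assumes f: "holomorphic_sv f polydisc" and A: "\<And>r. 0 < r \<Longrightarrow> r < 1 \<Longrightarrow> mean_square f r \<le> A"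
  shows "AE \<zeta> in torus_measure. \<exists>L. ((\<lambda>r. f (r *\<^sub>R \<zeta>)) \<longlongrightarrow> L) (at_left 1)"
proof -
  let ?P = "\<lambda>e \<zeta>. \<exists>b<1. \<forall>r s. b < r \<longrightarrow> r < 1 \<longrightarrow> b < s \<longrightarrow> s < 1 \<longrightarrow>
      norm (f (r *\<^sub>R \<zeta>) - f (s *\<^sub>R \<zeta>)) < e"
  have "AE \<zeta> in torus_measure. ?P e \<zeta>" if e: "0 < e" for e
  proof -
    have "\<forall>k. \<exists>E. E \<in> sets torus_measure \<and> measure torus_measure E \<le> inverse (real (Suc k)) \<and>
        (\<forall>\<zeta>\<in>torus - E. ?P e \<zeta>)"
    proof
      fix k
      have "0 < inverse (real (Suc k))" by simp
      from radial_oscillation[OF f A e this]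
      show "\<exists>E. E \<in> sets torus_measure \<and> measure torus_measure E \<le> inverse (real (Suc k)) \<and>
        (\<forall>\<zeta>\<in>torus - E. ?P e \<zeta>)" by (simp only: Bex_def conj_assoc)
    qed
    from choice[OF this] obtain E where E: "\<And>k. E k \<in> sets torus_measure"
      "\<And>k. measure torus_measure (E k) \<le> inverse (real (Suc k))" "\<And>k \<zeta>. \<zeta> \<in> torus - E k \<Longrightarrow> ?P e \<zeta>"
      by blast
    define N where "N = (\<Inter>k. E k)"
    have N: "N \<in> sets torus_measure" unfolding N_def using E(1) by blast
    have "measure torus_measure N \<le> inverse (real (Suc k))" for k
      using E(2)[of k] torus.finite_measure_mono[of N "E k"] E(1)[of k] by (fastforce simp: N_def)
    then have "measure torus_measure N \<le> 0"
      by (rule LIMSEQ_le_const[OF LIMSEQ_inverse_real_of_nat, OF exI[of _ 0], rule_format])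
    then have "emeasure torus_measure N = 0"
      by (simp add: torus.emeasure_eq_measure measure_le_0_iff)
    \<comment> \<open>Covering the bad points by a null set settles this tolerance without knowing
      that they form a measurable set.\<close>
    moreover have "{\<zeta> \<in> space torus_measure. \<not> ?P e \<zeta>} \<subseteq> N"
    proof
      fix \<zeta> assume "\<zeta> \<in> {\<zeta> \<in> space torus_measure. \<not> ?P e \<zeta>}"
      then have "\<zeta> \<in> torus" "\<not> ?P e \<zeta>" unfolding mem_Collect_eq space_torus_measure by blast+
      then have "\<zeta> \<in> E k" for k using E(3)[of \<zeta> k] by blast
      then show "\<zeta> \<in> N" by (simp add: N_def)
    qed
    ultimately show ?thesis using N by (intro AE_I)
  qed
  then have "AE \<zeta> in torus_measure. \<forall>k. ?P (inverse (real (Suc k))) \<zeta>"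
    by (subst AE_all_countable) simp
  then show ?thesis
    by eventually_elim (rule Cauchy_at_left_convergent, blast)
qed

text \<open>The set where the oscillation of \<open>f\<close> along radii exceeds \<open>c\<close> beyond radius \<open>b\<close> is relatively
  open, so the set of convergence is Borel; off that set \<open>boundary_value f\<close> is a fixed junk value.\<close>

definition radial_limit_set :: "(complex ^ 'n \<Rightarrow> complex) \<Rightarrow> (complex ^ 'n) set" where
  "radial_limit_set f = {\<zeta> \<in> torus. \<exists>L. ((\<lambda>r. f (r *\<^sub>R \<zeta>)) \<longlongrightarrow> L) (at_left 1)}"

text \<open>Fixed radii tending to 1, for limit theorems about sequences. The double
  \<open>Suc\<close> starts them at 1/2, so that all are positive.\<close>

definition radius :: "nat \<Rightarrow> real" where
  "radius m = 1 - inverse (real (Suc (Suc m)))"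

lemma radius_pos [simp]: "0 < radius m" and radius_less_one [simp]: "radius m < 1"
  by (simp_all add: radius_def field_simps)

lemma radius_tendsto: "radius \<longlonglongrightarrow> 1"
  unfolding radius_def
  using tendsto_diff[OF tendsto_const[of 1] LIMSEQ_Suc[OF LIMSEQ_inverse_real_of_nat]] by simp

lemma radius_at_left: "filterlim radius (at_left 1) sequentially"
  unfolding filterlim_at using radius_tendsto by (auto simp: less_imp_neq)

lemma radial_limit_set_sets:
  assumes f: "holomorphic_sv f polydisc"
  shows "radial_limit_set f \<in> sets torus_borel"
proof -
  define G where "G k j = {\<zeta> \<in> torus. \<exists>r s. radius j < r \<and> r < 1 \<and> radius j < s \<and> s < 1 \<and>
    inverse (real (Suc k)) < norm (f (r *\<^sub>R \<zeta>) - f (s *\<^sub>R \<zeta>))}" for k j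
  have G: "G k j \<in> sets torus_borel" for k j
  proof -
    let ?I = "{radius j<..<1}"
    let ?U = "\<lambda>r s. {\<zeta> \<in> torus. norm (f (r *\<^sub>R \<zeta>) - f (s *\<^sub>R \<zeta>)) \<in> {inverse (real (Suc k))<..}}"
    have U: "openin (top_of_set torus) (?U r s)" if rs: "r \<in> ?I" "s \<in> ?I" for r s
    proof -
      have "0 \<le> r" "0 \<le> s" "r < 1" "s < 1" using rs radius_pos[of j] by (simp_all del: radius_pos)
      then have "continuous_on torus (\<lambda>\<zeta>. norm (f (r *\<^sub>R \<zeta>) - f (s *\<^sub>R \<zeta>)))"
        by (intro continuous_on_norm continuous_on_diff dilation_continuous_torus f)
      from continuous_openin_preimage_gen[OF this open_greaterThan]
      show ?thesis by (simp add: vimage_def Int_def)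
    qed
    \<comment> \<open>The union runs over uncountably many pairs of radii, which is harmless for
      relatively open sets.\<close>
    have "openin (top_of_set torus) (\<Union>p\<in>?I \<times> ?I. ?U (fst p) (snd p))"
      by (rule openin_Union) (use U in auto)
    moreover have "G k j = (\<Union>p\<in>?I \<times> ?I. ?U (fst p) (snd p))"
      unfolding G_def by (intro set_eqI iffI) (auto simp: Bex_def simp del: of_nat_Suc)
    ultimately obtain T where "open T" "G k j = torus \<inter> T" by (auto simp: openin_open)
    then show ?thesis by (auto simp: sets_restrict_space)
  qed
  have "radial_limit_set f = (\<Inter>k. \<Union>j. torus - G k j)"
  proof (intro set_eqI iffI)
    fix \<zeta> assume "\<zeta> \<in> radial_limit_set f"
    then obtain L where \<zeta>: "\<zeta> \<in> torus" and L: "((\<lambda>r. f (r *\<^sub>R \<zeta>)) \<longlongrightarrow> L) (at_left 1)"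
      by (auto simp: radial_limit_set_def)
    have "\<exists>j. \<zeta> \<in> torus - G k j" for k
    proof -
      define e where "e = inverse (real (Suc k)) / 2"
      have e: "0 < e" by (simp add: e_def)
      obtain b where b: "b < 1" "\<And>r. b < r \<Longrightarrow> r < 1 \<Longrightarrow> dist (f (r *\<^sub>R \<zeta>)) L < e"
        using tendstoD[OF L e] unfolding eventually_at_left_field by blast
      obtain j where j: "b < radius j"
        using order_tendstoD(1)[OF radius_tendsto b(1)] by (auto dest: eventually_happens)
      have "norm (f (r *\<^sub>R \<zeta>) - f (s *\<^sub>R \<zeta>)) \<le> inverse (real (Suc k))"
        if "radius j < r" "r < 1" "radius j < s" "s < 1" for r s
        using b(2)[of r] b(2)[of s] that j dist_triangle2[of "f (r *\<^sub>R \<zeta>)" "f (s *\<^sub>R \<zeta>)" L]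
        by (simp add: e_def dist_norm del: of_nat_Suc)
      then have "\<zeta> \<notin> G k j" unfolding G_def mem_Collect_eq using not_less by blast
      then show ?thesis using \<zeta> by blast
    qed
    then show "\<zeta> \<in> (\<Inter>k. \<Union>j. torus - G k j)" by blast
  next
    fix \<zeta> assume *: "\<zeta> \<in> (\<Inter>k. \<Union>j. torus - G k j)"
    then have \<zeta>: "\<zeta> \<in> torus" by blast
    have "\<exists>L. ((\<lambda>r. f (r *\<^sub>R \<zeta>)) \<longlongrightarrow> L) (at_left 1)"
    proof (rule Cauchy_at_left_convergent)
      fix k
      \<comment> \<open>Taking \<open>Suc k\<close> turns the weak inequality valid outside
        \<open>G\<close> into the strict one that the Cauchy criterion asks for.\<close>
      obtain j where j: "\<zeta> \<notin> G (Suc k) j" using * by blast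
      have "inverse (real (Suc (Suc k))) < inverse (real (Suc k))" by simp
      moreover have "norm (f (r *\<^sub>R \<zeta>) - f (s *\<^sub>R \<zeta>)) \<le> inverse (real (Suc (Suc k)))"
        if "radius j < r" "r < 1" "radius j < s" "s < 1" for r s
        using j that \<zeta> unfolding G_def mem_Collect_eq using not_less by blast
      ultimately show "\<exists>b<1. \<forall>r s. b < r \<longrightarrow> r < 1 \<longrightarrow> b < s \<longrightarrow> s < 1 \<longrightarrow>
          norm (f (r *\<^sub>R \<zeta>) - f (s *\<^sub>R \<zeta>)) < inverse (real (Suc k))"
        by (intro exI[of _ "radius j"] conjI radius_less_one allI impI) (rule le_less_trans)
    qed
    then show "\<zeta> \<in> radial_limit_set f" using \<zeta> by (simp add: radial_limit_set_def)
  qed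
  also have "\<dots> \<in> sets torus_borel"
  proof -
    have "torus - G k j \<in> sets torus_borel" for k j
      using sets.compl_sets[OF G[of k j]] by (simp add: space_restrict_space)
    then have "(\<Union>j. torus - G k j) \<in> sets torus_borel" for k
      by (intro sets.countable_UN image_subsetI)
    then show ?thesis by (intro sets.countable_INT image_subsetI) simp_all
  qed
  finally show ?thesis .
qed

lemma boundary_value_eq:
  assumes "((\<lambda>r. f (r *\<^sub>R \<zeta>)) \<longlongrightarrow> L) (at_left 1)"
  shows "boundary_value f \<zeta> = L"
  unfolding boundary_value_def using assms by (intro tendsto_Lim) auto

lemma boundary_value_tendsto:
  assumes "\<zeta> \<in> radial_limit_set f"
  shows "((\<lambda>r. f (r *\<^sub>R \<zeta>)) \<longlongrightarrow> boundary_value f \<zeta>) (at_left 1)"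
  using assms boundary_value_eq[of f \<zeta>] by (auto simp: radial_limit_set_def)

lemma boundary_value_radius_tendsto:
  assumes "\<zeta> \<in> radial_limit_set f"
  shows "(\<lambda>m. f (radius m *\<^sub>R \<zeta>)) \<longlonglongrightarrow> boundary_value f \<zeta>"
  by (rule filterlim_compose[OF boundary_value_tendsto[OF assms] radius_at_left])

lemma boundary_value_measurable:
  assumes f: "holomorphic_sv f polydisc"
  shows "boundary_value f \<in> borel_measurable torus_borel"
proof -
  \<comment> \<open>\<open>Lim\<close> is a definite description; where no limit exists its
    predicate is identically false, so it always takes this value.\<close>
  let ?c = "THE l::complex. False"
  let ?g = "\<lambda>m \<zeta>. f (radius m *\<^sub>R \<zeta>)"
  have g: "?g m \<in> borel_measurable torus_borel" for m
    by (intro continuous_on_torus_measurable dilation_continuous_torus f) (auto simp: less_imp_le)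
  have C: "radial_limit_set f \<inter> space torus_borel \<in> sets torus_borel"
    by (intro sets.Int radial_limit_set_sets f sets.top)
  have "(\<lambda>\<zeta>. if \<zeta> \<in> radial_limit_set f then lim (\<lambda>m. ?g m \<zeta>) else ?c) \<in> borel_measurable torus_borel"
    by (intro measurable_If_set borel_measurable_lim_metric g borel_measurable_const C)
  moreover have "boundary_value f \<zeta> = (if \<zeta> \<in> radial_limit_set f then lim (\<lambda>m. ?g m \<zeta>) else ?c)"
    if "\<zeta> \<in> space torus_borel" for \<zeta>
  proof (cases "\<zeta> \<in> radial_limit_set f")
    case True
    then show ?thesis using limI[OF boundary_value_radius_tendsto[OF True]] by simp
  next
    case False
    then have "\<not> ((\<lambda>r. f (r *\<^sub>R \<zeta>)) \<longlongrightarrow> l) (at_left 1)" for l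
      using that by (auto simp: radial_limit_set_def space_restrict_space)
    then show ?thesis using False by (simp add: boundary_value_def t2_space_class.Lim_def)
  qed
  ultimately show ?thesis by (simp cong: measurable_cong)
qed

section \<open>Boundary values of Hardy functions\<close>

lemma hardy2_holomorphic: "f \<in> hardy2 \<Longrightarrow> holomorphic_sv f polydisc"
  by (simp add: hardy2_def)

lemma mean_square_eq: "mean_square f r = (\<integral>\<zeta>. (norm (f (r *\<^sub>R \<zeta>)))\<^sup>2 \<partial>torus_measure)"
  by (simp add: mean_square_def L2_norm_square)

lemma hardy2_bound:
  assumes "f \<in> hardy2"
  obtains A where "\<And>r. 0 < r \<Longrightarrow> r < 1 \<Longrightarrow> mean_square f r \<le> A"
  using assms unfolding hardy2_def mean_square_eq bdd_above_def by force

lemma hardy2I: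
  assumes "holomorphic_sv f polydisc" "\<And>r. 0 < r \<Longrightarrow> r < 1 \<Longrightarrow> mean_square f r \<le> A"
  shows "f \<in> hardy2"
  using assms unfolding hardy2_def mean_square_eq by (auto intro!: bdd_aboveI[of _ A])

lemma radial_limit_set_AE:
  fixes f :: "complex ^ 'n \<Rightarrow> complex"
  assumes "f \<in> hardy2"
  shows "AE \<zeta> in torus_measure. \<zeta> \<in> radial_limit_set f"
proof -
  obtain A where A: "\<And>r. 0 < r \<Longrightarrow> r < 1 \<Longrightarrow> mean_square f r \<le> A"
    using hardy2_bound[OF assms] by blast
  have "AE \<zeta> in torus_measure. \<exists>L. ((\<lambda>r. f (r *\<^sub>R \<zeta>)) \<longlongrightarrow> L) (at_left 1)"
    by (rule radial_limit_AE[OF hardy2_holomorphic[OF assms] A])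
  moreover have "AE \<zeta> in torus_measure. \<zeta> \<in> (torus :: (complex ^ 'n) set)"
    by (rule AE_I2) simp
  ultimately show ?thesis by eventually_elim (simp add: radial_limit_set_def)
qed

text \<open>Almost everywhere convergence identifies the limit of the dilates. Fatou for the bounded
  dilates puts it into L2, and Fatou for their differences turns the Cauchy property into
  convergence in norm.\<close>

lemma
  fixes f :: "complex ^ 'n \<Rightarrow> complex"
  assumes f: "f \<in> hardy2"
  shows boundary_value_L2: "boundary_value f \<in> L2 torus_measure"
    and dilation_tendsto_boundary_value:
      "(\<lambda>m. L2_norm torus_measure (\<lambda>\<zeta>. boundary_value f \<zeta> - f (radius m *\<^sub>R \<zeta>))) \<longlonglongrightarrow> 0"
proof -
  let ?d = "\<lambda>m \<zeta>. f (radius m *\<^sub>R \<zeta>)"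
  note hol = hardy2_holomorphic[OF f]
  obtain A where A: "\<And>r. 0 < r \<Longrightarrow> r < 1 \<Longrightarrow> mean_square f r \<le> A"
    using hardy2_bound[OF f] by blast
  have d: "?d m \<in> L2 torus_measure" for m
    by (intro dilation_L2 hol) (auto simp: less_imp_le)
  have bm: "boundary_value f \<in> borel_measurable torus_measure"
    using boundary_value_measurable[OF hol] by simp
  have lim: "AE \<zeta> in torus_measure. (\<lambda>m. ?d m \<zeta>) \<longlonglongrightarrow> boundary_value f \<zeta>"
    using radial_limit_set_AE[OF f] by eventually_elim (rule boundary_value_radius_tendsto)
  show bL2: "boundary_value f \<in> L2 torus_measure"
  proof (rule L2_Fatou(1)[OF L2_measurable[OF d] bm lim])
    have "L2_norm torus_measure (?d m) \<le> sqrt A" for m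
      using A[of "radius m"] by (intro real_le_rsqrt) (simp add: mean_square_def)
    then show "\<forall>\<^sub>F m in sequentially. ?d m \<in> L2 torus_measure \<and> L2_norm torus_measure (?d m) \<le> sqrt A"
      using d by simp
  qed
  show "(\<lambda>m. L2_norm torus_measure (\<lambda>\<zeta>. boundary_value f \<zeta> - ?d m \<zeta>)) \<longlonglongrightarrow> 0"
  proof (rule LIMSEQ_I)
    fix e :: real assume e: "0 < e"
    then have "0 < (e / 2)\<^sup>2" by simp
    then obtain R where R: "0 < R" "R < 1" and close: "\<And>r s. R \<le> r \<Longrightarrow> r < 1 \<Longrightarrow> R \<le> s \<Longrightarrow> s < 1 \<Longrightarrow>
      (L2_norm torus_measure (\<lambda>\<zeta>. f (r *\<^sub>R \<zeta>) - f (s *\<^sub>R \<zeta>)))\<^sup>2 < (e / 2)\<^sup>2"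
      using dilation_L2_Cauchy[OF hol A] by blast
    obtain N where N: "\<And>m. m \<ge> N \<Longrightarrow> R < radius m"
      using order_tendstoD(1)[OF radius_tendsto R(2)] by (auto simp: eventually_sequentially)
    have "L2_norm torus_measure (\<lambda>\<zeta>. boundary_value f \<zeta> - ?d m \<zeta>) \<le> e / 2" if m: "m \<ge> N" for m
    proof (rule L2_Fatou(2)[where f = "\<lambda>k \<zeta>. ?d k \<zeta> - ?d m \<zeta>"])
      have dm: "(\<lambda>\<zeta>. ?d k \<zeta> - ?d m \<zeta>) \<in> L2 torus_measure" for k by (intro L2_diff d)
      then show "(\<lambda>\<zeta>. ?d k \<zeta> - ?d m \<zeta>) \<in> borel_measurable torus_measure" for k by (rule L2_measurable)
      show "(\<lambda>\<zeta>. boundary_value f \<zeta> - ?d m \<zeta>) \<in> borel_measurable torus_measure"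
        by (intro borel_measurable_diff bm L2_measurable[OF d])
      show "AE \<zeta> in torus_measure. (\<lambda>k. ?d k \<zeta> - ?d m \<zeta>) \<longlonglongrightarrow> boundary_value f \<zeta> - ?d m \<zeta>"
        using lim by eventually_elim (intro tendsto_intros)
      have "L2_norm torus_measure (\<lambda>\<zeta>. ?d k \<zeta> - ?d m \<zeta>) \<le> e / 2" if "k \<ge> N" for k
      proof (rule power2_le_imp_le)
        show "(L2_norm torus_measure (\<lambda>\<zeta>. ?d k \<zeta> - ?d m \<zeta>))\<^sup>2 \<le> (e / 2)\<^sup>2"
          using N[OF that] N[OF m] by (intro less_imp_le close) auto
      qed (use e in simp)
      then show "\<forall>\<^sub>F k in sequentially. (\<lambda>\<zeta>. ?d k \<zeta> - ?d m \<zeta>) \<in> L2 torus_measure \<and>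
          L2_norm torus_measure (\<lambda>\<zeta>. ?d k \<zeta> - ?d m \<zeta>) \<le> e / 2"
        using dm by (auto simp: eventually_sequentially)
    qed
    then show "\<exists>no. \<forall>m\<ge>no. norm (L2_norm torus_measure (\<lambda>\<zeta>. boundary_value f \<zeta> - ?d m \<zeta>) - 0) < e"
      using e by (intro exI[of _ N]) fastforce
  qed
qed

lemma cauchy_kernel_continuous_closed:
  assumes "w \<in> polydisc"
  shows "continuous_on closed_polydisc (\<lambda>z. cauchy_kernel z w)"
  by (rule holomorphic_sv_continuous[OF holomorphic_cauchy_kernel[OF assms]])

lemma cauchy_kernel_cnj: "cnj (cauchy_kernel z w) = cauchy_kernel w z"
  by (simp add: cauchy_kernel_def mult.commute)

lemma cauchy_kernel_L2:
  assumes "finite_measure \<sigma>" "sets \<sigma> = sets torus_borel" "w \<in> polydisc"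
  shows "(\<lambda>z. cauchy_kernel z w) \<in> L2 \<sigma>"
  by (rule continuous_on_torus_L2[OF assms(1,2) continuous_on_subset[OF
        cauchy_kernel_continuous_closed[OF assms(3)] torus_subset_closed_polydisc]])

text \<open>The formula holds for dilates. The integrals converge by L2 convergence to the boundary
  value, the values by continuity at the interior point \<open>w\<close>.\<close>

lemma hardy2_cauchy_formula:
  fixes f :: "complex ^ 'n \<Rightarrow> complex"
  assumes f: "f \<in> hardy2" and w: "w \<in> polydisc"
  shows "L2_inner torus_measure (boundary_value f) (\<lambda>z. cauchy_kernel z w) = f w"
proof (rule LIMSEQ_unique)
  note hol = hardy2_holomorphic[OF f]
  let ?d = "\<lambda>m \<zeta>. f (radius m *\<^sub>R \<zeta>)"
  have d: "?d m \<in> L2 torus_measure" for m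
    by (intro dilation_L2 hol) (auto simp: less_imp_le)
  show "(\<lambda>m. L2_inner torus_measure (?d m) (\<lambda>z. cauchy_kernel z w)) \<longlonglongrightarrow>
      L2_inner torus_measure (boundary_value f) (\<lambda>z. cauchy_kernel z w)"
    by (intro L2_inner_tendsto boundary_value_L2 f d dilation_tendsto_boundary_value
        cauchy_kernel_L2[OF torus.finite_measure_axioms sets_torus_measure w])
  have "L2_inner torus_measure (?d m) (\<lambda>z. cauchy_kernel z w) = f (radius m *\<^sub>R w)" for m
  proof -
    have "holomorphic_sv (?d m) closed_polydisc"
      by (rule holomorphic_sv_dilation[OF hol scaleR_closed_polydisc_in_polydisc])
        (auto simp: less_imp_le)
    from cauchy_formula[OF this w] show ?thesis
      by (simp add: L2_inner_def cauchy_kernel_cnj mult.commute)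
  qed
  moreover have "(\<lambda>m. f (radius m *\<^sub>R w)) \<longlonglongrightarrow> f (1 *\<^sub>R w)"
    using holomorphic_sv_isCont[OF hol w]
    by (intro isCont_tendsto_compose[where g = f] tendsto_intros radius_tendsto) simp
  ultimately show "(\<lambda>m. L2_inner torus_measure (?d m) (\<lambda>z. cauchy_kernel z w)) \<longlonglongrightarrow> f w" by simp
qed

lemma hardy2_norm_eq: "hardy2_norm f = L2_norm torus_measure (boundary_value f)"
  by (simp add: hardy2_norm_def)

lemma hardy2_inner_eq: "hardy2_inner f g = L2_inner torus_measure (boundary_value f) (boundary_value g)"
  by (simp add: hardy2_inner_def L2_inner_def)

text \<open>The means increase with the radius, and the dilates converge in L2 to the boundary
  value. With \<open>hardy2_norm_le\<close> this links the boundary norm to the means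
  inside.\<close>

lemma mean_square_le_hardy2_norm:
  fixes f :: "complex ^ 'n \<Rightarrow> complex"
  assumes f: "f \<in> hardy2" and r: "0 < r" "r < 1"
  shows "mean_square f r \<le> (hardy2_norm f)\<^sup>2"
proof -
  note hol = hardy2_holomorphic[OF f]
  obtain A where A: "\<And>r. 0 < r \<Longrightarrow> r < 1 \<Longrightarrow> mean_square f r \<le> A"
    using hardy2_bound[OF f] by blast
  let ?d = "\<lambda>m \<zeta>. f (radius m *\<^sub>R \<zeta>)"
  have d: "?d m \<in> L2 torus_measure" for m
    by (intro dilation_L2 hol) (auto simp: less_imp_le)
  have b: "boundary_value f \<in> L2 torus_measure" by (rule boundary_value_L2[OF f])
  have "sqrt (mean_square f r) \<le> hardy2_norm f"
  proof (rule LIMSEQ_le_const)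
    show "(\<lambda>m. hardy2_norm f + L2_norm torus_measure (\<lambda>\<zeta>. boundary_value f \<zeta> - ?d m \<zeta>)) \<longlonglongrightarrow> hardy2_norm f"
      using tendsto_add[OF tendsto_const dilation_tendsto_boundary_value[OF f]] by simp
    obtain N where N: "\<And>m. m \<ge> N \<Longrightarrow> r < radius m"
      using order_tendstoD(1)[OF radius_tendsto r(2)] by (auto simp: eventually_sequentially)
    have "sqrt (mean_square f r) \<le> hardy2_norm f + L2_norm torus_measure (\<lambda>\<zeta>. boundary_value f \<zeta> - ?d m \<zeta>)"
      if "m \<ge> N" for m
    proof -
      have "mean_square f r \<le> mean_square f (radius m)"
        using N[OF that] r by (intro mean_square_mono[OF hol A]) auto
      then have "sqrt (mean_square f r) \<le> L2_norm torus_measure (?d m)"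
        by (intro real_le_lsqrt) (auto simp: mean_square_def)
      also have "\<dots> = L2_norm torus_measure (\<lambda>\<zeta>. boundary_value f \<zeta> + (?d m \<zeta> - boundary_value f \<zeta>))"
        by simp
      also have "\<dots> \<le> L2_norm torus_measure (boundary_value f) + L2_norm torus_measure (\<lambda>\<zeta>. ?d m \<zeta> - boundary_value f \<zeta>)"
        by (intro L2_norm_triangle L2_diff b d)
      finally show ?thesis by (simp add: hardy2_norm_eq L2_norm_minus_commute)
    qed
    then show "\<exists>N. \<forall>m\<ge>N. sqrt (mean_square f r) \<le> hardy2_norm f + L2_norm torus_measure (\<lambda>\<zeta>. boundary_value f \<zeta> - ?d m \<zeta>)"
      by blast
  qed
  then have "(sqrt (mean_square f r))\<^sup>2 \<le> (hardy2_norm f)\<^sup>2" by (intro power_mono) auto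
  then show ?thesis by simp
qed

lemma hardy2_norm_le:
  fixes f :: "complex ^ 'n \<Rightarrow> complex"
  assumes f: "f \<in> hardy2" and A: "\<And>r. 0 < r \<Longrightarrow> r < 1 \<Longrightarrow> mean_square f r \<le> A\<^sup>2" and "0 \<le> A"
  shows "hardy2_norm f \<le> A"
  unfolding hardy2_norm_eq
proof (rule L2_Fatou(2))
  let ?d = "\<lambda>m \<zeta>. f (radius m *\<^sub>R \<zeta>)"
  have d: "?d m \<in> L2 torus_measure" for m
    by (intro dilation_L2 hardy2_holomorphic f) (auto simp: less_imp_le)
  then show "?d m \<in> borel_measurable torus_measure" for m by (rule L2_measurable)
  show "boundary_value f \<in> borel_measurable torus_measure"
    by (rule L2_measurable[OF boundary_value_L2[OF f]])
  show "AE \<zeta> in torus_measure. (\<lambda>m. ?d m \<zeta>) \<longlonglongrightarrow> boundary_value f \<zeta>"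
    using radial_limit_set_AE[OF f] by eventually_elim (rule boundary_value_radius_tendsto)
  have "L2_norm torus_measure (?d m) \<le> A" for m
    by (rule power2_le_imp_le[of _ A]) (use A[of "radius m"] \<open>0 \<le> A\<close> in \<open>auto simp: mean_square_def\<close>)
  then show "\<forall>\<^sub>F m in sequentially. ?d m \<in> L2 torus_measure \<and> L2_norm torus_measure (?d m) \<le> A"
    using d by simp
qed

section \<open>Hardy and model spaces\<close>

lemma mean_square_le:
  fixes f :: "complex ^ 'n \<Rightarrow> complex"
  assumes f: "holomorphic_sv f polydisc" and r: "0 < r" "r < 1"
    and g: "integrable torus_measure g" and le: "\<And>\<zeta>. \<zeta> \<in> torus \<Longrightarrow> (norm (f (r *\<^sub>R \<zeta>)))\<^sup>2 \<le> g \<zeta>"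
  shows "mean_square f r \<le> (\<integral>\<zeta>. g \<zeta> \<partial>torus_measure)"
  unfolding mean_square_eq
  using r by (intro integral_mono g L2_integrable_square dilation_L2 f) (auto intro: le)

lemma hardy2_lincomb:
  fixes f g :: "complex ^ 'n \<Rightarrow> complex"
  assumes f: "f \<in> hardy2" and g: "g \<in> hardy2"
  shows "(\<lambda>z. a * f z + b * g z) \<in> hardy2"
proof -
  obtain A where A: "\<And>r. 0 < r \<Longrightarrow> r < 1 \<Longrightarrow> mean_square f r \<le> A" using hardy2_bound[OF f] by blast
  obtain B where B: "\<And>r. 0 < r \<Longrightarrow> r < 1 \<Longrightarrow> mean_square g r \<le> B" using hardy2_bound[OF g] by blast
  have hol: "holomorphic_sv (\<lambda>z. a * f z + b * g z) polydisc"
    by (intro holomorphic_sv_lincomb hardy2_holomorphic f g)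
  show ?thesis
  proof (rule hardy2I[OF hol])
    fix r :: real assume r: "0 < r" "r < 1"
    have int: "integrable torus_measure (\<lambda>\<zeta>. (norm (f (r *\<^sub>R \<zeta>)))\<^sup>2)"
      "integrable torus_measure (\<lambda>\<zeta>. (norm (g (r *\<^sub>R \<zeta>)))\<^sup>2)"
      using r by (auto intro!: L2_integrable_square dilation_L2 hardy2_holomorphic f g)
    have "mean_square (\<lambda>z. a * f z + b * g z) r \<le>
        (\<integral>\<zeta>. 2 * ((norm a)\<^sup>2 * (norm (f (r *\<^sub>R \<zeta>)))\<^sup>2 + (norm b)\<^sup>2 * (norm (g (r *\<^sub>R \<zeta>)))\<^sup>2) \<partial>torus_measure)"
      using int by (intro mean_square_le hol r norm_square_lincomb_le) auto
    also have "\<dots> = 2 * ((norm a)\<^sup>2 * mean_square f r + (norm b)\<^sup>2 * mean_square g r)"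
      using int by (simp add: mean_square_eq)
    also have "\<dots> \<le> 2 * ((norm a)\<^sup>2 * A + (norm b)\<^sup>2 * B)"
      using A[OF r] B[OF r] by (intro mult_left_mono add_mono) auto
    finally show "mean_square (\<lambda>z. a * f z + b * g z) r \<le> 2 * ((norm a)\<^sup>2 * A + (norm b)\<^sup>2 * B)" .
  qed
qed

lemma hardy2_diff: "f \<in> hardy2 \<Longrightarrow> g \<in> hardy2 \<Longrightarrow> (\<lambda>z. f z - g z) \<in> hardy2"
  using hardy2_lincomb[of f g 1 "-1"] by simp

lemma hardy2_mult_bounded:
  fixes f g :: "complex ^ 'n \<Rightarrow> complex"
  assumes f: "holomorphic_sv f polydisc" "\<And>z. z \<in> polydisc \<Longrightarrow> norm (f z) \<le> B" and g: "g \<in> hardy2"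
  shows "(\<lambda>z. f z * g z) \<in> hardy2"
proof -
  obtain A where A: "\<And>r. 0 < r \<Longrightarrow> r < 1 \<Longrightarrow> mean_square g r \<le> A" using hardy2_bound[OF g] by blast
  have hol: "holomorphic_sv (\<lambda>z. f z * g z) polydisc"
    by (intro holomorphic_sv_mult f hardy2_holomorphic g)
  show ?thesis
  proof (rule hardy2I[OF hol])
    fix r :: real assume r: "0 < r" "r < 1"
    have int: "integrable torus_measure (\<lambda>\<zeta>. (norm (g (r *\<^sub>R \<zeta>)))\<^sup>2)"
      using r by (intro L2_integrable_square dilation_L2 hardy2_holomorphic g) auto
    have "mean_square (\<lambda>z. f z * g z) r \<le> (\<integral>\<zeta>. B\<^sup>2 * (norm (g (r *\<^sub>R \<zeta>)))\<^sup>2 \<partial>torus_measure)"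
    proof (intro mean_square_le hol r integrable_mult_right int)
      fix \<zeta> :: "complex ^ 'n" assume "\<zeta> \<in> torus"
      then have "norm (f (r *\<^sub>R \<zeta>)) \<le> B" using r by (intro f scaleR_torus_in_polydisc) auto
      then show "(norm (f (r *\<^sub>R \<zeta>) * g (r *\<^sub>R \<zeta>)))\<^sup>2 \<le> B\<^sup>2 * (norm (g (r *\<^sub>R \<zeta>)))\<^sup>2"
        unfolding norm_mult power_mult_distrib by (intro mult_right_mono power_mono) auto
    qed
    also have "\<dots> = B\<^sup>2 * mean_square g r" by (simp add: mean_square_eq)
    also have "\<dots> \<le> B\<^sup>2 * A" using A[OF r] by (intro mult_left_mono) auto
    finally show "mean_square (\<lambda>z. f z * g z) r \<le> B\<^sup>2 * A" .
  qed
qed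

lemma hardy2_const: "(\<lambda>z. c) \<in> hardy2"
  by (rule hardy2I[of _ "(norm c)\<^sup>2"])
    (auto intro: holomorphic_sv_const simp: mean_square_eq)

lemma hardy2_bounded:
  fixes f :: "complex ^ 'n \<Rightarrow> complex"
  assumes "holomorphic_sv f polydisc" "\<And>z. z \<in> polydisc \<Longrightarrow> norm (f z) \<le> B"
  shows "f \<in> hardy2"
  using hardy2_mult_bounded[OF assms hardy2_const[of 1]] by simp

lemma boundary_value_lincomb:
  assumes "\<zeta> \<in> radial_limit_set f" "\<zeta> \<in> radial_limit_set g"
  shows "boundary_value (\<lambda>z. a * f z + b * g z) \<zeta> = a * boundary_value f \<zeta> + b * boundary_value g \<zeta>"
  by (intro boundary_value_eq tendsto_add tendsto_mult_left boundary_value_tendsto assms)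

lemma boundary_value_mult:
  assumes "\<zeta> \<in> radial_limit_set f" "\<zeta> \<in> radial_limit_set g"
  shows "boundary_value (\<lambda>z. f z * g z) \<zeta> = boundary_value f \<zeta> * boundary_value g \<zeta>"
  by (intro boundary_value_eq tendsto_mult boundary_value_tendsto assms)

lemma boundary_value_lincomb_AE:
  fixes f g :: "complex ^ 'n \<Rightarrow> complex"
  assumes "f \<in> hardy2" "g \<in> hardy2"
  shows "AE \<zeta> in torus_measure.
    boundary_value (\<lambda>z. a * f z + b * g z) \<zeta> = a * boundary_value f \<zeta> + b * boundary_value g \<zeta>"
  using radial_limit_set_AE[OF assms(1)] radial_limit_set_AE[OF assms(2)]
  by eventually_elim (rule boundary_value_lincomb)

lemma hardy2_norm_lincomb:
  fixes f g :: "complex ^ 'n \<Rightarrow> complex"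
  assumes f: "f \<in> hardy2" and g: "g \<in> hardy2"
  shows "hardy2_norm (\<lambda>z. a * f z + b * g z) =
    L2_norm torus_measure (\<lambda>\<zeta>. a * boundary_value f \<zeta> + b * boundary_value g \<zeta>)"
  unfolding hardy2_norm_eq
  by (intro L2_norm_cong_AE boundary_value_lincomb_AE assms
      L2_measurable[OF boundary_value_L2[OF hardy2_lincomb]] L2_measurable[OF L2_lincomb] boundary_value_L2)

lemma hardy2_inner_lincomb_left:
  fixes f g h :: "complex ^ 'n \<Rightarrow> complex"
  assumes f: "f \<in> hardy2" and g: "g \<in> hardy2" and h: "h \<in> hardy2"
  shows "hardy2_inner (\<lambda>z. a * f z + b * g z) h = a * hardy2_inner f h + b * hardy2_inner g h"
proof -
  note b = boundary_value_L2[OF f] boundary_value_L2[OF g] boundary_value_L2[OF h]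
  have "hardy2_inner (\<lambda>z. a * f z + b * g z) h =
      L2_inner torus_measure (\<lambda>\<zeta>. a * boundary_value f \<zeta> + b * boundary_value g \<zeta>) (boundary_value h)"
    unfolding hardy2_inner_eq
    by (rule L2_inner_cong_AE[OF boundary_value_lincomb_AE[OF f g] AE_I2[OF refl]
          L2_measurable[OF boundary_value_L2[OF hardy2_lincomb[OF f g]]] L2_measurable[OF b(3)]
          L2_measurable[OF L2_lincomb[OF b(1,2)]] L2_measurable[OF b(3)]])
  then show ?thesis by (simp add: hardy2_inner_eq L2_inner_add_left[OF b])
qed

lemma hardy2_inner_commute: "hardy2_inner g f = cnj (hardy2_inner f g)"
  unfolding hardy2_inner_eq by (rule L2_inner_commute)

text \<open>It identifies boundary values with actual values for functions continuous up to the
  torus, in particular the Cauchy kernels.\<close>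

lemma continuous_closed_polydisc_radial_tendsto:
  fixes f :: "complex ^ 'n \<Rightarrow> complex"
  assumes "continuous_on closed_polydisc f" "\<zeta> \<in> torus"
  shows "((\<lambda>r. f (r *\<^sub>R \<zeta>)) \<longlongrightarrow> f \<zeta>) (at_left 1)"
proof -
  have "continuous_on {0..1} (\<lambda>r. f (r *\<^sub>R \<zeta>))"
  proof (rule continuous_on_compose2[OF assms(1)])
    show "continuous_on {0..1} (\<lambda>r. r *\<^sub>R \<zeta>)" by (intro continuous_intros)
    show "(\<lambda>r. r *\<^sub>R \<zeta>) ` {0..1} \<subseteq> closed_polydisc"
      using assms(2) by (auto simp: torus_def closed_polydisc_def)
  qed
  then have "((\<lambda>r. f (r *\<^sub>R \<zeta>)) \<longlongrightarrow> f (1 *\<^sub>R \<zeta>)) (at 1 within {0..1})"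
    unfolding continuous_on_def by (rule bspec) simp
  then show ?thesis by (simp add: at_within_Icc_at_left)
qed

lemma cauchy_kernel_bounded:
  assumes "w \<in> polydisc"
  obtains B where "\<And>z. z \<in> closed_polydisc \<Longrightarrow> norm (cauchy_kernel z w) \<le> B"
  using compact_imp_bounded[OF compact_continuous_image[OF cauchy_kernel_continuous_closed[OF assms] compact_closed_polydisc]]
  unfolding bounded_iff by (meson imageI)

lemma cauchy_kernel_hardy2:
  fixes w :: "complex ^ 'n"
  assumes "w \<in> polydisc"
  shows "(\<lambda>z. cauchy_kernel z w) \<in> hardy2"
proof -
  obtain B where "\<And>z. z \<in> closed_polydisc \<Longrightarrow> norm (cauchy_kernel z w) \<le> B"
    using cauchy_kernel_bounded[OF assms] by blast
  then show ?thesis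
    using polydisc_subset_closed_polydisc
      holomorphic_sv_subset[OF holomorphic_cauchy_kernel[OF assms] polydisc_subset_closed_polydisc]
    by (intro hardy2_bounded) blast+
qed

lemma boundary_value_cauchy_kernel:
  assumes "w \<in> polydisc" "\<zeta> \<in> torus"
  shows "boundary_value (\<lambda>z. cauchy_kernel z w) \<zeta> = cauchy_kernel \<zeta> w"
  by (intro boundary_value_eq continuous_closed_polydisc_radial_tendsto cauchy_kernel_continuous_closed assms)

lemma hardy2_inner_cauchy_kernel:
  fixes f :: "complex ^ 'n \<Rightarrow> complex"
  assumes f: "f \<in> hardy2" and w: "w \<in> polydisc"
  shows "hardy2_inner f (\<lambda>z. cauchy_kernel z w) = f w"
proof -
  have "hardy2_inner f (\<lambda>z. cauchy_kernel z w) = L2_inner torus_measure (boundary_value f) (\<lambda>z. cauchy_kernel z w)"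
    unfolding hardy2_inner_eq L2_inner_def
    by (intro Bochner_Integration.integral_cong refl) (simp add: boundary_value_cauchy_kernel[OF w])
  then show ?thesis using hardy2_cauchy_formula[OF f w] by simp
qed

section \<open>The model space of an inner function and its kernels\<close>

context
  fixes I :: "complex ^ 'n \<Rightarrow> complex"
  assumes inner: "inner_function I"
begin

lemma inner_holomorphic: "holomorphic_sv I polydisc"
  and inner_norm_less: "z \<in> polydisc \<Longrightarrow> norm (I z) < 1"
  using inner by (auto simp: inner_function_def)

lemma inner_hardy2: "I \<in> hardy2"
  by (rule hardy2_bounded[OF inner_holomorphic]) (rule less_imp_le[OF inner_norm_less])

lemma inner_mult_hardy2: "g \<in> hardy2 \<Longrightarrow> (\<lambda>z. I z * g z) \<in> hardy2"
  by (rule hardy2_mult_bounded[OF inner_holomorphic]) (rule less_imp_le[OF inner_norm_less])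

lemma inner_boundary_norm: "AE \<zeta> in torus_measure. norm (boundary_value I \<zeta>) = 1"
proof -
  have "AE \<zeta> in torus_measure. \<exists>l. ((\<lambda>r. I (r *\<^sub>R \<zeta>)) \<longlongrightarrow> l) (at_left 1) \<and> norm l = 1"
    using inner by (simp add: inner_function_def)
  then show ?thesis by eventually_elim (auto dest: boundary_value_eq)
qed

text \<open>Almost everywhere boundary values multiply and that of \<open>I\<close> has modulus 1,
  so it cancels against its conjugate.\<close>

lemma inner_mult_isometry:
  assumes f: "f \<in> hardy2" and g: "g \<in> hardy2"
  shows "hardy2_inner (\<lambda>z. I z * f z) (\<lambda>z. I z * g z) = hardy2_inner f g"
proof -
  have "AE \<zeta> in torus_measure. boundary_value (\<lambda>z. I z * f z) \<zeta> * cnj (boundary_value (\<lambda>z. I z * g z) \<zeta>) =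
      boundary_value f \<zeta> * cnj (boundary_value g \<zeta>)"
    using inner_boundary_norm radial_limit_set_AE[OF inner_hardy2] radial_limit_set_AE[OF f] radial_limit_set_AE[OF g]
  proof eventually_elim
    case (elim \<zeta>)
    have "boundary_value I \<zeta> * cnj (boundary_value I \<zeta>) = 1"
      using complex_norm_square[of "boundary_value I \<zeta>"] elim(1) by simp
    then show ?case
      using elim(2-4) by (simp add: boundary_value_mult mult_ac)
  qed
  moreover have "(\<lambda>\<zeta>. boundary_value u \<zeta> * cnj (boundary_value v \<zeta>)) \<in> borel_measurable torus_measure"
    if "u \<in> hardy2" "v \<in> hardy2" for u v :: "complex ^ 'n \<Rightarrow> complex"
    using that by (intro borel_measurable_times borel_measurable_cnj L2_measurable boundary_value_L2)
  ultimately show ?thesis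
    unfolding hardy2_inner_def using f g inner_mult_hardy2 by (intro integral_cong_AE) auto
qed

lemma model_kernel_eq:
  "model_kernel I w = (\<lambda>z. 1 * cauchy_kernel z w + (- cnj (I w)) * (I z * cauchy_kernel z w))"
  by (rule ext) (simp add: model_kernel_def algebra_simps)

lemma model_kernel_hardy2: "w \<in> polydisc \<Longrightarrow> model_kernel I w \<in> hardy2"
  unfolding model_kernel_eq by (intro hardy2_lincomb inner_mult_hardy2 cauchy_kernel_hardy2)

text \<open>The Cauchy kernel part evaluates at \<open>w\<close>. The correction vanishes on the
  model space, which gives the reproducing property; for a multiple of \<open>I\<close> it cancels
  the value at \<open>w\<close>, which puts the kernel into the model space.\<close>

lemma hardy2_inner_model_kernel:
  assumes f: "f \<in> hardy2" and w: "w \<in> polydisc"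
  shows "hardy2_inner f (model_kernel I w) = f w - I w * hardy2_inner f (\<lambda>z. I z * cauchy_kernel z w)"
proof -
  note k = cauchy_kernel_hardy2[OF w]
  have "hardy2_inner (model_kernel I w) f =
      hardy2_inner (\<lambda>z. cauchy_kernel z w) f - cnj (I w) * hardy2_inner (\<lambda>z. I z * cauchy_kernel z w) f"
    unfolding model_kernel_eq hardy2_inner_lincomb_left[OF k inner_mult_hardy2[OF k] f] by simp
  then have "cnj (hardy2_inner (model_kernel I w) f) =
      cnj (hardy2_inner (\<lambda>z. cauchy_kernel z w) f) - I w * cnj (hardy2_inner (\<lambda>z. I z * cauchy_kernel z w) f)"
    by simp
  then show ?thesis
    unfolding hardy2_inner_commute[of f, symmetric] hardy2_inner_cauchy_kernel[OF f w] .
qed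

lemma model_space_hardy2: "f \<in> model_space I \<Longrightarrow> f \<in> hardy2"
  by (simp add: model_space_def)

lemma model_kernel_in_model_space:
  assumes w: "w \<in> polydisc"
  shows "model_kernel I w \<in> model_space I"
proof -
  note k = cauchy_kernel_hardy2[OF w]
  have "hardy2_inner (model_kernel I w) (\<lambda>z. I z * g z) = 0" if g: "g \<in> hardy2" for g
  proof -
    have "hardy2_inner (\<lambda>z. I z * g z) (model_kernel I w) = 0"
      by (simp add: hardy2_inner_model_kernel[OF inner_mult_hardy2[OF g] w]
          inner_mult_isometry[OF g k] hardy2_inner_cauchy_kernel[OF g w])
    then show ?thesis by (simp add: hardy2_inner_commute[of "model_kernel I w"])
  qed
  then show ?thesis using model_kernel_hardy2[OF w] by (simp add: model_space_def)
qed

lemma model_space_reproducing: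
  assumes f: "f \<in> model_space I" and w: "w \<in> polydisc"
  shows "hardy2_inner f (model_kernel I w) = f w"
  using f cauchy_kernel_hardy2[OF w]
  by (simp add: hardy2_inner_model_kernel[OF model_space_hardy2[OF f] w] model_space_def)

lemma model_space_lincomb:
  assumes f: "f \<in> model_space I" and g: "g \<in> model_space I"
  shows "(\<lambda>z. a * f z + b * g z) \<in> model_space I"
proof -
  have "hardy2_inner (\<lambda>z. a * f z + b * g z) (\<lambda>z. I z * h z) = 0" if h: "h \<in> hardy2" for h
    using f g h
    by (simp add: hardy2_inner_lincomb_left[OF model_space_hardy2[OF f] model_space_hardy2[OF g] inner_mult_hardy2[OF h]] model_space_def)
  then show ?thesis
    using hardy2_lincomb[OF model_space_hardy2[OF f] model_space_hardy2[OF g]] by (simp add: model_space_def)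
qed

end

section \<open>Completeness of the model space\<close>

lemma norm_vector_scale: "norm (c *s (v :: complex ^ 'n)) = norm c * norm v"
  by (simp add: norm_vec_def L2_set_def norm_mult power_mult_distrib sum_distrib_left[symmetric]
      real_sqrt_mult)

text \<open>Cauchy's inequality on the complex line through \<open>z\<close> in direction
  \<open>h\<close>. Radius \<open>d / 2\<close> keeps the closed disc inside the open ball and
  accounts for the factor 2.\<close>

lemma holomorphic_sv_derivative_bound:
  fixes g :: "complex ^ 'n \<Rightarrow> complex"
  assumes g: "holomorphic_sv g (ball z d)" and D: "(g has_derivative D) (at z)" "\<And>c v. D (c *s v) = c * D v"
    and d: "0 < d" and M: "\<And>w. w \<in> ball z d \<Longrightarrow> norm (g w) \<le> M"
  shows "norm (D h) \<le> (2 * M / d) * norm h"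
proof (cases "h = 0")
  case True
  then show ?thesis using linear_0[OF has_derivative_linear[OF D(1)]] by simp
next
  case False
  define v where "v = of_real (1 / norm h) *s h"
  have v: "norm v = 1" using False by (simp add: v_def norm_vector_scale norm_divide)
  have h: "h = of_real (norm h) *s v" using False by (simp add: v_def vec_eq_iff)
  define \<phi> where "\<phi> u = g (z + u *s v)" for u
  have in_ball: "z + u *s v \<in> ball z d" if "norm u \<le> d / 2" for u
    using that d v by (simp add: dist_norm norm_vector_scale)
  have diff: "\<phi> field_differentiable at u" if "norm u \<le> d / 2" for u
    unfolding \<phi>_def by (rule holomorphic_sv_line[OF g in_ball[OF that]])
  have "norm ((deriv ^^ 1) \<phi> 0) \<le> fact 1 * M / (d / 2) ^ 1"
  proof (rule Cauchy_inequality)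
    show "\<phi> holomorphic_on ball 0 (d / 2)"
      unfolding holomorphic_on_def using diff by (auto intro: field_differentiable_at_within)
    show "continuous_on (cball 0 (d / 2)) \<phi>"
      using diff by (intro continuous_at_imp_continuous_on ballI field_differentiable_imp_continuous_at) auto
    show "0 < d / 2" using d by simp
    fix x :: complex assume "norm (0 - x) = d / 2"
    then show "norm (\<phi> x) \<le> M" unfolding \<phi>_def by (intro M in_ball) simp
  qed
  moreover have "deriv \<phi> 0 = D v"
  proof (rule DERIV_imp_deriv)
    have "((\<lambda>u. z + u *s v) has_derivative (\<lambda>h. h *s v)) (at 0)"
      using has_derivative_add[OF has_derivative_const bounded_linear_imp_has_derivative[OF bounded_linear_scale]]
      by fastforce
    moreover have "(g has_derivative D) (at (z + 0 *s v))" using D(1) by simp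
    ultimately have "(\<phi> has_derivative (\<lambda>h. D (h *s v))) (at 0)"
      unfolding \<phi>_def by (rule has_derivative_compose)
    moreover have "(\<lambda>h. D (h *s v)) = (*) (D v)"
      by (rule ext) (simp add: D(2) mult.commute)
    ultimately show "(\<phi> has_field_derivative D v) (at 0)"
      unfolding has_field_derivative_def by simp
  qed
  ultimately have "norm (D v) \<le> 2 * M / d" by (simp add: field_simps)
  then have "norm (D v) * norm h \<le> (2 * M / d) * norm h" by (intro mult_right_mono) auto
  moreover have "D h = D v * of_real (norm h)" using D(2)[of "of_real (norm h)" v] h by simp
  ultimately show ?thesis by (simp add: norm_mult)
qed

text \<open>Weierstrass: the derivative bound makes the derivatives uniformly Cauchy on the ball of
  half the radius, so the limit can be differentiated termwise, and complex linearity survives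
  pointwise limits.\<close>

lemma holomorphic_sv_limit:
  fixes f :: "nat \<Rightarrow> complex ^ 'n \<Rightarrow> complex"
  assumes f: "\<And>m. holomorphic_sv (f m) S"
    and lim: "\<And>z. z \<in> S \<Longrightarrow> (\<lambda>m. f m z) \<longlonglongrightarrow> F z"
    and unif: "\<And>z. z \<in> S \<Longrightarrow> \<exists>d>0. ball z d \<subseteq> S \<and>
      (\<forall>e>0. \<exists>N. \<forall>m\<ge>N. \<forall>l\<ge>N. \<forall>w\<in>ball z d. norm (f m w - f l w) \<le> e)"
  shows "holomorphic_sv F S"
  unfolding holomorphic_sv_def
proof (rule ballI)
  fix z0 assume z0: "z0 \<in> S"
  obtain d where d: "0 < d" "ball z0 d \<subseteq> S"
    and Cau: "\<And>e. 0 < e \<Longrightarrow> \<exists>N. \<forall>m\<ge>N. \<forall>l\<ge>N. \<forall>w\<in>ball z0 d. norm (f m w - f l w) \<le> e"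
    using unif[OF z0] by blast
  let ?B = "ball z0 (d / 2)"
  have sub: "ball z (d / 2) \<subseteq> ball z0 d" if "z \<in> ?B" for z
  proof
    fix w assume "w \<in> ball z (d / 2)"
    then show "w \<in> ball z0 d" using that dist_triangle[of z0 w z] by simp
  qed
  have z_in: "z \<in> S" if "z \<in> ?B" for z using that d by (auto intro: subsetD[OF d(2)])
  have "\<forall>m z. \<exists>D. z \<in> S \<longrightarrow> (f m has_derivative D) (at z) \<and> (\<forall>c v. D (c *s v) = c * D v)"
    using f by (auto simp: holomorphic_sv_def)
  then obtain D where D: "\<And>m z. z \<in> S \<Longrightarrow> (f m has_derivative D m z) (at z)"
    and Dc: "\<And>m z c v. z \<in> S \<Longrightarrow> D m z (c *s v) = c * D m z v"
    by metis
  have D_Cauchy: "\<exists>N. \<forall>m\<ge>N. \<forall>l\<ge>N. \<forall>z\<in>?B. \<forall>h. norm (D m z h - D l z h) \<le> e * norm h" if e: "0 < e" for e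
  proof -
    \<comment> \<open>The tolerance \<open>e * d / 4\<close> offsets the factor
      \<open>2 / (d / 2)\<close> of the derivative bound on balls of radius
      \<open>d / 2\<close>.\<close>
    have "0 < e * d / 4" using e d by simp
    then obtain N where N: "\<And>m l w. m \<ge> N \<Longrightarrow> l \<ge> N \<Longrightarrow> w \<in> ball z0 d \<Longrightarrow> norm (f m w - f l w) \<le> e * d / 4"
      using Cau by meson
    have "norm (D m z h - D l z h) \<le> e * norm h" if ml: "m \<ge> N" "l \<ge> N" and z: "z \<in> ?B" for m l z h
    proof -
      have "norm (D m z h - D l z h) \<le> (2 * (e * d / 4) / (d / 2)) * norm h"
      proof (rule holomorphic_sv_derivative_bound[where D = "\<lambda>h. D m z h - D l z h" and g = "\<lambda>w. f m w - f l w"])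
        show "holomorphic_sv (\<lambda>w. f m w - f l w) (ball z (d / 2))"
          by (rule holomorphic_sv_subset[OF holomorphic_sv_diff[OF f f]]) (use sub[OF z] d in blast)
        show "((\<lambda>w. f m w - f l w) has_derivative (\<lambda>h. D m z h - D l z h)) (at z)"
          by (intro has_derivative_diff D z_in z)
        show "D m z (c *s v) - D l z (c *s v) = c * (D m z v - D l z v)" for c v
          by (simp add: Dc[OF z_in[OF z]] right_diff_distrib)
        show "norm (f m w - f l w) \<le> e * d / 4" if "w \<in> ball z (d / 2)" for w
          using sub[OF z] that by (intro N ml) auto
      qed (use d in simp)
      then show ?thesis using d by simp
    qed
    then show ?thesis by blast
  qed
  have D_conv: "convergent (\<lambda>m. D m z h)" if z: "z \<in> ?B" for z h
  proof -
    have "Cauchy (\<lambda>m. D m z h)"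
    proof (rule metric_CauchyI)
      fix e :: real assume e: "0 < e"
      have "0 < e / (norm h + 1)" using e by (simp add: add_nonneg_pos)
      from D_Cauchy[OF this] obtain N where
        N: "\<And>m l. m \<ge> N \<Longrightarrow> l \<ge> N \<Longrightarrow> norm (D m z h - D l z h) \<le> e / (norm h + 1) * norm h"
        using z by blast
      have "e / (norm h + 1) * norm h < e"
        using e by (simp add: divide_simps add_nonneg_pos)
      then show "\<exists>M. \<forall>m\<ge>M. \<forall>n\<ge>M. dist (D m z h) (D n z h) < e"
        unfolding dist_norm using N le_less_trans by blast
    qed
    then show ?thesis by (simp add: Cauchy_convergent_iff)
  qed
  define E where "E z h = lim (\<lambda>m. D m z h)" for z h
  have E: "(\<lambda>m. D m z h) \<longlonglongrightarrow> E z h" if "z \<in> ?B" for z h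
    unfolding E_def using D_conv[OF that] by (simp add: convergent_LIMSEQ_iff)
  have "\<exists>g. \<forall>x\<in>?B. (\<lambda>m. f m x) \<longlonglongrightarrow> g x \<and> (g has_derivative E x) (at x within ?B)"
  proof (rule has_derivative_sequence)
    show "convex ?B" by simp
    show "z0 \<in> ?B" using d by simp
    show "(\<lambda>m. f m z0) \<longlonglongrightarrow> F z0" by (rule lim[OF z0])
    show "(f m has_derivative D m x) (at x within ?B)" if "x \<in> ?B" for m x
      by (rule has_derivative_at_withinI[OF D[OF z_in[OF that]]])
    fix e :: real assume e: "0 < e"
    obtain N where N: "\<And>m l z h. m \<ge> N \<Longrightarrow> l \<ge> N \<Longrightarrow> z \<in> ?B \<Longrightarrow> norm (D m z h - D l z h) \<le> e * norm h"
      using D_Cauchy[OF e] by blast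
    have "norm (D m x h - E x h) \<le> e * norm h" if "m \<ge> N" "x \<in> ?B" for m x h
    proof (rule LIMSEQ_le_const2)
      show "(\<lambda>l. norm (D m x h - D l x h)) \<longlonglongrightarrow> norm (D m x h - E x h)"
        by (intro tendsto_intros E that)
      show "\<exists>N. \<forall>l\<ge>N. norm (D m x h - D l x h) \<le> e * norm h" using N that by blast
    qed
    then show "\<forall>\<^sub>F m in sequentially. \<forall>x\<in>?B. \<forall>h. norm (D m x h - E x h) \<le> e * norm h"
      unfolding eventually_sequentially by blast
  qed
  then obtain g where g: "\<And>x. x \<in> ?B \<Longrightarrow> (\<lambda>m. f m x) \<longlonglongrightarrow> g x"
    and g': "\<And>x. x \<in> ?B \<Longrightarrow> (g has_derivative E x) (at x within ?B)" by blast
  have z0B: "z0 \<in> ?B" using d by simp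
  have "g x = F x" if "x \<in> ?B" for x
    using LIMSEQ_unique[OF g[OF that] lim[OF z_in[OF that]]] .
  moreover have "(g has_derivative E z0) (at z0)"
    using g'[OF z0B] z0B by (simp add: at_within_open[OF z0B open_ball])
  ultimately have "(F has_derivative E z0) (at z0)"
    using z0B by (intro has_derivative_transform_within_open[of g "E z0" z0 UNIV ?B F, simplified]) auto
  moreover have "E z0 (c *s v) = c * E z0 v" for c v
  proof (rule LIMSEQ_unique[OF E[OF z0B]])
    show "(\<lambda>m. D m z0 (c *s v)) \<longlonglongrightarrow> c * E z0 v"
      unfolding Dc[OF z0] by (intro tendsto_intros E z0B)
  qed
  ultimately show "\<exists>D. (F has_derivative D) (at z0) \<and> (\<forall>c v. D (c *s v) = c * D v)" by blast
qed

section \<open>Point evaluations and completeness\<close>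

lemma cauchy_kernel_norm_bound:
  fixes z w :: "complex ^ 'n"
  assumes z: "z \<in> closed_polydisc" and w: "\<And>j. norm (w $ j) \<le> \<rho>" and \<rho>: "\<rho> < 1"
  shows "norm (cauchy_kernel z w) \<le> (1 / (1 - \<rho>)) ^ CARD('n)"
proof -
  have "norm (cauchy_kernel z w) = (\<Prod>j\<in>(UNIV :: 'n set). norm (1 / (1 - z $ j * cnj (w $ j))))"
    unfolding cauchy_kernel_def by (rule prod_norm[symmetric])
  also have "\<dots> \<le> (\<Prod>j\<in>(UNIV :: 'n set). 1 / (1 - \<rho>))"
  proof (rule prod_mono)
    fix j
    have "norm (z $ j) * norm (w $ j) \<le> 1 * \<rho>"
      using z w[of j] by (intro mult_mono) (auto simp: closed_polydisc_def)
    then have "1 - \<rho> \<le> norm (1 - z $ j * cnj (w $ j))"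
      using norm_triangle_ineq2[of 1 "z $ j * cnj (w $ j)"] by (simp add: norm_mult)
    then show "0 \<le> norm (1 / (1 - z $ j * cnj (w $ j))) \<and> norm (1 / (1 - z $ j * cnj (w $ j))) \<le> 1 / (1 - \<rho>)"
      using \<rho> by (simp add: norm_divide frac_le)
  qed
  finally show ?thesis by simp
qed

text \<open>Evaluation at \<open>w\<close> is pairing with the Cauchy kernel, which is bounded on
  the torus uniformly for \<open>w\<close> in a smaller polydisc. Hence convergence in norm is
  locally uniform.\<close>

lemma hardy2_pointwise_bound:
  fixes f :: "complex ^ 'n \<Rightarrow> complex"
  assumes f: "f \<in> hardy2" and w: "\<And>j. norm (w $ j) \<le> \<rho>" and \<rho>: "\<rho> < 1"
  shows "norm (f w) \<le> hardy2_norm f * (1 / (1 - \<rho>)) ^ CARD('n)"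
proof -
  let ?C = "(1 / (1 - \<rho>)) ^ CARD('n)"
  let ?k = "\<lambda>z. cauchy_kernel z w"
  have wp: "w \<in> polydisc" using w \<rho> le_less_trans unfolding polydisc_def by blast
  have k: "?k \<in> L2 torus_measure"
    by (rule cauchy_kernel_L2[OF torus.finite_measure_axioms sets_torus_measure wp])
  have "(L2_norm torus_measure ?k)\<^sup>2 \<le> (\<integral>\<zeta>. ?C\<^sup>2 \<partial>(torus_measure :: (complex ^ 'n) measure))"
    unfolding L2_norm_square
  proof (rule integral_mono[OF L2_integrable_square[OF k]])
    fix \<zeta> :: "complex ^ 'n" assume "\<zeta> \<in> space torus_measure"
    then have "\<zeta> \<in> closed_polydisc" using torus_subset_closed_polydisc by auto
    then show "(norm (?k \<zeta>))\<^sup>2 \<le> ?C\<^sup>2"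
      by (intro power_mono cauchy_kernel_norm_bound w \<rho>) auto
  qed simp
  then have "(L2_norm torus_measure ?k)\<^sup>2 \<le> ?C\<^sup>2" by simp
  then have kC: "L2_norm torus_measure ?k \<le> ?C" by (rule power2_le_imp_le) (use \<rho> in simp)
  have "norm (f w) = norm (L2_inner torus_measure (boundary_value f) ?k)"
    by (simp add: hardy2_cauchy_formula[OF f wp])
  also have "\<dots> \<le> hardy2_norm f * L2_norm torus_measure ?k"
    unfolding hardy2_norm_eq by (intro L2_Cauchy_Schwarz boundary_value_L2 f k)
  also have "\<dots> \<le> hardy2_norm f * ?C"
    using kC by (intro mult_left_mono) (simp_all add: hardy2_norm_eq)
  finally show ?thesis .
qed

text \<open>The largest of the finitely many moduli leaves a gap \<open>1 - m\<close>; half of it is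
  the radius, since the Euclidean distance bounds the change of each coordinate.\<close>

lemma polydisc_neighbourhood:
  fixes z :: "complex ^ 'n"
  assumes z: "z \<in> polydisc"
  obtains d \<rho> where "0 < d" "\<rho> < 1" "\<And>w j. w \<in> ball z d \<Longrightarrow> norm (w $ j) \<le> \<rho>"
proof -
  define m where "m = Max (range (\<lambda>j. norm (z $ j)))"
  have m: "norm (z $ j) \<le> m" for j unfolding m_def by (intro Max_ge) auto
  have "m \<in> range (\<lambda>j. norm (z $ j))" unfolding m_def by (intro Max_in) auto
  then have m1: "m < 1" using z by (auto simp: polydisc_def)
  show thesis
  proof (rule that[of "(1 - m) / 2" "(1 + m) / 2"])
    fix w j assume w: "w \<in> ball z ((1 - m) / 2)"
    have "norm (w $ j) \<le> norm (z $ j) + norm ((w - z) $ j)"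
      using norm_triangle_ineq[of "z $ j" "(w - z) $ j"] by simp
    also have "norm ((w - z) $ j) \<le> norm (w - z)" by (rule Finite_Cartesian_Product.norm_nth_le)
    finally show "norm (w $ j) \<le> (1 + m) / 2" using w m[of j] by (simp add: dist_norm norm_minus_commute field_simps)
  qed (use m1 in auto)
qed

text \<open>The limit is built inside the polydisc from locally uniform convergence, so holomorphy
  comes first and no L2 function has to be extended inwards from the torus.\<close>

lemma hardy2_complete:
  fixes f :: "nat \<Rightarrow> complex ^ 'n \<Rightarrow> complex"
  assumes f: "\<And>m. f m \<in> hardy2"
    and Cau: "\<And>e. 0 < e \<Longrightarrow> \<exists>N. \<forall>m\<ge>N. \<forall>l\<ge>N. hardy2_norm (\<lambda>z. f m z - f l z) < e"
  obtains F where "F \<in> hardy2" "(\<lambda>m. hardy2_norm (\<lambda>z. F z - f m z)) \<longlonglongrightarrow> 0"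
proof -
  have diff: "(\<lambda>z. f m z - f l z) \<in> hardy2" for m l by (intro hardy2_diff f)
  have unif: "\<exists>N. \<forall>m\<ge>N. \<forall>l\<ge>N. \<forall>w. (\<forall>j. norm (w $ j) \<le> \<rho>) \<longrightarrow> norm (f m w - f l w) < e"
    if \<rho>: "\<rho> < 1" and e: "0 < e" for \<rho> e
  proof -
    let ?C = "(1 / (1 - \<rho>)) ^ CARD('n)"
    have C: "0 < ?C" using \<rho> by simp
    then obtain N where N: "\<And>m l. m \<ge> N \<Longrightarrow> l \<ge> N \<Longrightarrow> hardy2_norm (\<lambda>z. f m z - f l z) < e / ?C"
      using Cau[of "e / ?C"] e by (metis divide_pos_pos)
    have "norm (f m w - f l w) < e" if "m \<ge> N" "l \<ge> N" "\<And>j. norm (w $ j) \<le> \<rho>" for m l w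
    proof -
      have "norm (f m w - f l w) \<le> hardy2_norm (\<lambda>z. f m z - f l z) * ?C"
        by (rule hardy2_pointwise_bound[OF diff that(3) \<rho>])
      also have "\<dots> < e / ?C * ?C" using N[OF that(1,2)] C by (intro mult_strict_right_mono)
      also have "\<dots> = e" using less_imp_neq[OF C] by simp
      finally show ?thesis .
    qed
    then show ?thesis by blast
  qed
  define F where "F z = lim (\<lambda>m. f m z)" for z
  have lim: "(\<lambda>m. f m z) \<longlonglongrightarrow> F z" if z: "z \<in> polydisc" for z
  proof -
    obtain d \<rho> where d: "0 < d" "\<rho> < 1" "\<And>w j. w \<in> ball z d \<Longrightarrow> norm (w $ j) \<le> \<rho>"
      using polydisc_neighbourhood[OF z] by blast
    have zj: "\<forall>j. norm (z $ j) \<le> \<rho>" using d(3)[of z] d(1) by simp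
    have "Cauchy (\<lambda>m. f m z)"
    proof (rule metric_CauchyI)
      fix e :: real assume "0 < e"
      from unif[OF d(2) this] show "\<exists>M. \<forall>m\<ge>M. \<forall>n\<ge>M. dist (f m z) (f n z) < e"
        unfolding dist_norm using zj by blast
    qed
    then show ?thesis unfolding F_def by (simp add: Cauchy_convergent_iff convergent_LIMSEQ_iff)
  qed
  have F_hol: "holomorphic_sv F polydisc"
  proof (rule holomorphic_sv_limit[OF hardy2_holomorphic[OF f] lim])
    fix z :: "complex ^ 'n" assume z: "z \<in> polydisc"
    obtain d \<rho> where d: "0 < d" "\<rho> < 1" "\<And>w j. w \<in> ball z d \<Longrightarrow> norm (w $ j) \<le> \<rho>"
      using polydisc_neighbourhood[OF z] by blast
    have "ball z d \<subseteq> polydisc"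
      unfolding polydisc_def using d(2,3) le_less_trans by blast
    moreover have "\<exists>N. \<forall>m\<ge>N. \<forall>l\<ge>N. \<forall>w\<in>ball z d. norm (f m w - f l w) \<le> e" if "0 < e" for e
      using unif[OF d(2) that] d(3) less_imp_le by meson
    ultimately show "\<exists>d>0. ball z d \<subseteq> polydisc \<and>
        (\<forall>e>0. \<exists>N. \<forall>m\<ge>N. \<forall>l\<ge>N. \<forall>w\<in>ball z d. norm (f m w - f l w) \<le> e)"
      using d(1) by blast
  qed
  have close: "(\<lambda>z. F z - f m z) \<in> hardy2 \<and> hardy2_norm (\<lambda>z. F z - f m z) \<le> e"
    if N: "\<And>l. l \<ge> N \<Longrightarrow> hardy2_norm (\<lambda>z. f l z - f m z) < e" and e: "0 < e" for m N e
  proof -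
    \<comment> \<open>At each radius \<open>f l\<close> converges pointwise on the torus, so Fatou
      passes the bound on \<open>f l - f m\<close> to \<open>F - f m\<close>, uniformly in the
      radius.\<close>
    have ms: "mean_square (\<lambda>z. F z - f m z) r \<le> e\<^sup>2" if r: "0 < r" "r < 1" for r
      unfolding mean_square_def
    proof (rule power_mono[OF L2_Fatou(2)[where f = "\<lambda>l \<zeta>. f l (r *\<^sub>R \<zeta>) - f m (r *\<^sub>R \<zeta>)"]])
      have d: "(\<lambda>\<zeta>. f l (r *\<^sub>R \<zeta>) - f m (r *\<^sub>R \<zeta>)) \<in> L2 torus_measure" for l
        using r by (intro L2_diff dilation_L2 hardy2_holomorphic f) auto
      then show "(\<lambda>\<zeta>. f l (r *\<^sub>R \<zeta>) - f m (r *\<^sub>R \<zeta>)) \<in> borel_measurable torus_measure" for l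
        by (rule L2_measurable)
      show "(\<lambda>\<zeta>. F (r *\<^sub>R \<zeta>) - f m (r *\<^sub>R \<zeta>)) \<in> borel_measurable torus_measure"
        using r by (intro L2_measurable L2_diff dilation_L2 hardy2_holomorphic f F_hol) auto
      show "AE \<zeta> in torus_measure. (\<lambda>l. f l (r *\<^sub>R \<zeta>) - f m (r *\<^sub>R \<zeta>)) \<longlonglongrightarrow> F (r *\<^sub>R \<zeta>) - f m (r *\<^sub>R \<zeta>)"
        using r by (intro AE_I2 tendsto_diff lim tendsto_const scaleR_torus_in_polydisc) auto
      have "L2_norm torus_measure (\<lambda>\<zeta>. f l (r *\<^sub>R \<zeta>) - f m (r *\<^sub>R \<zeta>)) \<le> e" if "l \<ge> N" for l
      proof (rule power2_le_imp_le)
        have "(L2_norm torus_measure (\<lambda>\<zeta>. f l (r *\<^sub>R \<zeta>) - f m (r *\<^sub>R \<zeta>)))\<^sup>2 \<le> (hardy2_norm (\<lambda>z. f l z - f m z))\<^sup>2"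
          using mean_square_le_hardy2_norm[OF diff r] by (simp add: mean_square_def)
        also have "\<dots> \<le> e\<^sup>2" using N[OF that] by (intro power_mono) (simp_all add: hardy2_norm_eq)
        finally show "(L2_norm torus_measure (\<lambda>\<zeta>. f l (r *\<^sub>R \<zeta>) - f m (r *\<^sub>R \<zeta>)))\<^sup>2 \<le> e\<^sup>2" .
      qed (use e in simp)
      then show "\<forall>\<^sub>F l in sequentially. (\<lambda>\<zeta>. f l (r *\<^sub>R \<zeta>) - f m (r *\<^sub>R \<zeta>)) \<in> L2 torus_measure \<and>
          L2_norm torus_measure (\<lambda>\<zeta>. f l (r *\<^sub>R \<zeta>) - f m (r *\<^sub>R \<zeta>)) \<le> e"
        using d by (auto simp: eventually_sequentially)
    qed simp
    have h: "(\<lambda>z. F z - f m z) \<in> hardy2"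
      by (rule hardy2I[OF holomorphic_sv_diff[OF F_hol hardy2_holomorphic[OF f]] ms])
    show ?thesis using h hardy2_norm_le[OF h ms] e by simp
  qed
  have ev: "\<exists>N. \<forall>m\<ge>N. (\<lambda>z. F z - f m z) \<in> hardy2 \<and> hardy2_norm (\<lambda>z. F z - f m z) \<le> e" if e: "0 < e" for e
  proof -
    obtain N where N: "\<And>m l. m \<ge> N \<Longrightarrow> l \<ge> N \<Longrightarrow> hardy2_norm (\<lambda>z. f m z - f l z) < e"
      using Cau[OF e] by blast
    have "(\<lambda>z. F z - f m z) \<in> hardy2 \<and> hardy2_norm (\<lambda>z. F z - f m z) \<le> e" if "m \<ge> N" for m
      by (rule close[OF N[OF _ that] e])
    then show ?thesis by blast
  qed
  obtain m where "(\<lambda>z. F z - f m z) \<in> hardy2" using ev[of 1] by auto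
  then have "F \<in> hardy2" using hardy2_lincomb[of "\<lambda>z. F z - f m z" "f m" 1 1] f by simp
  moreover have "(\<lambda>m. hardy2_norm (\<lambda>z. F z - f m z)) \<longlonglongrightarrow> 0"
  proof (rule LIMSEQ_I)
    fix e :: real assume e: "0 < e"
    then obtain N where N: "\<And>m. m \<ge> N \<Longrightarrow> hardy2_norm (\<lambda>z. F z - f m z) \<le> e / 2"
      using ev[of "e / 2"] by auto
    have "norm (hardy2_norm (\<lambda>z. F z - f m z) - 0) < e" if "m \<ge> N" for m
      using N[OF that] e by (simp add: hardy2_norm_eq)
    then show "\<exists>N. \<forall>m\<ge>N. norm (hardy2_norm (\<lambda>z. F z - f m z) - 0) < e" by blast
  qed
  ultimately show thesis by (rule that)
qed

lemma hardy2_inner_tendsto: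
  fixes F g :: "complex ^ 'n \<Rightarrow> complex"
  assumes F: "F \<in> hardy2" and f: "\<And>m. f m \<in> hardy2" and g: "g \<in> hardy2"
    and lim: "(\<lambda>m. hardy2_norm (\<lambda>z. F z - f m z)) \<longlonglongrightarrow> 0"
  shows "(\<lambda>m. hardy2_inner (f m) g) \<longlonglongrightarrow> hardy2_inner F g"
  unfolding hardy2_inner_eq
proof (rule L2_inner_tendsto)
  have "hardy2_norm (\<lambda>z. F z - f m z) = L2_norm torus_measure (\<lambda>\<zeta>. boundary_value F \<zeta> - boundary_value (f m) \<zeta>)" for m
    using hardy2_norm_lincomb[OF F f[of m], of 1 "-1"] by simp
  then show "(\<lambda>m. L2_norm torus_measure (\<lambda>\<zeta>. boundary_value F \<zeta> - boundary_value (f m) \<zeta>)) \<longlonglongrightarrow> 0"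
    using lim by simp
qed (intro boundary_value_L2 F f g)+

lemma model_space_complete:
  fixes f :: "nat \<Rightarrow> complex ^ 'n \<Rightarrow> complex"
  assumes I: "inner_function I" and f: "\<And>m. f m \<in> model_space I"
    and Cau: "\<And>e. 0 < e \<Longrightarrow> \<exists>N. \<forall>m\<ge>N. \<forall>l\<ge>N. hardy2_norm (\<lambda>z. f m z - f l z) < e"
  obtains F where "F \<in> model_space I" "(\<lambda>m. hardy2_norm (\<lambda>z. F z - f m z)) \<longlonglongrightarrow> 0"
proof -
  have fh: "f m \<in> hardy2" for m by (rule model_space_hardy2[OF I f])
  obtain F where F: "F \<in> hardy2" and lim: "(\<lambda>m. hardy2_norm (\<lambda>z. F z - f m z)) \<longlonglongrightarrow> 0"
    using hardy2_complete[OF fh Cau] by blast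
  have "hardy2_inner F (\<lambda>z. I z * g z) = 0" if g: "g \<in> hardy2" for g
  proof -
    have "(\<lambda>m. hardy2_inner (f m) (\<lambda>z. I z * g z)) \<longlonglongrightarrow> hardy2_inner F (\<lambda>z. I z * g z)"
      by (rule hardy2_inner_tendsto[OF F fh inner_mult_hardy2[OF I g] lim])
    moreover have "hardy2_inner (f m) (\<lambda>z. I z * g z) = 0" for m
      using f[of m] g by (simp add: model_space_def)
    ultimately show ?thesis using LIMSEQ_unique[OF tendsto_const] by fastforce
  qed
  then have "F \<in> model_space I" using F by (simp add: model_space_def)
  then show thesis using lim by (rule that)
qed

section \<open>The Clark operator\<close>

lemma cauchy_transform_eq_L2_inner:
  "cauchy_transform \<sigma> h w = L2_inner \<sigma> h (\<lambda>z. cauchy_kernel z w)"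
  by (simp add: cauchy_transform_def L2_inner_def cauchy_kernel_cnj mult.commute)

lemma polydisc_algebra_L2:
  assumes "finite_measure \<sigma>" "sets \<sigma> = sets torus_borel" "v \<in> polydisc_algebra"
  shows "v \<in> L2 \<sigma>"
  by (rule continuous_on_torus_L2[OF assms(1,2) continuous_on_subset[OF _ torus_subset_closed_polydisc]])
    (use assms(3) in \<open>simp add: polydisc_algebra_def\<close>)

lemma cauchy_kernel_polydisc_algebra:
  assumes "w \<in> polydisc"
  shows "(\<lambda>z. cauchy_kernel z w) \<in> polydisc_algebra"
  unfolding polydisc_algebra_def
  using cauchy_kernel_continuous_closed[OF assms]
    holomorphic_sv_subset[OF holomorphic_cauchy_kernel[OF assms] polydisc_subset_closed_polydisc]
  by simp

lemma polydisc_algebra_lincomb: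
  assumes "u \<in> polydisc_algebra" "v \<in> polydisc_algebra"
  shows "(\<lambda>z. a * u z + b * v z) \<in> polydisc_algebra"
  using assms unfolding polydisc_algebra_def
  by (auto intro!: holomorphic_sv_lincomb continuous_intros)

lemma cauchy_kernel_scaleR: "cauchy_kernel (r *\<^sub>R z) w = cauchy_kernel z (r *\<^sub>R w)"
  by (simp add: cauchy_kernel_def)

text \<open>For \<open>v\<close> in the algebra, the dilate of \<open>v\<close> by \<open>r\<^sup>2\<close> is a superposition of the kernels
  \<open>cauchy_kernel _ (r *\<^sub>R \<zeta>)\<close> with weights \<open>v (r *\<^sub>R \<zeta>)\<close>.\<close>

lemma cauchy_transform_zero_orthogonal:
  fixes \<sigma> :: "(complex ^ 'n) measure"
  assumes fin: "finite_measure \<sigma>" and sets: "sets \<sigma> = sets torus_borel" and h: "h \<in> L2 \<sigma>"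
    and zero: "\<And>w. w \<in> polydisc \<Longrightarrow> cauchy_transform \<sigma> h w = 0" and v: "v \<in> polydisc_algebra"
  shows "L2_inner \<sigma> h v = 0"
proof -
  interpret \<sigma>: finite_measure \<sigma> by fact
  have space: "space \<sigma> = torus"
    using sets_eq_imp_space_eq[OF sets] by (simp add: space_restrict_space)
  have meas_eq: "borel_measurable \<sigma> = borel_measurable torus_borel"
    by (rule measurable_cong_sets[OF sets refl])
  have vc: "continuous_on closed_polydisc v" and vh: "holomorphic_sv v polydisc"
    using v by (auto simp: polydisc_algebra_def)
  have hm: "h \<in> borel_measurable \<sigma>" and hi: "integrable \<sigma> h"
    using h by (auto intro: L2_measurable \<sigma>.L2_integrable)
  have dil: "L2_inner \<sigma> h (\<lambda>\<zeta>. v ((r * r) *\<^sub>R \<zeta>)) = 0" if r: "0 \<le> r" "r < 1" for r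
  proof -
    let ?k = "\<lambda>\<xi> \<zeta>. h \<xi> * cnj (cauchy_kernel (r *\<^sub>R \<xi>) \<zeta> * v (r *\<^sub>R \<zeta>))"
    have "holomorphic_sv (\<lambda>z. v (r *\<^sub>R z)) closed_polydisc"
      using vh r scaleR_closed_polydisc_in_polydisc by (intro holomorphic_sv_dilation) blast+
    \<comment> \<open>The origin of \<open>r * r\<close>: one factor makes the dilate of
      \<open>v\<close> holomorphic across the closed polydisc, the other makes the point of
      evaluation interior.\<close>
    from cauchy_formula[OF this scaleR_torus_in_polydisc[OF _ r]]
    have rep: "v ((r * r) *\<^sub>R \<xi>) = (\<integral>\<zeta>. cauchy_kernel (r *\<^sub>R \<xi>) \<zeta> * v (r *\<^sub>R \<zeta>) \<partial>torus_measure)"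
      if "\<xi> \<in> torus" for \<xi> using that by simp
    obtain B where B: "\<And>\<zeta>. \<zeta> \<in> torus \<Longrightarrow> norm (v (r *\<^sub>R \<zeta>)) \<le> B"
      using dilation_bounded[OF vh r] by blast
    let ?C = "(1 / (1 - r)) ^ CARD('n)"
    have kb: "norm (cauchy_kernel (r *\<^sub>R \<xi>) \<zeta> * v (r *\<^sub>R \<zeta>)) \<le> ?C * B" if "\<xi> \<in> torus" "\<zeta> \<in> torus" for \<xi> \<zeta>
    proof -
      have "norm (cauchy_kernel \<xi> (r *\<^sub>R \<zeta>)) \<le> ?C"
        using that torus_subset_closed_polydisc r
        by (intro cauchy_kernel_norm_bound) (auto simp: torus_def)
      then show ?thesis
        unfolding norm_mult cauchy_kernel_scaleR using B[OF that(2)] r by (intro mult_mono) auto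
    qed
    have zint: "integrable torus_measure (\<lambda>\<zeta>. ?k \<xi> \<zeta>)" if \<xi>: "\<xi> \<in> torus" for \<xi>
    proof (rule integrable_mult_right[OF Bochner_Integration.integrable_cnj])
      have "(\<lambda>\<zeta>. cauchy_kernel (r *\<^sub>R \<xi>) \<zeta> * v (r *\<^sub>R \<zeta>)) \<in> borel_measurable torus_measure"
        unfolding borel_measurable_torus_measure
        by (intro borel_measurable_times cauchy_kernel_measurable borel_measurable_const
            measurable_torus_borel_ident continuous_on_torus_measurable dilation_continuous_torus vh r)
      then show "integrable torus_measure (\<lambda>\<zeta>. cauchy_kernel (r *\<^sub>R \<xi>) \<zeta> * v (r *\<^sub>R \<zeta>))"
        using kb[OF \<xi>] by (intro torus.integrable_const_bound[of _ "?C * B"] AE_I2) auto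
    qed
    interpret pair_sigma_finite \<sigma> "torus_measure :: (complex ^ 'n) measure" ..
    have km: "(\<lambda>(\<xi>, \<zeta>). ?k \<xi> \<zeta>) \<in> borel_measurable (\<sigma> \<Otimes>\<^sub>M torus_measure)"
    proof -
      have idm: "(\<lambda>\<zeta>. \<zeta>) \<in> borel_measurable \<sigma>" "(\<lambda>\<zeta>. \<zeta>) \<in> borel_measurable torus_measure"
        using measurable_torus_borel_ident by (simp_all add: meas_eq)
      have vm: "(\<lambda>\<zeta>. v (r *\<^sub>R \<zeta>)) \<in> borel_measurable torus_measure"
        unfolding borel_measurable_torus_measure
        by (intro continuous_on_torus_measurable dilation_continuous_torus vh r)
      have "(\<lambda>p. fst p) \<in> borel_measurable (\<sigma> \<Otimes>\<^sub>M torus_measure)"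
        "(\<lambda>p. snd p) \<in> borel_measurable (\<sigma> \<Otimes>\<^sub>M torus_measure)"
        by (rule measurable_compose[OF measurable_fst idm(1)], rule measurable_compose[OF measurable_snd idm(2)])
      then have "(\<lambda>p. cauchy_kernel (r *\<^sub>R fst p) (snd p)) \<in> borel_measurable (\<sigma> \<Otimes>\<^sub>M torus_measure)"
        by (intro cauchy_kernel_measurable borel_measurable_scaleR borel_measurable_const)
      moreover have "(\<lambda>p. v (r *\<^sub>R snd p)) \<in> borel_measurable (\<sigma> \<Otimes>\<^sub>M torus_measure)"
        by (rule measurable_compose[OF measurable_snd vm])
      moreover have "(\<lambda>p. h (fst p)) \<in> borel_measurable (\<sigma> \<Otimes>\<^sub>M torus_measure)"
        by (rule measurable_compose[OF measurable_fst hm])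
      ultimately show ?thesis
        unfolding case_prod_beta' by (intro borel_measurable_times borel_measurable_cnj)
    qed
    \<comment> \<open>\<open>h\<close> is merely square integrable, so joint integrability is
      derived from iterated absolute integrals: the inner one is at most a constant times
      \<open>norm (h \<xi>)\<close>.\<close>
    have kint: "integrable (\<sigma> \<Otimes>\<^sub>M torus_measure) (\<lambda>(\<xi>, \<zeta>). ?k \<xi> \<zeta>)"
    proof (rule Fubini_integrable[OF km])
      have inner: "norm (\<integral>\<zeta>. norm (?k \<xi> \<zeta>) \<partial>torus_measure) \<le> norm (h \<xi>) * (?C * B)" if \<xi>: "\<xi> \<in> torus" for \<xi>
      proof -
        have "(\<integral>\<zeta>. norm (?k \<xi> \<zeta>) \<partial>torus_measure) \<le> (\<integral>\<zeta>. norm (h \<xi>) * (?C * B) \<partial>(torus_measure :: (complex ^ 'n) measure))"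
        proof (rule integral_mono[OF integrable_norm[OF zint[OF \<xi>]]])
          fix \<zeta> :: "complex ^ 'n" assume "\<zeta> \<in> space torus_measure"
          then show "norm (?k \<xi> \<zeta>) \<le> norm (h \<xi>) * (?C * B)"
            using kb[OF \<xi>, of \<zeta>] unfolding norm_mult[of "h \<xi>"] complex_mod_cnj
            by (intro mult_left_mono) auto
        qed simp
        moreover have "0 \<le> (\<integral>\<zeta>. norm (?k \<xi> \<zeta>) \<partial>torus_measure)" by simp
        ultimately show ?thesis by simp
      qed
      show "integrable \<sigma> (\<lambda>\<xi>. \<integral>\<zeta>. norm (case (\<xi>, \<zeta>) of (\<xi>, \<zeta>) \<Rightarrow> ?k \<xi> \<zeta>) \<partial>torus_measure)"
      proof (rule Bochner_Integration.integrable_bound)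
        show "integrable \<sigma> (\<lambda>\<xi>. norm (h \<xi>) * (?C * B))" using hi by simp
        have "(\<lambda>(\<xi>, \<zeta>). norm (?k \<xi> \<zeta>)) \<in> borel_measurable (\<sigma> \<Otimes>\<^sub>M torus_measure)"
          using measurable_compose[OF km borel_measurable_norm] by (simp add: case_prod_beta')
        then show "(\<lambda>\<xi>. \<integral>\<zeta>. norm (case (\<xi>, \<zeta>) of (\<xi>, \<zeta>) \<Rightarrow> ?k \<xi> \<zeta>) \<partial>torus_measure) \<in> borel_measurable \<sigma>"
          unfolding case_prod_conv by (rule torus.borel_measurable_lebesgue_integral)
        show "AE \<xi> in \<sigma>. norm (\<integral>\<zeta>. norm (case (\<xi>, \<zeta>) of (\<xi>, \<zeta>) \<Rightarrow> ?k \<xi> \<zeta>) \<partial>torus_measure) \<le> norm (norm (h \<xi>) * (?C * B))"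
        proof (rule AE_I2)
          fix \<xi> assume "\<xi> \<in> space \<sigma>"
          then have "\<xi> \<in> torus" by (simp add: space)
          from inner[OF this]
          show "norm (\<integral>\<zeta>. norm (case (\<xi>, \<zeta>) of (\<xi>, \<zeta>) \<Rightarrow> ?k \<xi> \<zeta>) \<partial>torus_measure) \<le> norm (norm (h \<xi>) * (?C * B))"
            unfolding case_prod_conv real_norm_def[of "norm (h \<xi>) * (?C * B)"] by linarith
        qed
      qed
      show "AE \<xi> in \<sigma>. integrable torus_measure (\<lambda>\<zeta>. case (\<xi>, \<zeta>) of (\<xi>, \<zeta>) \<Rightarrow> ?k \<xi> \<zeta>)"
        unfolding case_prod_conv by (intro AE_I2 zint) (simp add: space)
    qed
    have "L2_inner \<sigma> h (\<lambda>\<zeta>. v ((r * r) *\<^sub>R \<zeta>)) = (\<integral>\<xi>. (\<integral>\<zeta>. ?k \<xi> \<zeta> \<partial>torus_measure) \<partial>\<sigma>)"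
      unfolding L2_inner_def
      by (intro Bochner_Integration.integral_cong refl) (simp add: space rep flip: Bochner_Integration.integral_cnj)
    also have "\<dots> = (\<integral>\<zeta>. (\<integral>\<xi>. ?k \<xi> \<zeta> \<partial>\<sigma>) \<partial>torus_measure)"
      by (rule Fubini_integral[OF kint, symmetric])
    also have "\<dots> = (\<integral>\<zeta>. 0 \<partial>(torus_measure :: (complex ^ 'n) measure))"
    proof (intro Bochner_Integration.integral_cong refl)
      fix \<zeta> :: "complex ^ 'n" assume "\<zeta> \<in> space torus_measure"
      then have "r *\<^sub>R \<zeta> \<in> polydisc" using r by (intro scaleR_torus_in_polydisc) simp_all
      \<comment> \<open>Conjugation and moving \<open>r\<close> to the other argument turn the
        integral over \<open>\<xi>\<close> into the Cauchy transform at the interior point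
        \<open>r *\<^sub>R \<zeta>\<close>.\<close>
      have "cnj (cauchy_kernel (r *\<^sub>R \<xi>) \<zeta>) = cauchy_kernel (r *\<^sub>R \<zeta>) \<xi>" for \<xi>
        unfolding cauchy_kernel_cnj by (rule cauchy_kernel_scaleR[symmetric])
      then have "(\<integral>\<xi>. ?k \<xi> \<zeta> \<partial>\<sigma>) = (\<integral>\<xi>. cnj (v (r *\<^sub>R \<zeta>)) * (cauchy_kernel (r *\<^sub>R \<zeta>) \<xi> * h \<xi>) \<partial>\<sigma>)"
        by (intro Bochner_Integration.integral_cong refl) (simp add: mult_ac)
      also have "\<dots> = cnj (v (r *\<^sub>R \<zeta>)) * cauchy_transform \<sigma> h (r *\<^sub>R \<zeta>)"
        by (simp add: cauchy_transform_def)
      also have "\<dots> = 0" using zero[OF \<open>r *\<^sub>R \<zeta> \<in> polydisc\<close>] by simp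
      finally show "(\<integral>\<xi>. ?k \<xi> \<zeta> \<partial>\<sigma>) = 0" .
    qed
    finally show ?thesis by simp
  qed
  obtain B where B: "\<And>z. z \<in> closed_polydisc \<Longrightarrow> norm (v z) \<le> B"
    using compact_imp_bounded[OF compact_continuous_image[OF vc compact_closed_polydisc]]
    unfolding bounded_iff by (meson imageI)
  have rr: "0 \<le> radius m * radius m" "radius m * radius m < 1" for m
    using mult_less_one_real[of "radius m" "radius m"] radius_less_one[of m] radius_pos[of m]
    by (simp_all add: less_imp_le del: radius_pos radius_less_one)
  \<comment> \<open>As the radii tend to 1, the dilates of \<open>v\<close> converge everywhere on
    the torus by continuity on \<open>closed_polydisc\<close> and stay bounded by
    \<open>B\<close>.\<close>
  have "(\<lambda>m. L2_inner \<sigma> h (\<lambda>\<zeta>. v ((radius m * radius m) *\<^sub>R \<zeta>))) \<longlonglongrightarrow> L2_inner \<sigma> h v"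
    unfolding L2_inner_def
  proof (rule integral_dominated_convergence[where w = "\<lambda>\<xi>. norm (h \<xi>) * B"])
    have "v \<in> borel_measurable \<sigma>" by (rule L2_measurable[OF polydisc_algebra_L2[OF fin sets v]])
    then show "(\<lambda>\<xi>. h \<xi> * cnj (v \<xi>)) \<in> borel_measurable \<sigma>"
      by (intro borel_measurable_times borel_measurable_cnj hm)
    show "(\<lambda>\<xi>. h \<xi> * cnj (v ((radius m * radius m) *\<^sub>R \<xi>))) \<in> borel_measurable \<sigma>" for m
      by (intro borel_measurable_times borel_measurable_cnj hm)
        (auto simp: meas_eq intro!: continuous_on_torus_measurable dilation_continuous_torus vh rr)
    show "integrable \<sigma> (\<lambda>\<xi>. norm (h \<xi>) * B)" using hi by simp
    show "AE \<xi> in \<sigma>. (\<lambda>m. h \<xi> * cnj (v ((radius m * radius m) *\<^sub>R \<xi>))) \<longlonglongrightarrow> h \<xi> * cnj (v \<xi>)"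
    proof (rule AE_I2)
      fix \<xi> assume "\<xi> \<in> space \<sigma>"
      then have \<xi>: "\<xi> \<in> torus" by (simp add: space)
      have "(\<lambda>m. radius m * radius m) \<longlonglongrightarrow> 1 * 1" by (intro tendsto_mult radius_tendsto)
      then have "filterlim (\<lambda>m. radius m * radius m) (at_left 1) sequentially"
        unfolding filterlim_at using rr(2) by (auto simp: less_imp_neq)
      from filterlim_compose[OF continuous_closed_polydisc_radial_tendsto[OF vc \<xi>] this]
      show "(\<lambda>m. h \<xi> * cnj (v ((radius m * radius m) *\<^sub>R \<xi>))) \<longlonglongrightarrow> h \<xi> * cnj (v \<xi>)"
        by (intro tendsto_intros)
    qed
    show "AE \<xi> in \<sigma>. norm (h \<xi> * cnj (v ((radius m * radius m) *\<^sub>R \<xi>))) \<le> norm (h \<xi>) * B" for m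
    proof (rule AE_I2)
      fix \<xi> assume "\<xi> \<in> space \<sigma>"
      then have "(radius m * radius m) *\<^sub>R \<xi> \<in> polydisc"
        using rr by (intro scaleR_torus_in_polydisc) (simp_all add: space)
      then show "norm (h \<xi> * cnj (v ((radius m * radius m) *\<^sub>R \<xi>))) \<le> norm (h \<xi>) * B"
        unfolding norm_mult complex_mod_cnj using polydisc_subset_closed_polydisc
        by (intro mult_left_mono B) auto
    qed
  qed
  moreover have "L2_inner \<sigma> h (\<lambda>\<zeta>. v ((radius m * radius m) *\<^sub>R \<zeta>)) = 0" for m
    by (rule dil) (auto simp: less_imp_le)
  ultimately show ?thesis using LIMSEQ_unique[OF tendsto_const] by fastforce
qed

lemma cauchy_transform_injective_iff_dense:
  fixes \<sigma> :: "(complex ^ 'n) measure"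
  assumes fin: "finite_measure \<sigma>" and sets: "sets \<sigma> = sets torus_borel"
  shows "(\<forall>f\<in>L2 \<sigma>. \<not> (AE \<xi> in \<sigma>. f \<xi> = 0) \<longrightarrow> (\<exists>z\<in>polydisc. cauchy_transform \<sigma> f z \<noteq> 0)) \<longleftrightarrow>
    dense_in_L2 polydisc_algebra \<sigma>"
proof
  assume inj: "\<forall>f\<in>L2 \<sigma>. \<not> (AE \<xi> in \<sigma>. f \<xi> = 0) \<longrightarrow> (\<exists>z\<in>polydisc. cauchy_transform \<sigma> f z \<noteq> 0)"
  have "\<exists>v\<in>polydisc_algebra. L2_norm \<sigma> (\<lambda>x. f x - v x) < e" if "f \<in> L2 \<sigma>" "0 < e" for f e
  proof (rule finite_measure.L2_subspace_dense[OF fin _ _ _ _ that])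
    show "polydisc_algebra \<subseteq> L2 \<sigma>" using polydisc_algebra_L2[OF fin sets] by blast
    have "(0 :: complex ^ 'n) \<in> polydisc" by (simp add: polydisc_def)
    then show "(polydisc_algebra :: (complex ^ 'n \<Rightarrow> complex) set) \<noteq> {}"
      using cauchy_kernel_polydisc_algebra by blast
    show "(\<lambda>x. a * u x + b * v x) \<in> polydisc_algebra"
      if "u \<in> polydisc_algebra" "v \<in> polydisc_algebra" for u v :: "complex ^ 'n \<Rightarrow> complex" and a b
      using that by (rule polydisc_algebra_lincomb)
    fix h assume h: "h \<in> L2 \<sigma>" and orth: "\<And>v. v \<in> polydisc_algebra \<Longrightarrow> L2_inner \<sigma> h v = 0"
    have "cauchy_transform \<sigma> h w = 0" if "w \<in> polydisc" for w
      unfolding cauchy_transform_eq_L2_inner by (rule orth[OF cauchy_kernel_polydisc_algebra[OF that]])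
    then show "AE x in \<sigma>. h x = 0" using inj h by blast
  qed
  then show "dense_in_L2 polydisc_algebra \<sigma>"
    unfolding dense_in_L2_def using polydisc_algebra_L2[OF fin sets] by blast
next
  assume dense: "dense_in_L2 polydisc_algebra \<sigma>"
  show "\<forall>f\<in>L2 \<sigma>. \<not> (AE \<xi> in \<sigma>. f \<xi> = 0) \<longrightarrow> (\<exists>z\<in>polydisc. cauchy_transform \<sigma> f z \<noteq> 0)"
  proof (intro ballI impI, rule ccontr)
    fix h assume h: "h \<in> L2 \<sigma>" and nz: "\<not> (AE \<xi> in \<sigma>. h \<xi> = 0)"
      and no: "\<not> (\<exists>z\<in>polydisc. cauchy_transform \<sigma> h z \<noteq> 0)"
    have "L2_inner \<sigma> h v = 0" if "v \<in> polydisc_algebra" for v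
      using no by (intro cauchy_transform_zero_orthogonal[OF fin sets h _ that]) blast
    then have "AE \<xi> in \<sigma>. h \<xi> = 0"
      using dense h unfolding dense_in_L2_def by (intro L2_orthogonal_dense[OF h, of polydisc_algebra]) blast+
    then show False using nz by blast
  qed
qed

section \<open>The range of the Clark operator\<close>

context
  fixes I :: "complex ^ 'n \<Rightarrow> complex" and \<alpha> :: complex and \<sigma> :: "(complex ^ 'n) measure"
    and T :: "(complex ^ 'n \<Rightarrow> complex) \<Rightarrow> (complex ^ 'n \<Rightarrow> complex)"
  assumes inner: "inner_function I" and \<alpha>: "norm \<alpha> = 1"
    and fin: "finite_measure \<sigma>" and sets: "sets \<sigma> = sets torus_borel"
    and clark: "clark_operator I \<alpha> \<sigma> T"
begin

lemma clark_isometry: "linear_isometry_model I \<sigma> T"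
  using clark by (simp add: clark_operator_def)

lemma clark_L2: "f \<in> model_space I \<Longrightarrow> T f \<in> L2 \<sigma>"
  and clark_norm: "f \<in> model_space I \<Longrightarrow> L2_norm \<sigma> (T f) = hardy2_norm f"
  and clark_lincomb: "f \<in> model_space I \<Longrightarrow> g \<in> model_space I \<Longrightarrow>
    AE \<xi> in \<sigma>. T (\<lambda>z. a * f z + b * g z) \<xi> = a * T f \<xi> + b * T g \<xi>"
  using clark_isometry by (auto simp: linear_isometry_model_def)

lemma clark_norm_lincomb:
  assumes f: "f \<in> model_space I" and g: "g \<in> model_space I"
  shows "L2_norm \<sigma> (\<lambda>\<xi>. a * T f \<xi> + b * T g \<xi>) = hardy2_norm (\<lambda>z. a * f z + b * g z)"
proof -
  have m: "(\<lambda>z. a * f z + b * g z) \<in> model_space I" by (rule model_space_lincomb[OF inner f g])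
  have "L2_norm \<sigma> (\<lambda>\<xi>. a * T f \<xi> + b * T g \<xi>) = L2_norm \<sigma> (T (\<lambda>z. a * f z + b * g z))"
  proof (rule L2_norm_cong_AE)
    show "AE x in \<sigma>. a * T f x + b * T g x = T (\<lambda>z. a * f z + b * g z) x"
      using clark_lincomb[OF f g, of a b] by eventually_elim simp
  qed (intro L2_measurable L2_lincomb clark_L2 f g m)+
  then show ?thesis by (simp add: clark_norm[OF m])
qed

text \<open>Polarization: comparing the squared norms of a combination with coefficients 1 and
  \<open>b\<close> leaves a real part, and \<open>b = 1\<close> and \<open>b = \<i>\<close> recover
  the full inner product.\<close>

lemma clark_inner:
  assumes f: "f \<in> model_space I" and g: "g \<in> model_space I"
  shows "L2_inner \<sigma> (T f) (T g) = hardy2_inner f g"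
proof -
  note h = model_space_hardy2[OF inner f] model_space_hardy2[OF inner g]
  have "Re (cnj b * L2_inner \<sigma> (T f) (T g)) = Re (cnj b * hardy2_inner f g)" for b
  proof -
    have "(L2_norm \<sigma> (\<lambda>\<xi>. 1 * T f \<xi> + b * T g \<xi>))\<^sup>2 =
        (L2_norm torus_measure (\<lambda>\<zeta>. 1 * boundary_value f \<zeta> + b * boundary_value g \<zeta>))\<^sup>2"
      unfolding clark_norm_lincomb[OF f g] hardy2_norm_lincomb[OF h] ..
    then show ?thesis
      unfolding L2_norm_lincomb[OF clark_L2[OF f] clark_L2[OF g]]
        L2_norm_lincomb[OF boundary_value_L2[OF h(1)] boundary_value_L2[OF h(2)]]
        clark_norm[OF f] clark_norm[OF g] hardy2_norm_eq hardy2_inner_eq by simp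
  qed
  from this[of 1] this[of \<i>] show ?thesis by (simp add: complex_eq_iff)
qed

text \<open>The scalar \<open>1 - \<alpha> * cnj (I w)\<close> stands in the conjugated slot. The
  resulting factor is nonzero, so orthogonality to the image kernels means a vanishing Cauchy
  transform.\<close>

lemma clark_kernel_inner:
  assumes h: "h \<in> L2 \<sigma>" and w: "w \<in> polydisc"
  shows "L2_inner \<sigma> h (T (model_kernel I w)) = (1 - cnj \<alpha> * I w) * cauchy_transform \<sigma> h w"
proof -
  have k: "(\<lambda>z. cauchy_kernel z w) \<in> L2 \<sigma>" by (rule cauchy_kernel_L2[OF fin sets w])
  have "L2_inner \<sigma> h (T (model_kernel I w)) = L2_inner \<sigma> h (\<lambda>\<xi>. (1 - \<alpha> * cnj (I w)) * cauchy_kernel \<xi> w)"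
  proof (rule L2_inner_cong_AE)
    show "AE \<xi> in \<sigma>. T (model_kernel I w) \<xi> = (1 - \<alpha> * cnj (I w)) * cauchy_kernel \<xi> w"
      using clark w by (simp add: clark_operator_def)
    show "T (model_kernel I w) \<in> borel_measurable \<sigma>"
      by (rule L2_measurable[OF clark_L2[OF model_kernel_in_model_space[OF inner w]]])
    show "(\<lambda>\<xi>. (1 - \<alpha> * cnj (I w)) * cauchy_kernel \<xi> w) \<in> borel_measurable \<sigma>"
      by (rule L2_measurable[OF L2_cmult[OF k]])
  qed (use h in \<open>auto intro: L2_measurable\<close>)
  also have "\<dots> = (\<integral>\<xi>. (1 - cnj \<alpha> * I w) * (cauchy_kernel w \<xi> * h \<xi>) \<partial>\<sigma>)"
    unfolding L2_inner_def
    by (intro Bochner_Integration.integral_cong refl) (simp add: cauchy_kernel_cnj mult_ac)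
  also have "\<dots> = (1 - cnj \<alpha> * I w) * cauchy_transform \<sigma> h w" by (simp add: cauchy_transform_def)
  finally show ?thesis .
qed

lemma clark_factor_nonzero: "w \<in> polydisc \<Longrightarrow> 1 - cnj \<alpha> * I w \<noteq> 0"
  using one_minus_mult_cnj_nonzero[of "I w" \<alpha>] inner_norm_less[OF inner] \<alpha> by (simp add: mult.commute)

lemma unitary_imp_cauchy_transform_injective:
  assumes unitary: "unitary_model I \<sigma> T" and h: "h \<in> L2 \<sigma>"
    and zero: "\<And>w. w \<in> polydisc \<Longrightarrow> cauchy_transform \<sigma> h w = 0"
  shows "AE \<xi> in \<sigma>. h \<xi> = 0"
proof -
  obtain f where f: "f \<in> model_space I" and Tf: "AE \<xi> in \<sigma>. T f \<xi> = h \<xi>"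
    using unitary h by (auto simp: unitary_model_def)
  have f0: "f w = 0" if w: "w \<in> polydisc" for w
  proof -
    note k = model_kernel_in_model_space[OF inner w]
    have "f w = L2_inner \<sigma> (T f) (T (model_kernel I w))"
      by (simp add: clark_inner[OF f k] model_space_reproducing[OF inner f w])
    also have "\<dots> = L2_inner \<sigma> h (T (model_kernel I w))"
      by (rule L2_inner_cong_AE[OF Tf AE_I2[OF refl]]) (use f k h in \<open>auto intro!: L2_measurable clark_L2\<close>)
    also have "\<dots> = 0" by (simp add: clark_kernel_inner[OF h w] zero[OF w])
    finally show ?thesis .
  qed
  \<comment> \<open>\<open>f\<close> is a total function with arbitrary values outside
    \<open>polydisc\<close>, so it need not be literally zero; its norm is estimated through its
    dilates.\<close>
  have "mean_square f r \<le> 0\<^sup>2" if "0 < r" "r < 1" for r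
  proof -
    have "mean_square f r = (\<integral>\<zeta>. 0 \<partial>(torus_measure :: (complex ^ 'n) measure))"
      unfolding mean_square_eq
      using that by (intro Bochner_Integration.integral_cong refl) (simp add: f0 scaleR_torus_in_polydisc)
    then show ?thesis by simp
  qed
  then have "hardy2_norm f \<le> 0" by (intro hardy2_norm_le model_space_hardy2[OF inner f]) auto
  then have "L2_norm \<sigma> (T f) = 0"
    using clark_norm[OF f] L2_norm_nonneg[of \<sigma> "T f"] by linarith
  then have "AE \<xi> in \<sigma>. T f \<xi> = 0" by (rule L2_norm_zero_AE[OF clark_L2[OF f]])
  with Tf show ?thesis by eventually_elim simp
qed

lemma cauchy_transform_injective_imp_unitary:
  assumes inj: "\<And>h. h \<in> L2 \<sigma> \<Longrightarrow> (\<And>w. w \<in> polydisc \<Longrightarrow> cauchy_transform \<sigma> h w = 0) \<Longrightarrow> AE \<xi> in \<sigma>. h \<xi> = 0"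
  shows "unitary_model I \<sigma> T"
proof -
  \<comment> \<open>The range is enlarged by almost everywhere equality: since \<open>T\<close> is
    linear only almost everywhere, the bare image need not contain the combinations of its
    members.\<close>
  define V where "V = {v \<in> L2 \<sigma>. \<exists>f\<in>model_space I. AE \<xi> in \<sigma>. T f \<xi> = v \<xi>}"
  have T_in_V: "T f \<in> V" if "f \<in> model_space I" for f
    using that clark_L2 by (auto simp: V_def)
  have V_dense: "\<exists>v\<in>V. L2_norm \<sigma> (\<lambda>x. h x - v x) < e" if "h \<in> L2 \<sigma>" "0 < e" for h e
  proof (rule finite_measure.L2_subspace_dense[OF fin _ _ _ _ that])
    show "V \<subseteq> L2 \<sigma>" by (auto simp: V_def)
    have "(0 :: complex ^ 'n) \<in> polydisc" by (simp add: polydisc_def)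
    then show "V \<noteq> {}" using T_in_V[OF model_kernel_in_model_space[OF inner]] by blast
    show "(\<lambda>x. a * u x + b * v x) \<in> V" if u: "u \<in> V" and v: "v \<in> V" for u v a b
    proof -
      obtain f where f: "f \<in> model_space I" "AE \<xi> in \<sigma>. T f \<xi> = u \<xi>" using u by (auto simp: V_def)
      obtain g where g: "g \<in> model_space I" "AE \<xi> in \<sigma>. T g \<xi> = v \<xi>" using v by (auto simp: V_def)
      have "AE \<xi> in \<sigma>. T (\<lambda>z. a * f z + b * g z) \<xi> = a * u \<xi> + b * v \<xi>"
        using clark_lincomb[OF f(1) g(1), of a b] f(2) g(2) by eventually_elim simp
      then show ?thesis
        using u v model_space_lincomb[OF inner f(1) g(1)] by (auto simp: V_def intro: L2_lincomb)
    qed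
    fix h assume h: "h \<in> L2 \<sigma>" and orth: "\<And>v. v \<in> V \<Longrightarrow> L2_inner \<sigma> h v = 0"
    have "cauchy_transform \<sigma> h w = 0" if w: "w \<in> polydisc" for w
      using orth[OF T_in_V[OF model_kernel_in_model_space[OF inner w]]] clark_factor_nonzero[OF w]
      by (simp add: clark_kernel_inner[OF h w])
    then show "AE x in \<sigma>. h x = 0" by (rule inj[OF h])
  qed
  have "\<exists>f\<in>model_space I. AE \<xi> in \<sigma>. T f \<xi> = h \<xi>" if h: "h \<in> L2 \<sigma>" for h
  proof -
    \<comment> \<open>The isometry turns convergence of the images to \<open>h\<close> into the
      Cauchy property of the preimages; the image of their limit then agrees with
      \<open>h\<close>.\<close>
    have "\<exists>f\<in>model_space I. L2_norm \<sigma> (\<lambda>\<xi>. h \<xi> - T f \<xi>) < inverse (real (Suc m))" for m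
    proof -
      obtain v f where v: "v \<in> L2 \<sigma>" "L2_norm \<sigma> (\<lambda>\<xi>. h \<xi> - v \<xi>) < inverse (real (Suc m))"
        and f: "f \<in> model_space I" "AE \<xi> in \<sigma>. T f \<xi> = v \<xi>"
        using V_dense[OF h, of "inverse (real (Suc m))"] by (auto simp: V_def)
      have "L2_norm \<sigma> (\<lambda>\<xi>. h \<xi> - T f \<xi>) = L2_norm \<sigma> (\<lambda>\<xi>. h \<xi> - v \<xi>)"
      proof (rule L2_norm_cong_AE)
        show "AE \<xi> in \<sigma>. h \<xi> - T f \<xi> = h \<xi> - v \<xi>" using f(2) by eventually_elim simp
      qed (intro L2_measurable L2_diff h v(1) clark_L2 f(1))+
      then show ?thesis using v(2) f(1) by (intro bexI[of _ f]) simp_all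
    qed
    then obtain f where f: "\<And>m. f m \<in> model_space I"
      and hf: "\<And>m. L2_norm \<sigma> (\<lambda>\<xi>. h \<xi> - T (f m) \<xi>) < inverse (real (Suc m))" by metis
    have T_diff: "L2_norm \<sigma> (\<lambda>\<xi>. T u \<xi> - T v \<xi>) = hardy2_norm (\<lambda>z. u z - v z)"
      if "u \<in> model_space I" "v \<in> model_space I" for u v
      using clark_norm_lincomb[OF that, of 1 "-1"] by simp
    have hf_lim: "(\<lambda>m. L2_norm \<sigma> (\<lambda>\<xi>. h \<xi> - T (f m) \<xi>)) \<longlonglongrightarrow> 0"
      by (rule tendsto_sandwich[OF _ _ tendsto_const LIMSEQ_inverse_real_of_nat])
        (simp, rule always_eventually, rule allI, rule less_imp_le[OF hf])
    obtain F where F: "F \<in> model_space I" and F_lim: "(\<lambda>m. hardy2_norm (\<lambda>z. F z - f m z)) \<longlonglongrightarrow> 0"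
    proof (rule model_space_complete[OF inner f])
      fix e :: real assume "0 < e"
      then obtain N where N: "\<And>m. m \<ge> N \<Longrightarrow> L2_norm \<sigma> (\<lambda>\<xi>. h \<xi> - T (f m) \<xi>) < e / 2"
        using order_tendstoD(2)[OF hf_lim, of "e / 2"] by (auto simp: eventually_sequentially)
      have "hardy2_norm (\<lambda>z. f m z - f l z) < e" if "m \<ge> N" "l \<ge> N" for m l
      proof -
        have "hardy2_norm (\<lambda>z. f m z - f l z) \<le>
            L2_norm \<sigma> (\<lambda>\<xi>. T (f m) \<xi> - h \<xi>) + L2_norm \<sigma> (\<lambda>\<xi>. h \<xi> - T (f l) \<xi>)"
          unfolding T_diff[OF f f, symmetric] by (intro L2_norm_triangle_diff clark_L2 f h)
        also have "\<dots> < e / 2 + e / 2"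
          using N[OF that(1)] N[OF that(2)] by (intro add_strict_mono) (simp_all add: L2_norm_minus_commute[of _ _ h])
        finally show ?thesis by simp
      qed
      then show "\<exists>N. \<forall>m\<ge>N. \<forall>l\<ge>N. hardy2_norm (\<lambda>z. f m z - f l z) < e" by blast
    qed
    have "L2_norm \<sigma> (\<lambda>\<xi>. T F \<xi> - h \<xi>) \<le> 0"
    proof (rule LIMSEQ_le_const)
      show "(\<lambda>m. hardy2_norm (\<lambda>z. F z - f m z) + L2_norm \<sigma> (\<lambda>\<xi>. h \<xi> - T (f m) \<xi>)) \<longlonglongrightarrow> 0"
        using tendsto_add[OF F_lim hf_lim] by simp
      have "L2_norm \<sigma> (\<lambda>\<xi>. T F \<xi> - h \<xi>) \<le> hardy2_norm (\<lambda>z. F z - f m z) + L2_norm \<sigma> (\<lambda>\<xi>. h \<xi> - T (f m) \<xi>)" for m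
        using L2_norm_triangle_diff[OF clark_L2[OF F] clark_L2[OF f] h, of m]
        unfolding T_diff[OF F f] by (simp only: L2_norm_minus_commute[of _ _ h])
      then show "\<exists>N. \<forall>m\<ge>N. L2_norm \<sigma> (\<lambda>\<xi>. T F \<xi> - h \<xi>) \<le>
          hardy2_norm (\<lambda>z. F z - f m z) + L2_norm \<sigma> (\<lambda>\<xi>. h \<xi> - T (f m) \<xi>)" by blast
    qed
    then have "L2_norm \<sigma> (\<lambda>\<xi>. T F \<xi> - h \<xi>) = 0" using L2_norm_nonneg[of \<sigma>] by (simp add: antisym)
    then have "AE \<xi> in \<sigma>. T F \<xi> - h \<xi> = 0" by (rule L2_norm_zero_AE[OF L2_diff[OF clark_L2[OF F] h]])
    then show ?thesis using F by auto
  qed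
  then show ?thesis using clark_isometry by (simp add: unitary_model_def)
qed

end

theorem theorem3p2:
  fixes I :: "complex ^ 'n \<Rightarrow> complex"
    and \<alpha> :: complex
    and \<sigma> :: "(complex ^ 'n) measure"
    and T :: "(complex ^ 'n \<Rightarrow> complex) \<Rightarrow> (complex ^ 'n \<Rightarrow> complex)"
  assumes "CARD('n) \<ge> 2"
    and "inner_function I"
    and "norm \<alpha> = 1"
    and "clark_measure I \<alpha> \<sigma>"
    and "clark_operator I \<alpha> \<sigma> T"
  shows "(unitary_model I \<sigma> T \<longleftrightarrow>
            (\<forall>f\<in>L2 \<sigma>. \<not> (AE \<xi> in \<sigma>. f \<xi> = 0) \<longrightarrow>
               (\<exists>z\<in>polydisc. cauchy_transform \<sigma> f z \<noteq> 0))) \<and>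
         (unitary_model I \<sigma> T \<longleftrightarrow> dense_in_L2 polydisc_algebra \<sigma>)"
proof -
  have \<sigma>: "finite_measure \<sigma>" "sets \<sigma> = sets torus_borel"
    using assms(4) by (auto simp: clark_measure_def)
  note clark = assms(2,3) \<sigma> assms(5)
  have "unitary_model I \<sigma> T \<longleftrightarrow>
      (\<forall>f\<in>L2 \<sigma>. \<not> (AE \<xi> in \<sigma>. f \<xi> = 0) \<longrightarrow> (\<exists>z\<in>polydisc. cauchy_transform \<sigma> f z \<noteq> 0))"
    using unitary_imp_cauchy_transform_injective[OF clark] cauchy_transform_injective_imp_unitary[OF clark]
    by blast
  then show ?thesis using cauchy_transform_injective_iff_dense[OF \<sigma>] by simp
qed

end
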